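(* Let $n\ge 1$ and let $(M,\mathcal{D},g)$ be one of the $(2n+1)$-dimensional contact sub-Riemannian model spaces: the Heisenberg group $\mathbb{H}^n$ ($M=\mathbb{R}^{2n+1}$), the sphere $M=S^{2n+1}$ with parameter $k>0$, or the anti-de Sitter space $M=H^{2n+1}$ with parameter $k>0$. Let $S$ be the model hypersurface in $(M,\mathcal{D},g)$, let $C(S)$ be its set of characteristic points, and let $\Delta$ be the intrinsic sub-Laplacian on $S\setminus C(S)$. Then the radial part of the stochastic process with generator $\frac12\Delta$ on $S\setminus C(S)$ is (i) the Bessel process of order $2n+1$ if $M=\mathbb{R}^{2n+1}$; (ii) a Legendre process of order $2n+1$ if $M=S^{2n+1}$; (iii) a hyperbolic Bessel process of order $2n+1$ if $M=H^{2n+1}$.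
   Context: General definitions. For a contact form $\omega$ on $M$ ($\dim M=2n+1$) with contact structure $\mathcal{D}=\ker\omega$ and fibre inner product $g$ on $\mathcal{D}$, $M$ is oriented by $\Omega=\omega\wedge(\mathrm{d}\omega)^n$. For an oriented hypersurface $S\subset M$, $C(S)=\{x\in S:T_xS=\mathcal{D}_x\}$ and $\mathcal{F}=\mathcal{D}\cap TS$ on $S\setminus C(S)$. The sub-Riemannian normal $N$ along $S\setminus C(S)$ is the vector field with $\omega(N)=0$, $g(N,N)=1$, $g(N,Y)=0$ for all $Y$ in $\mathcal{F}$, such that $(N,Z_1,\dots,Z_{2n})$ is positively oriented in $M$ for every positively oriented local frame $(Z_1,\dots,Z_{2n})$ of $S\setminus C(S)$. Set $\mu=\iota_N\Omega$ on $S\setminus C(S)$. For smooth $f$ on $S\setminus C(S)$, the horizontal gradient $\nabla_Sf$ is the unique vector field in $\mathcal{F}$ with $g(\nabla_Sf,Y)=\mathrm{d}f(Y)$ for all $Y$ in $\mathcal{F}$, and the intrinsic sub-Laplacian is $\Delta f=\operatorname{div}_\mu(\nabla_Sf)$ (it does not depend on the choice of orientation of $S$). Model spaces and model hypersurfaces (all contact forms below satisfy the normalisation $(\mathrm{d}\omega)^n|_{\mathcal{D}}=n!\,\mathrm{vol}_g$), together with the radial coordinate $r$ on $S\setminus C(S)$: (1) Heisenberg group: $M=\mathbb{R}^{2n+1}$ with coordinates $(x_1,\dots,x_{2n+1})$, $\omega=\frac12\sum_{m=1}^n(x_{2m-1}\mathrm{d}x_{2m}-x_{2m}\mathrm{d}x_{2m-1})-\mathrm{d}x_{2n+1}$,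 $\mathcal{D}=\ker\omega$, $g=\sum_{i=1}^{2n}\mathrm{d}x_i\otimes\mathrm{d}x_i$ on $\mathcal{D}$. Model hypersurface: $S=\{x_{2n+1}=0\}$, with $C(S)=\{0\}$. Radial coordinate: $r=\sqrt{\sum_{i=1}^{2n}x_i^2}\in(0,\infty)$. (2) Sphere with parameter $k>0$: $M=S^{2n+1}=\{x\in\mathbb{R}^{2n+2}:\sum_{i=1}^{2n+2}x_i^2=1\}$, $\omega=\frac{1}{2k^2}\sum_{m=1}^{n+1}(x_{2m-1}\mathrm{d}x_{2m}-x_{2m}\mathrm{d}x_{2m-1})$ restricted to $S^{2n+1}$, $\mathcal{D}=\ker\omega$, $g=\frac{1}{k^2}\langle\cdot,\cdot\rangle|_{\mathcal{D}}$ with $\langle\cdot,\cdot\rangle$ the Euclidean inner product. Model hypersurface: $S=S^{2n+1}\cap\{x_{2n+2}=0\}$; $C(S)$ consists of the two points with $x_1=\dots=x_{2n}=0$, $x_{2n+1}=\pm1$. Radial coordinate: $r\in(0,\frac{\pi}{k})$ with $x_{2n+1}=\cos(kr)$. (3) Anti-de Sitter space with parameter $k>0$: $M=H^{2n+1}=\{x\in\mathbb{R}^{2n+2}:\sum_{i=1}^{2n}x_i^2-x_{2n+1}^2-x_{2n+2}^2=-1\}$, $\omega=\frac{1}{2k^2}\sum_{m=1}^{n+1}(x_{2m-1}\mathrm{d}x_{2m}-x_{2m}\mathrm{d}x_{2m-1})$ restricted to $H^{2n+1}$, $\mathcal{D}=\ker\omega$, $g=\frac1{k^2}\eta|_{\mathcal{D}}$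 with $\eta=\sum_{i=1}^{2n}\mathrm{d}x_i\otimes\mathrm{d}x_i-\mathrm{d}x_{2n+1}\otimes\mathrm{d}x_{2n+1}-\mathrm{d}x_{2n+2}\otimes\mathrm{d}x_{2n+2}$ (which is positive definite on $\mathcal{D}$). Model hypersurface: $S=H^{2n+1}\cap\{x_{2n+2}=0,\ x_{2n+1}>0\}$; $C(S)$ is the single point with $x_1=\dots=x_{2n}=0$, $x_{2n+1}=1$. Radial coordinate: $r\in(0,\infty)$ with $x_{2n+1}=\cosh(kr)$. Radial part: if $(X_t)$ is the diffusion process on $S\setminus C(S)$ with generator $\frac12\Delta$ (defined up to its lifetime), its radial part is the one-dimensional process $(r(X_t))$. One-dimensional processes: the Bessel process of order $d$ is the diffusion on $(0,\infty)$ with generator $\frac12\frac{\partial^2}{\partial r^2}+\frac{d-1}{2r}\frac{\partial}{\partial r}$. A Legendre process of order $d$ (with parameter $k>0$, here that of the model space) is the diffusion on $(0,\frac{\pi}{k})$ with generator $\frac12\frac{\partial^2}{\partial r^2}+\frac{d-1}{2}k\cot(kr)\frac{\partial}{\partial r}$. A hyperbolic Bessel process of order $d$ (with parameter $k>0$, here that of the model space) is the diffusion on $(0,\infty)$ with generator $\frac12\frac{\partial^2}{\partial r^2}+\frac{d-1}{2}k\coth(kr)\frac{\partial}{\partial r}$. *)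

theory Defs
  imports "HOL-Probability.Probability"
begin

section \<open>Calculus along embedded submanifolds\<close>

text \<open>
  All manifolds are embedded submanifolds of a Euclidean space. A \<open>k\<close>-form along \<open>E\<close> is a function
  taking a point and a list of \<open>k\<close> ambient vectors; only its values on tangent vectors of \<open>E\<close>
  matter.
\<close>

text \<open>For an embedded submanifold, curves that are merely differentiable at the base point have
  the same velocities as smooth curves.\<close>

definition tangent_space :: "'a::euclidean_space set \<Rightarrow> 'a \<Rightarrow> 'a set" where
  "tangent_space E x = {v. \<exists>\<gamma> :: real \<Rightarrow> 'a. \<gamma> 0 = x \<and> (\<forall>\<^sub>F t in nhds 0. \<gamma> t \<in> E)
     \<and> (\<gamma> has_vector_derivative v) (at 0)}"

definition is_frame :: "nat \<Rightarrow> 'a::euclidean_space set \<Rightarrow> 'a \<Rightarrow> 'a list \<Rightarrow> bool" where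
  "is_frame m E x vs \<longleftrightarrow>
     length vs = m \<and> distinct vs \<and> independent (set vs) \<and> span (set vs) = tangent_space E x"

primrec Ck_on :: "nat \<Rightarrow> 'a::euclidean_space set \<Rightarrow> ('a \<Rightarrow> real) \<Rightarrow> bool" where
  "Ck_on 0 U f \<longleftrightarrow> continuous_on U f"
| "Ck_on (Suc k) U f \<longleftrightarrow>
     f differentiable_on U \<and> (\<forall>v. Ck_on k U (\<lambda>x. frechet_derivative f (at x) v))"

definition smooth_along :: "'a::euclidean_space set \<Rightarrow> ('a \<Rightarrow> real) \<Rightarrow> bool" where
  "smooth_along E f \<longleftrightarrow>
     (\<forall>x\<in>E. \<exists>U h. open U \<and> x \<in> U \<and> (\<forall>k. Ck_on k U h) \<and> (\<forall>y\<in>U \<inter> E. h y = f y))"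

text \<open>
  The derivative of a function along \<open>E\<close> at \<open>x\<close> in direction \<open>v\<close> is
  \<^term>\<open>frechet_derivative f (at x within E) v\<close>. The linear map itself need not be unique when \<open>E\<close> has
  positive codimension, but its values at tangent vectors \<open>v\<close> of \<open>E\<close> are.

  The exterior derivative below is the flat formula
  \<open>d\<alpha>(v\<^sub>0,\<dots>,v\<^sub>k) = \<Sum>\<^sub>i (-1)\<^sup>i D\<^bsub>v\<^sub>i\<^esub> (\<alpha>(v\<^sub>0,\<dots>,v\<^sub>i\<^sub>-\<^sub>1,v\<^sub>i\<^sub>+\<^sub>1,\<dots>,v\<^sub>k))\<close>, where the ambient vectors \<open>v\<^sub>j\<close> are kept constant.
  Since exterior differentiation commutes with restriction to \<open>E\<close>, its values at tangent vectors of \<open>E\<close>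
  are those of the exterior derivative on \<open>E\<close> of the restriction of \<open>\<alpha>\<close>, for every \<open>\<alpha>\<close> that is
  differentiable along \<open>E\<close> and multilinear and alternating in the ambient vectors.
\<close>

definition ext_deriv ::
    "'a::euclidean_space set \<Rightarrow> ('a \<Rightarrow> 'a list \<Rightarrow> real) \<Rightarrow> 'a \<Rightarrow> 'a list \<Rightarrow> real" where
  "ext_deriv E \<alpha> x vs =
     (\<Sum>i<length vs. (-1) ^ i *
        frechet_derivative (\<lambda>y. \<alpha> y (take i vs @ drop (Suc i) vs)) (at x within E) (vs ! i))"

definition interior_product ::
    "('a \<Rightarrow> 'a) \<Rightarrow> ('a \<Rightarrow> 'a list \<Rightarrow> real) \<Rightarrow> 'a \<Rightarrow> 'a list \<Rightarrow> real" where
  "interior_product X \<alpha> x vs = \<alpha> x (X x # vs)"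

text \<open>The divergence of \<open>X\<close> with respect to a volume form \<open>\<mu>\<close> on the \<open>m\<close>-dimensional \<open>E\<close> is given by
  \<open>L\<^sub>X \<mu> = div\<^sub>\<mu>(X) \<mu>\<close>, and \<open>L\<^sub>X \<mu> = d(\<iota>\<^sub>X \<mu>)\<close> as \<open>\<mu>\<close> has top degree.\<close>

definition divergence ::
    "nat \<Rightarrow> 'a::euclidean_space set \<Rightarrow> ('a \<Rightarrow> 'a list \<Rightarrow> real) \<Rightarrow> ('a \<Rightarrow> 'a) \<Rightarrow> 'a \<Rightarrow> real" where
  "divergence m E \<mu> X x =
     (THE c. \<forall>vs. length vs = m \<and> set vs \<subseteq> tangent_space E x \<longrightarrow>
        ext_deriv E (interior_product X \<mu>) x vs = c * \<mu> x vs)"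

text \<open>An orientation of the \<open>m\<close>-dimensional \<open>E\<close> is given by a continuous nowhere vanishing \<open>m\<close>-form
  \<open>\<theta>\<close>; a frame \<open>vs\<close> at \<open>x\<close> is positively oriented iff \<^term>\<open>\<theta> x vs > 0\<close>.\<close>

definition orientation_form ::
    "nat \<Rightarrow> 'a::euclidean_space set \<Rightarrow> ('a \<Rightarrow> 'a list \<Rightarrow> real) \<Rightarrow> bool" where
  "orientation_form m E \<theta> \<longleftrightarrow>
     (\<forall>x\<in>E.
        (\<forall>vs. length vs = m \<and> set vs \<subseteq> tangent_space E x \<longrightarrow>
           (\<forall>i<m. \<forall>u\<in>tangent_space E x. \<forall>v\<in>tangent_space E x. \<forall>a b.
              \<theta> x (vs[i := a *\<^sub>R u + b *\<^sub>R v]) = a * \<theta> x (vs[i := u]) + b * \<theta> x (vs[i := v])) \<and>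
           (\<not> distinct vs \<longrightarrow> \<theta> x vs = 0)) \<and>
        (\<forall>vs. is_frame m E x vs \<longrightarrow> \<theta> x vs \<noteq> 0)) \<and>
     (\<forall>U Z. openin (top_of_set E) U \<and>
        (\<forall>i<m. continuous_on U (Z i) \<and> (\<forall>x\<in>U. Z i x \<in> tangent_space E x)) \<longrightarrow>
        continuous_on U (\<lambda>x. \<theta> x (map (\<lambda>i. Z i x) [0..<m])))"


section \<open>Contact sub-Riemannian manifolds and their hypersurfaces\<close>

text \<open>A \<open>(2n+1)\<close>-dimensional contact sub-Riemannian manifold embedded in \<open>'a\<close>. The contact form is given
  as (the restriction of) an ambient one-form; the metric is only relevant on the contact planes.\<close>

record 'a contact_sr =
  half_rank :: nat
  points :: "'a set"
  contact_form :: "'a \<Rightarrow> 'a \<Rightarrow> real"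
  metric :: "'a \<Rightarrow> 'a \<Rightarrow> 'a \<Rightarrow> real"

definition distribution :: "'a::euclidean_space contact_sr \<Rightarrow> 'a \<Rightarrow> 'a set" where
  "distribution C x = {v \<in> tangent_space (points C) x. contact_form C x v = 0}"

definition contact_form_deriv :: "'a::euclidean_space contact_sr \<Rightarrow> 'a \<Rightarrow> 'a \<Rightarrow> 'a \<Rightarrow> real" where
  "contact_form_deriv C x u v = ext_deriv UNIV (\<lambda>y ws. contact_form C y (ws ! 0)) x [u, v]"

text \<open>\<open>\<Omega> = \<omega> \<and> (d\<omega>)\<^sup>n\<close>: the wedge product of forms \<open>\<alpha>\<^sub>0,\<dots>,\<alpha>\<^sub>n\<close> of degrees \<open>k\<^sub>0,\<dots>,k\<^sub>n\<close> is the signed sum over all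
  permutations of the arguments of \<open>\<alpha>\<^sub>0 \<otimes> \<cdots> \<otimes> \<alpha>\<^sub>n\<close>, divided by \<open>k\<^sub>0! \<cdots> k\<^sub>n!\<close>, which is \<open>2\<^sup>n\<close> here.\<close>

definition contact_volume :: "'a::euclidean_space contact_sr \<Rightarrow> 'a \<Rightarrow> 'a list \<Rightarrow> real" where
  "contact_volume C x vs =
     (let n = half_rank C in
      (1 / 2 ^ n) * (\<Sum>\<sigma> | \<sigma> permutes {..2 * n}. of_int (sign \<sigma>) *
         contact_form C x (vs ! \<sigma> 0) *
         (\<Prod>i<n. contact_form_deriv C x (vs ! \<sigma> (2 * i + 1)) (vs ! \<sigma> (2 * i + 2)))))"

definition characteristic_points :: "'a::euclidean_space contact_sr \<Rightarrow> 'a set \<Rightarrow> 'a set" where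
  "characteristic_points C S = {x \<in> S. tangent_space S x = distribution C x}"

definition noncharacteristic :: "'a::euclidean_space contact_sr \<Rightarrow> 'a set \<Rightarrow> 'a set" where
  "noncharacteristic C S = S - characteristic_points C S"

definition foliation :: "'a::euclidean_space contact_sr \<Rightarrow> 'a set \<Rightarrow> 'a \<Rightarrow> 'a set" where
  "foliation C S x = distribution C x \<inter> tangent_space S x"

text \<open>In the following, \<open>\<theta>\<close> is an orientation form of the hypersurface \<open>S\<close>, and \<open>points C\<close> is oriented
  by \<open>\<Omega>\<close>.\<close>

definition sr_normal ::
    "'a::euclidean_space contact_sr \<Rightarrow> 'a set \<Rightarrow> ('a \<Rightarrow> 'a list \<Rightarrow> real) \<Rightarrow> 'a \<Rightarrow> 'a" where
  "sr_normal C S \<theta> x = (THE N.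
     N \<in> tangent_space (points C) x \<and> contact_form C x N = 0 \<and> metric C x N N = 1 \<and>
     (\<forall>Y\<in>foliation C S x. metric C x N Y = 0) \<and>
     (\<forall>Zs. is_frame (2 * half_rank C) S x Zs \<and> \<theta> x Zs > 0 \<longrightarrow> contact_volume C x (N # Zs) > 0))"

definition hypersurface_volume ::
    "'a::euclidean_space contact_sr \<Rightarrow> 'a set \<Rightarrow> ('a \<Rightarrow> 'a list \<Rightarrow> real) \<Rightarrow> 'a \<Rightarrow> 'a list \<Rightarrow> real" where
  "hypersurface_volume C S \<theta> = interior_product (sr_normal C S \<theta>) (contact_volume C)"

definition horizontal_gradient ::
    "'a::euclidean_space contact_sr \<Rightarrow> 'a set \<Rightarrow> ('a \<Rightarrow> real) \<Rightarrow> 'a \<Rightarrow> 'a" where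
  "horizontal_gradient C S f x = (THE G. G \<in> foliation C S x \<and>
     (\<forall>Y\<in>foliation C S x.
        metric C x G Y = frechet_derivative f (at x within noncharacteristic C S) Y))"

definition sub_laplacian ::
    "'a::euclidean_space contact_sr \<Rightarrow> 'a set \<Rightarrow> ('a \<Rightarrow> 'a list \<Rightarrow> real) \<Rightarrow> ('a \<Rightarrow> real) \<Rightarrow> 'a \<Rightarrow> real" where
  "sub_laplacian C S \<theta> f = divergence (2 * half_rank C) (noncharacteristic C S)
     (hypersurface_volume C S \<theta>) (horizontal_gradient C S f)"


section \<open>Model spaces and model hypersurfaces\<close>

text \<open>
  With \<open>n = CARD('n)\<close>, the space \<open>\<real>\<^sup>2\<^sup>n\<close> is written as \<^typ>\<open>(real^'n) \<times> (real^'n)\<close>, a point of which is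
  \<open>(x, y)\<close> with \<open>x $ m\<close> standing for the coordinate \<open>x\<^bsub>2m-1\<^esub>\<close> and \<open>y $ m\<close> for \<open>x\<^bsub>2m\<^esub>\<close>. The remaining
  coordinates are \<open>t = x\<^bsub>2n+1\<^esub>\<close>, respectively \<open>a = x\<^bsub>2n+1\<^esub>\<close> and \<open>b = x\<^bsub>2n+2\<^esub>\<close>.
\<close>

definition heisenberg :: "((real^'n::finite) \<times> (real^'n) \<times> real) contact_sr" where
  "heisenberg = \<lparr> half_rank = CARD('n), points = UNIV,
     contact_form = (\<lambda>(x, y, t) (u, v, s). (1/2) * (\<Sum>m\<in>UNIV. x $ m * v $ m - y $ m * u $ m) - s),
     metric = (\<lambda>_ (u, v, s) (u', v', s'). \<Sum>m\<in>UNIV. u $ m * u' $ m + v $ m * v' $ m) \<rparr>"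

definition heisenberg_surface :: "((real^'n::finite) \<times> (real^'n) \<times> real) set" where
  "heisenberg_surface = {(x, y, t). t = 0}"

definition heisenberg_radius :: "(real^'n::finite) \<times> (real^'n) \<times> real \<Rightarrow> real" where
  "heisenberg_radius = (\<lambda>(x, y, t). sqrt (\<Sum>m\<in>UNIV. (x $ m)\<^sup>2 + (y $ m)\<^sup>2))"

definition sphere_model :: "real \<Rightarrow> ((real^'n::finite) \<times> (real^'n) \<times> real \<times> real) contact_sr" where
  "sphere_model k = \<lparr> half_rank = CARD('n),
     points = {(x, y, a, b). (\<Sum>m\<in>UNIV. (x $ m)\<^sup>2 + (y $ m)\<^sup>2) + a\<^sup>2 + b\<^sup>2 = 1},
     contact_form = (\<lambda>(x, y, a, b) (u, v, c, d).
       (1 / (2 * k\<^sup>2)) * ((\<Sum>m\<in>UNIV. x $ m * v $ m - y $ m * u $ m) + (a * d - b * c))),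
     metric = (\<lambda>_ (u, v, c, d) (u', v', c', d').
       (1 / k\<^sup>2) * ((\<Sum>m\<in>UNIV. u $ m * u' $ m + v $ m * v' $ m) + c * c' + d * d')) \<rparr>"

definition sphere_surface :: "real \<Rightarrow> ((real^'n::finite) \<times> (real^'n) \<times> real \<times> real) set" where
  "sphere_surface k = points (sphere_model k) \<inter> {(x, y, a, b). b = 0}"

definition sphere_radius :: "real \<Rightarrow> (real^'n::finite) \<times> (real^'n) \<times> real \<times> real \<Rightarrow> real" where
  "sphere_radius k = (\<lambda>(x, y, a, b). THE r. 0 < r \<and> r < pi / k \<and> a = cos (k * r))"

definition anti_de_sitter :: "real \<Rightarrow> ((real^'n::finite) \<times> (real^'n) \<times> real \<times> real) contact_sr" where
  "anti_de_sitter k = \<lparr> half_rank = CARD('n),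
     points = {(x, y, a, b). (\<Sum>m\<in>UNIV. (x $ m)\<^sup>2 + (y $ m)\<^sup>2) - a\<^sup>2 - b\<^sup>2 = -1},
     contact_form = (\<lambda>(x, y, a, b) (u, v, c, d).
       (1 / (2 * k\<^sup>2)) * ((\<Sum>m\<in>UNIV. x $ m * v $ m - y $ m * u $ m) + (a * d - b * c))),
     metric = (\<lambda>_ (u, v, c, d) (u', v', c', d').
       (1 / k\<^sup>2) * ((\<Sum>m\<in>UNIV. u $ m * u' $ m + v $ m * v' $ m) - c * c' - d * d')) \<rparr>"

definition anti_de_sitter_surface :: "real \<Rightarrow> ((real^'n::finite) \<times> (real^'n) \<times> real \<times> real) set" where
  "anti_de_sitter_surface k = points (anti_de_sitter k) \<inter> {(x, y, a, b). b = 0 \<and> a > 0}"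

definition anti_de_sitter_radius :: "real \<Rightarrow> (real^'n::finite) \<times> (real^'n) \<times> real \<times> real \<Rightarrow> real" where
  "anti_de_sitter_radius k = (\<lambda>(x, y, a, b). THE r. 0 < r \<and> a = cosh (k * r))"


section \<open>Diffusions\<close>

definition martingale ::
    "'w measure \<Rightarrow> (real \<Rightarrow> 'w measure) \<Rightarrow> (real \<Rightarrow> 'w \<Rightarrow> real) \<Rightarrow> bool" where
  "martingale P F Y \<longleftrightarrow>
     (\<forall>t\<ge>0. Y t \<in> borel_measurable (F t) \<and> integrable P (Y t)) \<and>
     (\<forall>s t. 0 \<le> s \<and> s \<le> t \<longrightarrow> (AE w in P. real_cond_exp P (F s) (Y t) w = Y s w))"

definition test_functions :: "'a::euclidean_space set \<Rightarrow> ('a \<Rightarrow> real) set" where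
  "test_functions E =
     {f. smooth_along E f \<and> (\<exists>K. compact K \<and> K \<subseteq> E \<and> (\<forall>x\<in>E - K. f x = 0))}"

text \<open>The process \<open>h(X\<^sub>t)\<close>, where \<open>h\<close> is extended by zero to the cemetery state.\<close>

definition before_lifetime ::
    "('w \<Rightarrow> ereal) \<Rightarrow> (real \<Rightarrow> 'w \<Rightarrow> 'a) \<Rightarrow> ('a \<Rightarrow> real) \<Rightarrow> real \<Rightarrow> 'w \<Rightarrow> real" where
  "before_lifetime \<zeta> X h t w = (if ereal t < \<zeta> w then h (X t w) else 0)"

text \<open>
  A diffusion on \<open>E\<close> with generator \<open>L\<close>, defined up to its lifetime \<open>\<zeta>\<close>: an adapted process with continuous
  paths in \<open>E\<close> on \<open>[0,\<zeta>)\<close> that leave every compact subset of \<open>E\<close> as \<open>t \<up> \<zeta>\<close> if \<open>\<zeta> < \<infinity>\<close>, and which solves the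
  martingale problem for \<open>L\<close> on the smooth compactly supported functions. The time set is \<open>[0,\<infinity>)\<close>; the
  \<open>\<sigma>\<close>-algebras \<open>F t\<close> with \<open>t < 0\<close> and the values \<open>X t w\<close> with \<open>t < 0\<close> or \<open>t \<ge> \<zeta> w\<close> play no role.
\<close>

definition diffusion ::
    "'w measure \<Rightarrow> (real \<Rightarrow> 'w measure) \<Rightarrow> 'a::euclidean_space set \<Rightarrow>
     (('a \<Rightarrow> real) \<Rightarrow> 'a \<Rightarrow> real) \<Rightarrow> ('w \<Rightarrow> ereal) \<Rightarrow> (real \<Rightarrow> 'w \<Rightarrow> 'a) \<Rightarrow> bool" where
  "diffusion P F E L \<zeta> X \<longleftrightarrow>
     prob_space P \<and> filtration (space P) F \<and> (\<forall>t. sets (F t) \<subseteq> sets P) \<and>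
     (\<forall>w\<in>space P. 0 < \<zeta> w) \<and>
     (\<forall>w\<in>space P. \<forall>t\<ge>0. ereal t < \<zeta> w \<longrightarrow> X t w \<in> E) \<and>
     (\<forall>w\<in>space P. continuous_on {t. 0 \<le> t \<and> ereal t < \<zeta> w} (\<lambda>t. X t w)) \<and>
     (\<forall>t\<ge>0. \<forall>B\<in>sets borel. {w \<in> space P. ereal t < \<zeta> w \<and> X t w \<in> B} \<in> sets (F t)) \<and>
     (\<forall>w\<in>space P. \<zeta> w < \<infinity> \<longrightarrow>
        (\<forall>K. compact K \<and> K \<subseteq> E \<longrightarrow> (\<forall>\<^sub>F t in at_left (real_of_ereal (\<zeta> w)). X t w \<notin> K))) \<and>
     (\<forall>f\<in>test_functions E. martingale P F (\<lambda>t w.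
        before_lifetime \<zeta> X f t w - f (X 0 w) - (LINT s:{0..t}|lborel. before_lifetime \<zeta> X (L f) s w)))"

definition bessel_process ::
    "real \<Rightarrow> 'w measure \<Rightarrow> (real \<Rightarrow> 'w measure) \<Rightarrow> ('w \<Rightarrow> ereal) \<Rightarrow> (real \<Rightarrow> 'w \<Rightarrow> real) \<Rightarrow> bool" where
  "bessel_process d P F \<zeta> R \<longleftrightarrow> diffusion P F {0<..}
     (\<lambda>f r. (1/2) * deriv (deriv f) r + (d - 1) / (2 * r) * deriv f r) \<zeta> R"

definition legendre_process ::
    "real \<Rightarrow> real \<Rightarrow> 'w measure \<Rightarrow> (real \<Rightarrow> 'w measure) \<Rightarrow> ('w \<Rightarrow> ereal) \<Rightarrow> (real \<Rightarrow> 'w \<Rightarrow> real) \<Rightarrow> bool" where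
  "legendre_process k d P F \<zeta> R \<longleftrightarrow> diffusion P F {0<..<pi / k}
     (\<lambda>f r. (1/2) * deriv (deriv f) r + (d - 1) / 2 * k * cot (k * r) * deriv f r) \<zeta> R"

definition hyperbolic_bessel_process ::
    "real \<Rightarrow> real \<Rightarrow> 'w measure \<Rightarrow> (real \<Rightarrow> 'w measure) \<Rightarrow> ('w \<Rightarrow> ereal) \<Rightarrow> (real \<Rightarrow> 'w \<Rightarrow> real) \<Rightarrow> bool" where
  "hyperbolic_bessel_process k d P F \<zeta> R \<longleftrightarrow> diffusion P F {0<..}
     (\<lambda>f r. (1/2) * deriv (deriv f) r + (d - 1) / 2 * k * (cosh (k * r) / sinh (k * r)) * deriv f r) \<zeta> R"

definition sub_laplacian_diffusion ::
    "'a::euclidean_space contact_sr \<Rightarrow> 'a set \<Rightarrow> ('a \<Rightarrow> 'a list \<Rightarrow> real) \<Rightarrow>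
     'w measure \<Rightarrow> (real \<Rightarrow> 'w measure) \<Rightarrow> ('w \<Rightarrow> ereal) \<Rightarrow> (real \<Rightarrow> 'w \<Rightarrow> 'a) \<Rightarrow> bool" where
  "sub_laplacian_diffusion C S \<theta> P F \<zeta> X \<longleftrightarrow>
     diffusion P F (noncharacteristic C S) (\<lambda>f x. (1/2) * sub_laplacian C S \<theta> f x) \<zeta> X"

end

theory Submission
  imports Defs
begin

text \<open>
  Let \<open>X\<close> be the unit horizontal field with \<open>X r = 1\<close>. On all model hypersurfaces \<open>X\<close> is
  tangent to the foliation, so the horizontal gradient of \<open>f(r)\<close> is \<open>f'(r) X\<close>, and
  \<open>\<iota>\<^sub>X \<mu> = \<iota>\<^sub>p T\<close> for a constant form \<open>T\<close> and the position vector \<open>p\<close>. Hence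
  \<open>d(f'(r) \<iota>\<^sub>X \<mu>) = f''(r) dr \<and> \<iota>\<^sub>X \<mu> + 2n f'(r) T\<close>, where \<open>dr \<and> \<iota>\<^sub>X \<mu> = \<mu>\<close> and \<open>T = q(r) \<mu>\<close> with
  \<open>q(r)\<close> equal to \<open>1/r\<close>, \<open>k cot(kr)\<close>, \<open>k coth(kr)\<close> in the three cases, so that
  \<open>\<Delta>(f(r)) = f''(r) + 2n q(r) f'(r)\<close>. As \<open>r\<close> is proper, compactly supported smooth functions of \<open>r\<close> are
  test functions upstairs, and the martingale problem passes to the radial part.
\<close>

section \<open>Alternating forms on lists of vectors\<close>

text \<open>\<open>divergence\<close>, \<open>sr_normal\<close> and
  \<open>horizontal_gradient\<close> are definite descriptions, so each value must be shown unique.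
  For the first two this rests on the volume form being nonzero on a frame. The permutation sum is
  not evaluated for that: on a symplectic basis its terms are a common factor times non-negative
  numbers, and the identity contributes 1. An orientation form \<open>\<theta>\<close> fixes the
  sign of the normal only pointwise. The flux can be differentiated once this sign is known to be
  locally constant, and continuous tangent fields and continuity of the volume are what proves it.
  \<open>ext_deriv\<close> freezes the ambient vectors while the base point moves, so the formula
  for \<iota>_X \<mu> is needed at other points y for vectors tangent at x. It holds there because
  the forms come from constant ambient forms, and the remaining components lie in subspaces too
  small to support a form of that degree. The sphere and the anti-de Sitter space are treated
  together as quadrics with a sign \<open>\<kappa>\<close>; they differ in the change of coordinate
  between r and x_(2n+1).\<close>

definition alternating_on :: "nat \<Rightarrow> 'a::real_vector set \<Rightarrow> ('a list \<Rightarrow> real) \<Rightarrow> bool" where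
  "alternating_on m W A \<longleftrightarrow>
     (\<forall>vs. length vs = m \<and> set vs \<subseteq> W \<longrightarrow>
        (\<forall>i<m. \<forall>u\<in>W. \<forall>v\<in>W. \<forall>a b.
           A (vs[i := a *\<^sub>R u + b *\<^sub>R v]) = a * A (vs[i := u]) + b * A (vs[i := v])) \<and>
        (\<not> distinct vs \<longrightarrow> A vs = 0))"

lemma alternating_on_lin:
  assumes "alternating_on m W A" "length vs = m" "set vs \<subseteq> W" "i < m" "u \<in> W" "v \<in> W"
  shows "A (vs[i := a *\<^sub>R u + b *\<^sub>R v]) = a * A (vs[i := u]) + b * A (vs[i := v])"
  using assms unfolding alternating_on_def by blast

lemma alternating_on_not_distinct:
  "alternating_on m W A \<Longrightarrow> length vs = m \<Longrightarrow> set vs \<subseteq> W \<Longrightarrow> \<not> distinct vs \<Longrightarrow> A vs = 0"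
  unfolding alternating_on_def by blast

text \<open>An orientation form is constrained on tangent vectors only, while the volume form
  alternates on the whole ambient space; restriction makes the two comparable on a tangent
  space.\<close>

lemma alternating_on_subset:
  "alternating_on m W A \<Longrightarrow> V \<subseteq> W \<Longrightarrow> alternating_on m V A"
  unfolding alternating_on_def by blast

lemma alternating_on_cmult:
  assumes "alternating_on m W A"
  shows "alternating_on m W (\<lambda>vs. c * A vs)"
  using assms unfolding alternating_on_def by (simp add: algebra_simps)

lemma set_list_update_subset: "set vs \<subseteq> W \<Longrightarrow> u \<in> W \<Longrightarrow> set (vs[i := u]) \<subseteq> W"
  using set_update_subset_insert[of vs i u] by blast

lemma not_distinct_nthI:
  "i < length vs \<Longrightarrow> j < length vs \<Longrightarrow> i \<noteq> j \<Longrightarrow> vs ! i = vs ! j \<Longrightarrow> \<not> distinct vs"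
  by (auto simp: distinct_conv_nth)

lemma alternating_on_zero:
  assumes "alternating_on m W A" "subspace W" "length vs = m" "set vs \<subseteq> W" "i < m"
  shows "A (vs[i := 0]) = 0"
  using alternating_on_lin[OF assms(1,3,4,5), of 0 0 0 0] subspace_0[OF assms(2)] by simp

text \<open>Polarisation: expand the vanishing value with \<open>u + v\<close> in both
  slots.\<close>

lemma alternating_on_swap:
  assumes A: "alternating_on m W A" and W: "subspace W"
    and vs: "length vs = m" "set vs \<subseteq> W" and ij: "i < m" "j < m" "i \<noteq> j"
    and uv: "u \<in> W" "v \<in> W"
  shows "A (vs[i := u, j := v]) = - A (vs[i := v, j := u])"
proof -
  have uvW: "u + v \<in> W" using W uv by (simp add: subspace_add)
  have nd: "A (vs[i := x, j := x]) = 0" if "x \<in> W" for x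
  proof (rule alternating_on_not_distinct[OF A])
    show "\<not> distinct (vs[i := x, j := x])"
      using ij vs(1) by (intro not_distinct_nthI[of i _ j]) auto
  qed (use that vs in \<open>auto simp: set_list_update_subset\<close>)
  have l1: "A ((vs[i := x])[j := u + v]) = A (vs[i := x, j := u]) + A (vs[i := x, j := v])"
    if "x \<in> W" for x
    using alternating_on_lin[OF A, of "vs[i := x]" j u v 1 1] vs ij uv that
    by (simp add: set_list_update_subset)
  have l2: "A ((vs[i := u + v])[j := x]) = A (vs[i := u, j := x]) + A (vs[i := v, j := x])"
    if "x \<in> W" for x
    using alternating_on_lin[OF A, of "vs[j := x]" i u v 1 1] vs ij uv that
    by (simp add: set_list_update_subset list_update_swap[of i j])
  have "0 = A (vs[i := u + v, j := u + v])" using nd[OF uvW] by simp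
  also have "\<dots> = A (vs[i := u, j := v]) + A (vs[i := v, j := u])"
    using l1[OF uvW] l2[OF uv(1)] l2[OF uv(2)] nd[OF uv(1)] nd[OF uv(2)] by simp
  finally show ?thesis by simp
qed

lemma alternating_on_swap_adjacent:
  assumes "alternating_on m W A" "subspace W" "set (pre @ u # v # ys) \<subseteq> W"
    "length (pre @ u # v # ys) = m"
  shows "A (pre @ u # v # ys) = - A (pre @ v # u # ys)"
  using alternating_on_swap[OF assms(1,2), of "pre @ u # v # ys" "length pre" "Suc (length pre)" u v] assms(3,4)
  by (simp add: list_update_append)

lemma alternating_on_move:
  assumes A: "alternating_on m W A" "subspace W"
  shows "set (pre @ xs @ w # ys) \<subseteq> W \<Longrightarrow> length (pre @ xs @ w # ys) = m \<Longrightarrow>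
    A (pre @ xs @ w # ys) = (-1) ^ length xs * A (pre @ w # xs @ ys)"
proof (induction xs arbitrary: ys rule: rev_induct)
  case (snoc x xs)
  have "A (pre @ (xs @ [x]) @ w # ys) = - A (pre @ xs @ w # x # ys)"
    using alternating_on_swap_adjacent[OF A, of "pre @ xs" x w ys] snoc.prems by simp
  also have "A (pre @ xs @ w # x # ys) = (-1) ^ length xs * A (pre @ w # xs @ x # ys)"
    using snoc.prems by (intro snoc.IH) auto
  finally show ?case by simp
qed simp

text \<open>Supplies the sign that cancels the \<open>(-1) ^ i\<close> of \<open>ext_deriv\<close>,
  where the i-th argument is deleted from the list.\<close>

lemma alternating_on_front:
  assumes A: "alternating_on m W A" "subspace W" and "set vs \<subseteq> W" "w \<in> W" "length vs = m" "i < m"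
  shows "A (vs[i := w]) = (-1) ^ i * A (w # take i vs @ drop (Suc i) vs)"
proof -
  have "vs[i := w] = [] @ take i vs @ w # drop (Suc i) vs"
    using assms by (simp add: upd_conv_take_nth_drop)
  moreover have "A ([] @ take i vs @ w # drop (Suc i) vs)
      = (-1) ^ length (take i vs) * A ([] @ w # take i vs @ drop (Suc i) vs)"
    using assms by (intro alternating_on_move[OF A]) (auto dest: in_set_takeD in_set_dropD)
  ultimately show ?thesis using assms by simp
qed

lemma alternating_on_Cons:
  assumes A: "alternating_on (Suc m) W A" and "w \<in> W"
  shows "alternating_on m W (\<lambda>vs. A (w # vs))"
  unfolding alternating_on_def
proof (intro allI impI conjI ballI; elim conjE)
  fix vs i u v a b assume "length vs = m" "set vs \<subseteq> W" "i < m" "u \<in> W" "v \<in> W"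
  then show "A (w # vs[i := a *\<^sub>R u + b *\<^sub>R v]) = a * A (w # vs[i := u]) + b * A (w # vs[i := v])"
    using alternating_on_lin[OF A, of "w # vs" "Suc i" u v a b] assms(2) by simp
next
  fix vs assume "length vs = m" "set vs \<subseteq> W" "\<not> distinct vs"
  then show "A (w # vs) = 0"
    using alternating_on_not_distinct[OF A, of "w # vs"] assms(2) by simp
qed

text \<open>Transporting only the vanishing of a value avoids tracking the sign of the
  rearrangement. \<open>pre\<close> collects the entries already in place.\<close>

lemma alternating_on_permute:
  assumes A: "alternating_on m W A" "subspace W"
  shows "mset xs = mset ys \<Longrightarrow> set (pre @ ys) \<subseteq> W \<Longrightarrow> length (pre @ ys) = m \<Longrightarrow>
    A (pre @ ys) = 0 \<Longrightarrow> A (pre @ xs) = 0"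
proof (induction xs arbitrary: ys pre)
  case (Cons x xs)
  have "x \<in> set ys" using Cons.prems(1) by (metis list.set_intros(1) set_mset_mset)
  then obtain y1 y2 where y: "ys = y1 @ x # y2" by (meson split_list)
  have "A (pre @ y1 @ x # y2) = (-1) ^ length y1 * A (pre @ x # y1 @ y2)"
    using Cons.prems y by (intro alternating_on_move[OF A]) auto
  then have "A ((pre @ [x]) @ y1 @ y2) = 0" using Cons.prems y by simp
  moreover have "mset xs = mset (y1 @ y2)" using Cons.prems(1) y by simp
  ultimately have "A ((pre @ [x]) @ xs) = 0"
    using Cons.prems y by (intro Cons.IH[of "y1 @ y2"]) auto
  then show ?case by simp
qed simp

text \<open>Multilinear expansion of the arguments in \<^term>\<open>Bs\<close>, one slot after the other.\<close>

lemma alternating_on_eq_0: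
  assumes A: "alternating_on m W A" and W: "subspace W"
    and Bs: "length Bs = m" "set Bs \<subseteq> W" "W \<subseteq> span (set Bs)" "A Bs = 0"
  shows "length vs = m \<Longrightarrow> set vs \<subseteq> W \<Longrightarrow> A vs = 0"
proof -
  \<comment> \<open>Slots below \<open>j\<close> may hold arbitrary vectors of \<open>W\<close>,
    those from \<open>j\<close> on hold entries of \<open>Bs\<close>. At \<open>j = 0\<close> the
    whole list is drawn from \<open>Bs\<close>, so it either repeats an entry or rearranges
    \<open>Bs\<close>.\<close>
  have "length vs = m \<Longrightarrow> set vs \<subseteq> W \<Longrightarrow> \<forall>i. j \<le> i \<and> i < m \<longrightarrow> vs ! i \<in> set Bs \<Longrightarrow> A vs = 0" for j vs
  proof (induction j arbitrary: vs)
    case 0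
    have sub: "set vs \<subseteq> set Bs" using 0 by (auto simp: in_set_conv_nth)
    show ?case
    proof (cases "distinct vs")
      case True
      have c: "card (set vs) = m" using True 0 by (simp add: distinct_card)
      have "card (set vs) \<le> card (set Bs)" using sub by (simp add: card_mono)
      moreover have "card (set Bs) \<le> m" using Bs(1) card_length by metis
      ultimately have "card (set Bs) = m" using c by simp
      then have "distinct Bs" "set vs = set Bs"
        using Bs(1) c sub by (auto simp: card_distinct card_subset_eq)
      then have "mset vs = mset Bs" using True by (simp add: set_eq_iff_mset_eq_distinct)
      then show ?thesis using alternating_on_permute[OF A W, of vs Bs "[]"] Bs by simp
    qed (use alternating_on_not_distinct[OF A] 0 in blast)
  next
    case (Suc j)
    show ?case
    proof (cases "j < m")
      case True
      have "vs ! j \<in> span (set Bs)" using Bs(3) Suc.prems True by (meson in_mono nth_mem)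
      then have "vs ! j \<in> W \<and> A (vs[j := vs ! j]) = 0"
      proof (induction rule: span_induct_alt)
        case base
        then show ?case
          using alternating_on_zero[OF A W] Suc.prems True subspace_0[OF W] by simp
      next
        case (step c x y)
        have "A (vs[j := x]) = 0"
          using Suc.prems True step(1) Bs(2) set_list_update_subset[of vs W x j]
          by (intro Suc.IH) (auto simp: nth_list_update)
        moreover have "x \<in> W" using step(1) Bs(2) by blast
        ultimately show ?case
          using step alternating_on_lin[OF A, of vs j x y c 1] Suc.prems True W
          by (simp add: subspace_add subspace_scale)
      qed
      then show ?thesis by simp
    qed (use Suc in auto)
  qed
  from this[of vs m] show "length vs = m \<Longrightarrow> set vs \<subseteq> W \<Longrightarrow> A vs = 0" by (meson leD)
qed

text \<open>Some entry lies in the span of the others. Replacing it by any of them creates a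
  repetition, and linearity in that slot does the rest.\<close>

lemma alternating_on_dependent:
  assumes A: "alternating_on m W A" and W: "subspace W"
    and vs: "length vs = m" "set vs \<subseteq> W" and dep: "dependent (set vs)"
  shows "A vs = 0"
proof (cases "distinct vs")
  case True
  obtain x where x: "x \<in> set vs" "x \<in> span (set vs - {x})" using dep unfolding dependent_def by blast
  obtain j where j: "j < m" "vs ! j = x" using x vs by (auto simp: in_set_conv_nth)
  have "x \<in> W \<and> A (vs[j := x]) = 0"
    using x(2)
  proof (induction rule: span_induct_alt)
    case base
    then show ?case using alternating_on_zero[OF A W] vs j subspace_0[OF W] by simp
  next
    case (step c u y)
    have uW: "u \<in> W" using step(1) vs by blast
    obtain i where i: "i < m" "vs ! i = u" "i \<noteq> j"
      using step(1) vs j by (auto simp: in_set_conv_nth)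
    have "A (vs[j := u]) = 0"
    proof (rule alternating_on_not_distinct[OF A])
      show "\<not> distinct (vs[j := u])"
        using i j vs by (intro not_distinct_nthI[of i _ j]) auto
    qed (use vs uW in \<open>auto simp: set_list_update_subset\<close>)
    then show ?case
      using step alternating_on_lin[OF A vs(1,2) j(1), of u y c 1] W uW
      by (simp add: subspace_add subspace_scale)
  qed
  then show ?thesis using j by auto
qed (use alternating_on_not_distinct[OF A vs] in blast)

text \<open>The device by which components of the normal and radial fields that lie in a plane,
  hyperplane or tangent space drop out of the volume computations.\<close>

lemma alternating_on_exceeds_dim:
  fixes W :: "'a::euclidean_space set"
  assumes A: "alternating_on m W A" and W: "subspace W" and "dim W < m"
    and vs: "length vs = m" "set vs \<subseteq> W"
  shows "A vs = 0"
proof (cases "distinct vs")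
  case True
  have "dependent (set vs)"
  proof (rule ccontr)
    assume "\<not> dependent (set vs)"
    then have "card (set vs) \<le> dim W" using vs by (simp add: independent_card_le_dim)
    then show False using True vs assms(3) by (simp add: distinct_card)
  qed
  then show ?thesis using alternating_on_dependent[OF A W vs] by blast
qed (use alternating_on_not_distinct[OF A vs] in blast)

text \<open>The identity \<open>\<lambda> \<and> A = 0\<close> in degree one above the dimension, evaluated at \<^term>\<open>w # vs\<close>.\<close>

lemma alternating_on_expansion:
  assumes A: "alternating_on m W A" and W: "subspace W"
    and Bs: "length Bs = m" "set Bs \<subseteq> W" "W \<subseteq> span (set Bs)"
    and l: "linear l" and w: "w \<in> W" and vs: "length vs = m" "set vs \<subseteq> W"
  shows "l w * A vs = (\<Sum>i<m. l (vs ! i) * A (vs[i := w]))"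
proof -
  \<comment> \<open>The defect of the identity is itself alternating in \<open>vs\<close>, so it is
    enough to test it on \<open>Bs\<close>.\<close>
  define A' where "A' = (\<lambda>vs. l w * A vs - (\<Sum>i<m. l (vs ! i) * A (vs[i := w])))"
  have 1: "alternating_on m W A'"
    unfolding alternating_on_def
  proof (intro allI impI conjI ballI; elim conjE)
    fix vs j u v a b assume h: "length vs = m" "set vs \<subseteq> W" "j < m" "u \<in> W" "v \<in> W"
    have "l ((vs[j := a *\<^sub>R u + b *\<^sub>R v]) ! i) * A (vs[j := a *\<^sub>R u + b *\<^sub>R v, i := w])
       = a * (l ((vs[j := u]) ! i) * A (vs[j := u, i := w]))
        + b * (l ((vs[j := v]) ! i) * A (vs[j := v, i := w]))" if "i < m" for i
    proof (cases "i = j")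
      case True
      then show ?thesis using h l by (simp add: linear_add linear_scale algebra_simps)
    next
      case False
      have "A ((vs[i := w])[j := a *\<^sub>R u + b *\<^sub>R v])
          = a * A ((vs[i := w])[j := u]) + b * A ((vs[i := w])[j := v])"
        using h w by (intro alternating_on_lin[OF A]) (auto simp: set_list_update_subset)
      then show ?thesis using False by (simp add: list_update_swap[of j i] algebra_simps)
    qed
    then show "A' (vs[j := a *\<^sub>R u + b *\<^sub>R v]) = a * A' (vs[j := u]) + b * A' (vs[j := v])"
      using alternating_on_lin[OF A h]
      by (simp add: A'_def sum.distrib sum_distrib_left[symmetric] algebra_simps)
  next
    fix vs assume h: "length vs = m" "set vs \<subseteq> W" "\<not> distinct vs"
    then obtain p q where pq: "p < m" "q < m" "p \<noteq> q" "vs ! p = vs ! q"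
      by (auto simp: distinct_conv_nth)
    have z: "A (vs[i := w]) = 0" if "i < m" "i \<noteq> p" "i \<noteq> q" for i
    proof (rule alternating_on_not_distinct[OF A])
      show "\<not> distinct (vs[i := w])"
        using pq h that by (intro not_distinct_nthI[of p _ q]) auto
    qed (use h w in \<open>auto simp: set_list_update_subset\<close>)
    \<comment> \<open>With equal entries at \<open>p\<close> and \<open>q\<close> only the terms
      \<open>i = p\<close> and \<open>i = q\<close> survive, and the exchange of the two slots makes
      them cancel.\<close>
    have "A (vs[p := w, q := vs ! q]) = - A (vs[p := vs ! q, q := w])"
      using pq h w by (intro alternating_on_swap[OF A W]) auto
    then have s: "A (vs[p := w]) = - A (vs[q := w])"
      using pq by (metis list_update_id list_update_swap)
    have "(\<Sum>i<m. l (vs ! i) * A (vs[i := w])) = (\<Sum>i\<in>{p, q}. l (vs ! i) * A (vs[i := w]))"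
      using pq z by (intro sum.mono_neutral_right) auto
    then show "A' vs = 0"
      using pq s alternating_on_not_distinct[OF A h] by (simp add: A'_def)
  qed
  have "w \<in> span (set Bs)" using w Bs by blast
  \<comment> \<open>On \<open>Bs\<close> both sides are linear in \<open>w\<close>; for
    \<open>w = Bs ! j\<close> every term except the j-th repeats that vector.\<close>
  then have "w \<in> W \<and> l w * A Bs = (\<Sum>i<m. l (Bs ! i) * A (Bs[i := w]))"
  proof (induction rule: span_induct_alt)
    case base
    then show ?case
      using alternating_on_zero[OF A W Bs(1,2)] l subspace_0[OF W] by (simp add: linear_0)
  next
    case (step c x y)
    obtain j where j: "j < m" "Bs ! j = x" using step(1) Bs by (auto simp: in_set_conv_nth)
    have x: "x \<in> W" using step(1) Bs by blast
    have z: "A (Bs[i := x]) = 0" if "i < m" "i \<noteq> j" for i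
    proof (rule alternating_on_not_distinct[OF A])
      show "\<not> distinct (Bs[i := x])"
        using j Bs that by (intro not_distinct_nthI[of i _ j]) auto
    qed (use Bs x in \<open>auto simp: set_list_update_subset\<close>)
    have "(\<Sum>i<m. l (Bs ! i) * A (Bs[i := x])) = (\<Sum>i\<in>{j}. l (Bs ! i) * A (Bs[i := x]))"
      using j z by (intro sum.mono_neutral_right) auto
    then have "(\<Sum>i<m. l (Bs ! i) * A (Bs[i := x])) = l x * A Bs" using j by auto
    moreover have "A (Bs[i := c *\<^sub>R x + y]) = c * A (Bs[i := x]) + A (Bs[i := y])" if "i < m" for i
      using alternating_on_lin[OF A Bs(1,2) that x, of y c 1] step by simp
    ultimately show ?case
      using step x W l
      by (simp add: linear_add linear_scale subspace_add subspace_scale distrib_left sum.distrib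
          mult.left_commute[of _ c] sum_distrib_left[symmetric] algebra_simps)
  qed
  then have "A' Bs = 0" by (simp add: A'_def)
  from alternating_on_eq_0[OF 1 W Bs this vs] show ?thesis by (simp add: A'_def)
qed

section \<open>Smooth functions\<close>

lemma Ck_on_cong:
  assumes "open U" "\<And>x. x \<in> U \<Longrightarrow> f x = g x" "Ck_on k U f"
  shows "Ck_on k U g"
  using assms(2,3)
proof (induction k arbitrary: f g)
  case 0
  then show ?case using continuous_on_cong[of U U f g] by simp
next
  case (Suc k)
  have hd: "(f has_derivative D) (at x) \<longleftrightarrow> (g has_derivative D) (at x)" if "x \<in> U" for x D
  proof
    show "(f has_derivative D) (at x) \<Longrightarrow> (g has_derivative D) (at x)"
      by (rule has_derivative_transform_within_open[OF _ assms(1) that Suc.prems(1)])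
    show "(g has_derivative D) (at x) \<Longrightarrow> (f has_derivative D) (at x)"
      by (rule has_derivative_transform_within_open[OF _ assms(1) that Suc.prems(1)[symmetric]])
  qed
  then have fd: "frechet_derivative f (at x) = frechet_derivative g (at x)" if "x \<in> U" for x
    using that unfolding frechet_derivative_def by simp
  have "f differentiable_on U" using Suc.prems(2) by simp
  then have "g differentiable_on U"
    using hd unfolding differentiable_on_eq_differentiable_at[OF assms(1)] differentiable_def by blast
  moreover have "Ck_on k U (\<lambda>x. frechet_derivative g (at x) v)" for v
    using Suc.prems(2) fd by (rule_tac Suc.IH[of "\<lambda>x. frechet_derivative f (at x) v"]) auto
  ultimately show ?case by simp
qed

text \<open>\<open>Ck_on\<close> speaks of the chosen \<open>frechet_derivative\<close>; on an open
  set derivatives are unique, so an explicit one may take its place.\<close>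

lemma Ck_on_SucI:
  assumes "open U" "\<And>x. x \<in> U \<Longrightarrow> (f has_derivative f' x) (at x)" "\<And>v. Ck_on k U (\<lambda>x. f' x v)"
  shows "Ck_on (Suc k) U f"
proof -
  have "f' x = frechet_derivative f (at x)" if "x \<in> U" for x
    using assms(2)[OF that] by (rule frechet_derivative_at)
  then have "Ck_on k U (\<lambda>x. frechet_derivative f (at x) v)" for v
    using assms(3)[of v] by (rule_tac Ck_on_cong[OF assms(1), of "\<lambda>x. f' x v"]) auto
  moreover have "f differentiable_on U"
    using assms(1,2) by (auto simp: differentiable_on_eq_differentiable_at differentiable_def)
  ultimately show ?thesis by simp
qed

lemma Ck_on_SucD:
  assumes "open U" "Ck_on (Suc k) U f" "x \<in> U"
  shows "(f has_derivative frechet_derivative f (at x)) (at x)"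
  using assms by (auto simp: differentiable_on_eq_differentiable_at frechet_derivative_works)

lemma Ck_on_Suc_imp: "Ck_on (Suc k) U f \<Longrightarrow> Ck_on k U f"
proof (induction k arbitrary: f)
  case 0
  then show ?case by (simp add: differentiable_imp_continuous_on)
next
  case (Suc k)
  have "f differentiable_on U" using Suc.prems by simp
  moreover have "Ck_on k U (\<lambda>x. frechet_derivative f (at x) v)" for v
    using Suc.prems by (intro Suc.IH) simp
  ultimately show ?case by simp
qed

lemma Ck_on_subset: "Ck_on k U f \<Longrightarrow> V \<subseteq> U \<Longrightarrow> Ck_on k V f"
  by (induction k arbitrary: f) (auto intro: continuous_on_subset differentiable_on_subset)

lemma Ck_on_const: "Ck_on k U (\<lambda>x. c)"
proof (induction k arbitrary: c)
  case (Suc k)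
  have "frechet_derivative (\<lambda>x. c) (at x) = (\<lambda>v. 0)" for x :: 'a
    by (metis frechet_derivative_at has_derivative_const)
  then show ?case using Suc by simp
qed simp

lemma Ck_on_bounded_linear:
  assumes "bounded_linear f"
  shows "Ck_on k U f"
proof (cases k)
  case 0
  then show ?thesis using assms by (simp add: linear_continuous_on)
next
  case (Suc j)
  have hd: "(f has_derivative f) (at x)" for x
    using assms by (rule bounded_linear_imp_has_derivative)
  then have "frechet_derivative f (at x) = f" for x by (metis frechet_derivative_at)
  then show ?thesis
    using Suc hd by (auto simp: Ck_on_const differentiable_on_def differentiable_def
        intro: has_derivative_at_withinI)
qed

lemma Ck_on_add:
  assumes "open U" "Ck_on k U f" "Ck_on k U g"
  shows "Ck_on k U (\<lambda>x. f x + g x)"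
  using assms(2,3)
proof (induction k arbitrary: f g)
  case (Suc k)
  show ?case
  proof (rule Ck_on_SucI[OF assms(1)])
    show "((\<lambda>x. f x + g x) has_derivative
      (\<lambda>v. frechet_derivative f (at x) v + frechet_derivative g (at x) v)) (at x)" if "x \<in> U" for x
      using Ck_on_SucD[OF assms(1) Suc.prems(1) that] Ck_on_SucD[OF assms(1) Suc.prems(2) that]
      by (rule has_derivative_add)
  qed (use Suc in simp)
qed (simp add: continuous_on_add)

lemma Ck_on_mult:
  assumes "open U" "Ck_on k U f" "Ck_on k U g"
  shows "Ck_on k U (\<lambda>x. f x * g x)"
  using assms(2,3)
proof (induction k arbitrary: f g)
  case (Suc k)
  show ?case
  proof (rule Ck_on_SucI[OF assms(1)])
    show "((\<lambda>x. f x * g x) has_derivative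
      (\<lambda>v. f x * frechet_derivative g (at x) v + frechet_derivative f (at x) v * g x)) (at x)"
      if "x \<in> U" for x
      using Ck_on_SucD[OF assms(1) Suc.prems(1) that] Ck_on_SucD[OF assms(1) Suc.prems(2) that]
      by (rule has_derivative_mult)
    show "Ck_on k U (\<lambda>x. f x * frechet_derivative g (at x) v + frechet_derivative f (at x) v * g x)" for v
      using Suc.prems by (intro Ck_on_add[OF assms(1)] Suc.IH Ck_on_Suc_imp[of k U f] Ck_on_Suc_imp[of k U g]) auto
  qed
qed (simp add: continuous_on_mult)

lemma Ck_on_cmult: "open U \<Longrightarrow> Ck_on k U f \<Longrightarrow> Ck_on k U (\<lambda>x. c * f x)"
  by (intro Ck_on_mult Ck_on_const)

lemma Ck_on_sum:
  assumes "open U" "\<And>i. i \<in> I \<Longrightarrow> Ck_on k U (f i)"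
  shows "Ck_on k U (\<lambda>x. \<Sum>i\<in>I. f i x)"
  using assms(2)
  by (induction I rule: infinite_finite_induct) (auto intro: Ck_on_const Ck_on_add[OF assms(1)])

lemma Ck_on_compose:
  fixes f :: "real \<Rightarrow> real"
  assumes "open U" "open V" "g ` U \<subseteq> V" "Ck_on k U g" "Ck_on k V f"
  shows "Ck_on k U (\<lambda>x. f (g x))"
  using assms(4,5)
proof (induction k arbitrary: f)
  case 0
  then show ?case using assms(3) by (auto intro: continuous_on_compose2)
next
  case (Suc k)
  show ?case
  proof (rule Ck_on_SucI[OF assms(1)])
    fix x assume x: "x \<in> U"
    then have gx: "g x \<in> V" using assms(3) by blast
    have f': "(f has_derivative frechet_derivative f (at (g x))) (at (g x))"
      using Ck_on_SucD[OF assms(2) Suc.prems(2) gx] .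
    define D where "D = frechet_derivative f (at (g x))"
    have "((\<lambda>x. f (g x)) has_derivative (\<lambda>v. D (frechet_derivative g (at x) v))) (at x)"
      unfolding D_def
      using has_derivative_compose[OF Ck_on_SucD[OF assms(1) Suc.prems(1) x] f'] .
    \<comment> \<open>A linear map on the reals is multiplication by its value at 1, so the chain
      rule yields a product covered by \<open>Ck_on_mult\<close>.\<close>
    moreover have "D = (\<lambda>u. D 1 * u)"
    proof
      show "D u = D 1 * u" for u
        using linear_scale[OF has_derivative_linear[OF f'], of u 1] by (simp add: D_def)
    qed
    ultimately have "((\<lambda>x. f (g x)) has_derivative (\<lambda>v. D 1 * frechet_derivative g (at x) v)) (at x)"
      by metis
    then show "((\<lambda>x. f (g x)) has_derivative
        (\<lambda>v. frechet_derivative f (at (g x)) 1 * frechet_derivative g (at x) v)) (at x)" by (simp add: D_def)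
  next
    fix v
    have "Ck_on k U (\<lambda>x. frechet_derivative f (at (g x)) 1)"
      using Suc.prems by (intro Suc.IH[of "\<lambda>r. frechet_derivative f (at r) 1"] Ck_on_Suc_imp[of k U g]) auto
    then show "Ck_on k U (\<lambda>x. frechet_derivative f (at (g x)) 1 * frechet_derivative g (at x) v)"
      using Suc.prems by (intro Ck_on_mult[OF assms(1)]) auto
  qed
qed

lemma Ck_on_real_SucI:
  assumes "open U" "\<And>x. x \<in> U \<Longrightarrow> (f has_real_derivative f' x) (at x)" "Ck_on k U f'"
  shows "Ck_on (Suc k) U f"
proof (rule Ck_on_SucI[OF assms(1)])
  show "(f has_derivative (\<lambda>v. f' x * v)) (at x)" if "x \<in> U" for x
    using assms(2)[OF that] by (simp add: has_field_derivative_def)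
  show "Ck_on k U (\<lambda>x. f' x * v)" for v
    by (intro Ck_on_mult[OF assms(1)] assms(3) Ck_on_const)
qed

text \<open>The derivative is a polynomial in \<open>inverse\<close> itself, so the induction
  closes. The same happens for \<open>sqrt\<close> below, whose derivative is again expressed
  through \<open>sqrt\<close>.\<close>

lemma Ck_on_inverse:
  assumes "open U" "0 \<notin> U"
  shows "Ck_on k U (inverse :: real \<Rightarrow> real)"
proof (induction k)
  case 0
  then show ?case using assms by (auto intro!: continuous_intros)
next
  case (Suc k)
  show ?case
  proof (rule Ck_on_real_SucI[OF assms(1)])
    show "(inverse has_real_derivative (-1) * (inverse x * inverse x)) (at x)" if "x \<in> U" for x :: real
      using DERIV_inverse[of x] that assms by (auto simp: power2_eq_square)
    show "Ck_on k U (\<lambda>x. (-1) * (inverse x * inverse x))"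
      by (intro Ck_on_mult[OF assms(1)] Suc Ck_on_const)
  qed
qed

lemma Ck_on_sqrt: "Ck_on k {0<..} sqrt"
proof (induction k)
  case 0
  then show ?case by (auto intro!: continuous_intros)
next
  case (Suc k)
  show ?case
  proof (rule Ck_on_real_SucI)
    show "(sqrt has_real_derivative inverse (2 * sqrt x)) (at x)" if "x \<in> {0<..}" for x :: real
      using DERIV_real_sqrt[of x] that by (simp add: field_simps)
    show "Ck_on k {0<..} (\<lambda>x. inverse (2 * sqrt x))"
      by (rule Ck_on_compose[of _ "{0<..}" _ _ inverse])
        (auto intro!: Ck_on_cmult Suc Ck_on_inverse)
  qed auto
qed

lemma Ck_on_power:
  assumes "open U" "Ck_on k U f"
  shows "Ck_on k U (\<lambda>x. f x ^ j)"
  by (induction j) (auto intro: Ck_on_const Ck_on_mult assms)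

text \<open>For \<open>c = 1\<close> and \<open>c = -1\<close> this is, up to a constant factor, the
  derivative of arccos and of arcosh, which express r on the quadrics.\<close>

lemma Ck_on_inverse_sqrt_poly:
  assumes "open U" "\<And>a. a \<in> U \<Longrightarrow> c * (1 - a\<^sup>2) > (0::real)"
  shows "Ck_on k U (\<lambda>a. inverse (sqrt (c * (1 - a\<^sup>2))))"
proof -
  have "Ck_on k U (\<lambda>a. c + (- c) * a ^ 2)"
    by (rule Ck_on_add[OF assms(1) Ck_on_const Ck_on_cmult[OF assms(1)
        Ck_on_power[OF assms(1) Ck_on_bounded_linear[OF bounded_linear_ident]]]])
  then have "Ck_on k U (\<lambda>a. c * (1 - a\<^sup>2))" by (simp add: algebra_simps)
  then have "Ck_on k U (\<lambda>a. sqrt (c * (1 - a\<^sup>2)))"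
    using assms by (intro Ck_on_compose[of U "{0<..}" _ k sqrt] Ck_on_sqrt) auto
  then show ?thesis
    using assms(2) by (intro Ck_on_compose[of U "{0<..}" _ k inverse] Ck_on_inverse assms(1)) auto
qed

text \<open>Smoothness along \<open>E\<close> is tested through local ambient extensions. Near each
  point \<open>r\<close> is replaced by such an extension \<open>g\<close>, and the neighbourhood
  shrinks to where \<open>g\<close> lands in the domain of the extension of
  \<open>f\<close>.\<close>

lemma smooth_along_compose:
  assumes f: "smooth_along I f" and r: "\<And>x. x \<in> E \<Longrightarrow> r x \<in> I"
    and g: "\<And>x. x \<in> E \<Longrightarrow> \<exists>U g. open U \<and> x \<in> U \<and> (\<forall>k. Ck_on k U g) \<and> (\<forall>y\<in>U \<inter> E. g y = r y)"
  shows "smooth_along E (\<lambda>x. f (r x))"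
  unfolding smooth_along_def
proof
  fix x assume x: "x \<in> E"
  obtain U g where U: "open U" "x \<in> U" "\<And>k. Ck_on k U g" "\<And>y. y \<in> U \<inter> E \<Longrightarrow> g y = r y"
    using g[OF x] by blast
  obtain V h where V: "open V" "r x \<in> V" "\<And>k. Ck_on k V h" "\<And>y. y \<in> V \<inter> I \<Longrightarrow> h y = f y"
    using f r[OF x] unfolding smooth_along_def by meson
  have "continuous_on U g" using U(3)[of 0] by simp
  then have o: "open (U \<inter> g -` V)" using U(1) V(1) by (simp add: continuous_open_preimage)
  have "Ck_on k (U \<inter> g -` V) (\<lambda>y. h (g y))" for k
    using o V U by (rule_tac Ck_on_compose[of _ V]) (auto intro: Ck_on_subset[of _ U g])
  moreover have "x \<in> U \<inter> g -` V" using U V x by auto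
  moreover have "\<forall>y\<in>U \<inter> g -` V \<inter> E. h (g y) = f (r y)" using U V r by auto
  ultimately show "\<exists>U h. open U \<and> x \<in> U \<and> (\<forall>k. Ck_on k U h) \<and> (\<forall>y\<in>U \<inter> E. h y = f (r y))"
    using o by blast
qed

text \<open>Near a point of the open set \<open>I\<close> the extension coincides with
  \<open>f\<close>, so \<open>f\<close> itself is twice differentiable there and both uses of
  \<open>deriv\<close> denote genuine derivatives.\<close>

lemma smooth_along_real_derivs:
  fixes f :: "real \<Rightarrow> real"
  assumes f: "smooth_along I f" and I: "open I" and x: "x \<in> I"
  shows "(f has_real_derivative deriv f x) (at x)"
    and "(deriv f has_real_derivative deriv (deriv f) x) (at x)"
proof -
  obtain U h where U: "open U" "x \<in> U" "\<And>k. Ck_on k U h" "\<And>y. y \<in> U \<inter> I \<Longrightarrow> h y = f y"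
    using f x unfolding smooth_along_def by meson
  let ?V = "U \<inter> I"
  have V: "open ?V" "x \<in> ?V" using U I x by auto
  have C2: "Ck_on (Suc (Suc 0)) ?V f"
    using Ck_on_cong[OF V(1) _ Ck_on_subset[OF U(3)]] U(4) by blast
  define f' where "f' y = frechet_derivative f (at y) 1" for y
  have d1: "(f has_real_derivative f' y) (at y)" if "y \<in> ?V" for y
  proof -
    have h: "(f has_derivative frechet_derivative f (at y)) (at y)"
      using Ck_on_SucD[OF V(1) C2 that] .
    have "frechet_derivative f (at y) = (\<lambda>u. f' y * u)"
    proof
      show "frechet_derivative f (at y) u = f' y * u" for u
        using linear_scale[OF has_derivative_linear[OF h], of u 1] by (simp add: f'_def)
    qed
    then show ?thesis using h by (simp add: has_field_derivative_def)
  qed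
  have df: "deriv f y = f' y" if "y \<in> ?V" for y using d1[OF that] by (rule DERIV_imp_deriv)
  show "(f has_real_derivative deriv f x) (at x)" using d1[OF V(2)] df[OF V(2)] by simp
  have "Ck_on (Suc 0) ?V f'" using C2 unfolding f'_def by simp
  then have "f' differentiable (at x)" using V
    by (auto simp: differentiable_on_eq_differentiable_at)
  then have "f' field_differentiable (at x)"
    by (simp add: field_differentiable_def real_differentiable_def)
  then have "(f' has_real_derivative deriv f' x) (at x)"
    by (simp add: field_differentiable_derivI)
  then have "(deriv f has_real_derivative deriv f' x) (at x)"
    using df V by (metis has_field_derivative_transform_within_open)
  then show "(deriv f has_real_derivative deriv (deriv f) x) (at x)"
    by (simp add: DERIV_imp_deriv)
qed

section \<open>The form \<open>\<omega> \<and> (d\<omega>)\<^sup>n\<close>\<close>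

text \<open>The sum in \<open>contact_volume\<close> without the factor 1/2^n and with
  \<open>\<omega>\<close>, \<open>\<beta>\<close> free, because the model computations insert a part
  of the contact form for \<open>\<omega>\<close> or a multiple of a bilinear form for
  \<open>\<beta>\<close>.\<close>

definition permutation_form ::
    "nat \<Rightarrow> ('a \<Rightarrow> real) \<Rightarrow> ('a \<Rightarrow> 'a \<Rightarrow> real) \<Rightarrow> 'a list \<Rightarrow> real" where
  "permutation_form n \<omega> \<beta> vs = (\<Sum>\<sigma> | \<sigma> permutes {..2 * n}. of_int (sign \<sigma>) *
     (\<omega> (vs ! \<sigma> 0) * (\<Prod>i<n. \<beta> (vs ! \<sigma> (2 * i + 1)) (vs ! \<sigma> (2 * i + 2)))))"

lemma contact_volume_eq_permutation_form:
  "contact_volume C x vs = (1 / 2 ^ half_rank C) *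
     permutation_form (half_rank C) (contact_form C x) (contact_form_deriv C x) vs"
  by (simp add: contact_volume_def permutation_form_def Let_def mult.assoc)

lemma sign_compose_permutes:
  "finite S \<Longrightarrow> \<sigma> permutes S \<Longrightarrow> \<tau> permutes S \<Longrightarrow> sign (\<sigma> \<circ> \<tau>) = sign \<sigma> * sign \<tau>"
  by (simp add: sign_compose permutes_imp_permutation)

lemma position_cases:
  fixes p n :: nat
  assumes "p \<le> 2 * n"
  obtains "p = 0" | i where "i < n" "p = 2 * i + 1" | i where "i < n" "p = 2 * i + 2"
proof (cases "p = 0")
  case False
  then have "p = 2 * ((p - 1) div 2) + 1 \<or> p = 2 * ((p - 1) div 2) + 2" "(p - 1) div 2 < n"
    using assms by presburger+
  then show ?thesis using that by blast
qed

lemma permutation_form_slot_linear: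
  fixes \<omega> :: "'a::real_vector \<Rightarrow> real"
  assumes \<omega>: "linear \<omega>" and \<beta>: "\<And>u. linear (\<beta> u)" "\<And>v. linear (\<lambda>u. \<beta> u v)"
    and \<sigma>: "\<sigma> permutes {..2 * n}" and vs: "length vs = Suc (2 * n)" "j < Suc (2 * n)"
  shows "linear (\<lambda>w. \<omega> (vs[j := w] ! \<sigma> 0) *
    (\<Prod>i<n. \<beta> (vs[j := w] ! \<sigma> (2 * i + 1)) (vs[j := w] ! \<sigma> (2 * i + 2))))"
proof -
  \<comment> \<open>\<open>p\<close> is the only position that \<open>\<sigma>\<close> sends to slot
    \<open>j\<close>, so \<open>w\<close> enters exactly one factor.\<close>
  obtain p where p: "p \<le> 2 * n" "\<sigma> p = j"
    using permutes_image[OF \<sigma>] vs(2) by (metis atMost_iff imageE less_Suc_eq_le)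
  have eq: "\<sigma> q = j \<longleftrightarrow> q = p" for q using permutes_inj[OF \<sigma>] p by (auto dest: injD)
  have nth: "vs[j := w] ! \<sigma> q = (if q = p then w else vs ! \<sigma> q)" for w q
    using eq[of q] vs by (auto simp: nth_list_update)
  have lin: "linear (\<lambda>w. f w * c)" "linear (\<lambda>w. c * f w)" if "linear f" for f :: "'a \<Rightarrow> real" and c
    using that by (auto simp: linear_iff algebra_simps)
  define F where "F w i = \<beta> (vs[j := w] ! \<sigma> (2 * i + 1)) (vs[j := w] ! \<sigma> (2 * i + 2))" for w i
  define G where "G i = \<beta> (vs ! \<sigma> (2 * i + 1)) (vs ! \<sigma> (2 * i + 2))" for i
  have F: "(\<Prod>i<n. F w i) = F w i0 * (\<Prod>i\<in>{..<n} - {i0}. G i)"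
    if i0: "i0 < n" "p = 2 * i0 + 1 \<or> p = 2 * i0 + 2" for i0 w
  proof -
    have "F w i = G i" if "i \<noteq> i0" for i
    proof -
      have "2 * i + 1 \<noteq> p" "2 * i + 2 \<noteq> p" using i0 that by presburger+
      then show ?thesis unfolding F_def G_def nth by simp
    qed
    then show ?thesis using i0 prod.remove[of "{..<n}" i0 "F w"] by simp
  qed
  have "linear (\<lambda>w. \<omega> (vs[j := w] ! \<sigma> 0) * (\<Prod>i<n. F w i))"
    using p(1)
  proof (cases rule: position_cases)
    case 1
    have "F w i = G i" for w i using 1 unfolding F_def G_def nth by simp
    then show ?thesis using 1 lin(1)[OF \<omega>] by (simp add: nth)
  next
    case (2 i0)
    then have "F w i0 = \<beta> w (vs ! \<sigma> (2 * i0 + 2))" for w unfolding F_def nth by simp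
    then show ?thesis using 2 F[of i0] lin(2)[OF lin(1)[OF \<beta>(2)]] by (simp add: nth)
  next
    case (3 i0)
    then have "F w i0 = \<beta> (vs ! \<sigma> (2 * i0 + 1)) w" for w unfolding F_def nth by simp
    then show ?thesis using 3 F[of i0] lin(2)[OF lin(1)[OF \<beta>(1)]] by (simp add: nth)
  qed
  then show ?thesis unfolding F_def .
qed

lemma permutation_form_alternating:
  fixes \<omega> :: "'a::real_vector \<Rightarrow> real"
  assumes \<omega>: "linear \<omega>" and \<beta>: "\<And>u. linear (\<beta> u)" "\<And>v. linear (\<lambda>u. \<beta> u v)"
  shows "alternating_on (Suc (2 * n)) UNIV (permutation_form n \<omega> \<beta>)"
  unfolding alternating_on_def
proof (intro allI impI conjI ballI; elim conjE)
  fix vs :: "'a list" and j u v a b assume h: "length vs = Suc (2 * n)" "j < Suc (2 * n)"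
  have "linear (\<lambda>w. permutation_form n \<omega> \<beta> (vs[j := w]))"
    unfolding permutation_form_def
  proof (intro linear_compose_sum ballI)
    fix \<sigma> assume "\<sigma> \<in> {\<sigma>. \<sigma> permutes {..2 * n}}"
    then show "linear (\<lambda>w. of_int (sign \<sigma>) * (\<omega> (vs[j := w] ! \<sigma> 0) *
        (\<Prod>i<n. \<beta> (vs[j := w] ! \<sigma> (2 * i + 1)) (vs[j := w] ! \<sigma> (2 * i + 2)))))"
      using permutation_form_slot_linear[OF \<omega> \<beta> _ h, of \<sigma>]
      by (auto simp: linear_iff algebra_simps)
  qed
  then show "permutation_form n \<omega> \<beta> (vs[j := a *\<^sub>R u + b *\<^sub>R v])
      = a * permutation_form n \<omega> \<beta> (vs[j := u]) + b * permutation_form n \<omega> \<beta> (vs[j := v])"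
    using linear_add[of "\<lambda>w. permutation_form n \<omega> \<beta> (vs[j := w])" "a *\<^sub>R u" "b *\<^sub>R v"]
      linear_scale[of "\<lambda>w. permutation_form n \<omega> \<beta> (vs[j := w])"] by simp
next
  fix vs :: "'a list" assume h: "length vs = Suc (2 * n)" "\<not> distinct vs"
  then obtain p q where pq: "p < Suc (2 * n)" "q < Suc (2 * n)" "p \<noteq> q" "vs ! p = vs ! q"
    by (auto simp: distinct_conv_nth)
  \<comment> \<open>Left composition with this transposition permutes the terms, keeps every product
    because \<open>vs ! p = vs ! q\<close>, and reverses every sign.\<close>
  define \<tau> where "\<tau> = Transposition.transpose p q"
  have \<tau>: "\<tau> permutes {..2 * n}" unfolding \<tau>_def using pq by (intro permutes_swap_id) auto
  have nth: "vs ! \<tau> i = vs ! i" for i using pq(4) by (auto simp: \<tau>_def Transposition.transpose_def)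
  have s: "sign (\<tau> \<circ> \<sigma>) = - sign \<sigma>" if "\<sigma> permutes {..2 * n}" for \<sigma>
    using sign_compose_permutes[OF finite_atMost \<tau> that] pq(3) by (simp add: \<tau>_def sign_swap_id)
  have "permutation_form n \<omega> \<beta> vs = - permutation_form n \<omega> \<beta> vs"
    unfolding permutation_form_def
    by (subst setum_permutations_compose_left[OF \<tau>]) (simp add: nth s sum_negf)
  then show "permutation_form n \<omega> \<beta> vs = 0" by simp
qed

text \<open>If \<open>y\<close> occurs among the arguments, then it is paired by some factor \<open>\<alpha> y v\<close>, and exchanging
  \<open>v\<close> with the argument of the leading factor \<open>\<alpha> y\<close> is a sign-reversing involution of the sum.\<close>

lemma permutation_form_radial:
  fixes \<alpha> :: "'a::real_vector \<Rightarrow> 'a \<Rightarrow> real"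
  assumes \<alpha>: "\<And>u v. \<alpha> u v = - \<alpha> v u" and vs: "j \<le> 2 * n" "vs ! j = y"
  shows "permutation_form n (\<alpha> y) (\<lambda>u v. c * \<alpha> u v) vs = 0"
proof -
  have \<alpha>0: "\<alpha> u u = 0" for u using \<alpha>[of u u] by simp
  define t where "t \<sigma> = of_int (sign \<sigma>) * (\<alpha> y (vs ! \<sigma> 0) *
    (\<Prod>i<n. c * \<alpha> (vs ! \<sigma> (2 * i + 1)) (vs ! \<sigma> (2 * i + 2))))" for \<sigma> :: "nat \<Rightarrow> nat"
  \<comment> \<open>The sum is split according to the position \<open>p\<close> at which
    \<open>\<sigma>\<close> uses the index \<open>j\<close> of \<open>y\<close>. For
    \<open>p = 0\<close> the leading factor is \<alpha>(y, y) = 0.\<close>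
  define S where "S p = {\<sigma>. \<sigma> permutes {..2 * n} \<and> \<sigma> p = j}" for p
  \<comment> \<open>\<open>p'\<close> is the partner of \<open>p\<close> in its pair, and the
    involution exchanges the positions 0 and \<open>p'\<close>.\<close>
  have inv: "sum t (S p) = 0" if p: "p \<le> 2 * n" "p' \<le> 2 * n" "p' \<noteq> 0" "p' \<noteq> p" "p \<noteq> 0"
    and i0: "i0 < n" "{p, p'} = {2 * i0 + 1, 2 * i0 + 2}" for p p' i0
  proof -
    define \<tau> where "\<tau> = Transposition.transpose 0 p'"
    have \<tau>: "\<tau> permutes {..2 * n}" unfolding \<tau>_def using p by (intro permutes_swap_id) auto
    have S: "\<sigma> \<circ> \<tau> \<in> S p" if "\<sigma> \<in> S p" for \<sigma>
      using that \<tau> p unfolding S_def \<tau>_def by (auto simp: permutes_compose)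
    have \<tau>\<tau>: "\<sigma> \<circ> \<tau> \<circ> \<tau> = \<sigma>" for \<sigma> :: "nat \<Rightarrow> nat" by (auto simp: \<tau>_def)
    have "t (\<sigma> \<circ> \<tau>) = - t \<sigma>" if \<sigma>: "\<sigma> \<in> S p" for \<sigma>
    proof -
      have s: "sign (\<sigma> \<circ> \<tau>) = - sign \<sigma>"
        using sign_compose_permutes[OF finite_atMost _ \<tau>] \<sigma> p by (simp add: S_def \<tau>_def sign_swap_id)
      have y: "vs ! \<sigma> p = y" using \<sigma> vs by (simp add: S_def)
      have f: "(\<Prod>i\<in>{..<n} - {i0}. c * \<alpha> (vs ! (\<sigma> \<circ> \<tau>) (2 * i + 1)) (vs ! (\<sigma> \<circ> \<tau>) (2 * i + 2)))
          = (\<Prod>i\<in>{..<n} - {i0}. c * \<alpha> (vs ! \<sigma> (2 * i + 1)) (vs ! \<sigma> (2 * i + 2)))"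
      proof (rule prod.cong[OF refl])
        fix i assume "i \<in> {..<n} - {i0}"
        moreover have "p' = 2 * i0 + 1 \<or> p' = 2 * i0 + 2" using i0(2) by (auto simp: doubleton_eq_iff)
        ultimately have "\<tau> (2 * i + 1) = 2 * i + 1" "\<tau> (2 * i + 2) = 2 * i + 2"
          unfolding \<tau>_def Transposition.transpose_def by (auto; presburger)+
        then show "c * \<alpha> (vs ! (\<sigma> \<circ> \<tau>) (2 * i + 1)) (vs ! (\<sigma> \<circ> \<tau>) (2 * i + 2))
            = c * \<alpha> (vs ! \<sigma> (2 * i + 1)) (vs ! \<sigma> (2 * i + 2))" by simp
      qed
      have \<tau>v: "\<tau> 0 = p'" "\<tau> p' = 0" "\<tau> p = p" using p by (auto simp: \<tau>_def Transposition.transpose_def)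
      have "\<alpha> y (vs ! \<sigma> p') * (c * \<alpha> (vs ! \<sigma> (\<tau> (2 * i0 + 1))) (vs ! \<sigma> (\<tau> (2 * i0 + 2))))
          = \<alpha> y (vs ! \<sigma> 0) * (c * \<alpha> (vs ! \<sigma> (2 * i0 + 1)) (vs ! \<sigma> (2 * i0 + 2)))"
      proof (cases "p = 2 * i0 + 1")
        case True
        then have "p' = 2 * i0 + 2" using i0(2) p by (auto simp: doubleton_eq_iff)
        then show ?thesis using True \<tau>v y by simp
      next
        case False
        then have "p = 2 * i0 + 2" "p' = 2 * i0 + 1" using i0(2) p by (auto simp: doubleton_eq_iff)
        then show ?thesis using \<tau>v y \<alpha>[of _ y] by simp
      qed
      then show ?thesis
        unfolding t_def s
        using i0(1) f \<tau>v by (subst (1 2) prod.remove[of _ i0]) (simp_all add: mult.assoc[symmetric])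
    qed
    then have "sum t (S p) = (\<Sum>\<sigma>\<in>S p. - t \<sigma>)"
      using S \<tau>\<tau>
      by (intro sum.reindex_bij_witness[where i = "\<lambda>\<sigma>. \<sigma> \<circ> \<tau>" and j = "\<lambda>\<sigma>. \<sigma> \<circ> \<tau>"]) auto
    then show ?thesis by (simp add: sum_negf)
  qed
  have z: "sum t (S p) = 0" if "p \<le> 2 * n" for p
    using that
  proof (cases rule: position_cases)
    case 1
    then show ?thesis using vs by (auto simp: t_def S_def \<alpha>0 intro!: sum.neutral)
  next
    case (2 i)
    then show ?thesis using inv[of p "2 * i + 2" i] by auto
  next
    case (3 i)
    then show ?thesis using inv[of p "2 * i + 1" i] by auto
  qed
  have fin: "finite (S p)" for p
    using finite_permutations[OF finite_atMost, of "2 * n"] by (auto simp: S_def intro: finite_subset[rotated])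
  have U: "{\<sigma>. \<sigma> permutes {..2 * n}} = (\<Union>p\<in>{..2 * n}. S p)"
  proof -
    have "\<exists>p\<in>{..2 * n}. \<sigma> p = j" if "\<sigma> permutes {..2 * n}" for \<sigma>
      using permutes_image[OF that] vs(1) by (metis atMost_iff imageE)
    then show ?thesis by (auto simp: S_def)
  qed
  have "permutation_form n (\<alpha> y) (\<lambda>u v. c * \<alpha> u v) vs = sum t (\<Union>p\<in>{..2 * n}. S p)"
    unfolding permutation_form_def t_def U[symmetric] ..
  also have "\<dots> = (\<Sum>p\<le>2 * n. sum t (S p))"
    using fin by (intro sum.UNION_disjoint) (auto simp: S_def dest: permutes_inj injD)
  also have "\<dots> = 0" using z by simp
  finally show ?thesis .
qed

text \<open>With the base point adjoined as first argument, a family of forms depending linearly on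
  it becomes a single form of degree 2n+2, to which dimension counts in the ambient space apply. A
  repetition that involves the first argument is \<open>permutation_form_radial\<close>.\<close>

lemma permutation_form_bilinear_alternating:
  fixes \<alpha> :: "'a::real_vector \<Rightarrow> 'a \<Rightarrow> real"
  assumes \<alpha>: "\<And>u v. \<alpha> u v = - \<alpha> v u" and lin: "\<And>u. linear (\<alpha> u)"
  shows "alternating_on (Suc (Suc (2 * n))) UNIV
    (\<lambda>us. permutation_form n (\<alpha> (hd us)) (\<lambda>u v. c * \<alpha> u v) (tl us))"
proof -
  have lin': "linear (\<lambda>u. \<alpha> u v)" for v using linear_compose_neg[OF lin[of v]] \<alpha>[of _ v] by simp
  have alt: "alternating_on (Suc (2 * n)) UNIV (permutation_form n (\<alpha> y) (\<lambda>u v. c * \<alpha> u v))" for y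
    using lin lin' by (intro permutation_form_alternating) (auto simp: linear_iff algebra_simps)
  have lin0: "linear (\<lambda>y. permutation_form n (\<alpha> y) (\<lambda>u v. c * \<alpha> u v) ws)" for ws
    unfolding permutation_form_def
  proof (intro linear_compose_sum ballI)
    fix \<sigma> assume "\<sigma> \<in> {\<sigma>. \<sigma> permutes {..2 * n}}"
    show "linear (\<lambda>y. of_int (sign \<sigma>) * (\<alpha> y (ws ! \<sigma> 0) *
        (\<Prod>i<n. c * \<alpha> (ws ! \<sigma> (2 * i + 1)) (ws ! \<sigma> (2 * i + 2)))))"
      using lin'[of "ws ! \<sigma> 0"] by (auto simp: linear_iff algebra_simps)
  qed
  show ?thesis
    unfolding alternating_on_def
  proof (intro allI impI conjI ballI; elim conjE)
    fix us :: "'a list" and i u v a b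
    assume h: "length us = Suc (Suc (2 * n))" "i < Suc (Suc (2 * n))"
    then obtain y ws where us: "us = y # ws" "length ws = Suc (2 * n)" by (cases us) auto
    show "permutation_form n (\<alpha> (hd (us[i := a *\<^sub>R u + b *\<^sub>R v]))) (\<lambda>u v. c * \<alpha> u v) (tl (us[i := a *\<^sub>R u + b *\<^sub>R v])) =
       a * permutation_form n (\<alpha> (hd (us[i := u]))) (\<lambda>u v. c * \<alpha> u v) (tl (us[i := u])) +
       b * permutation_form n (\<alpha> (hd (us[i := v]))) (\<lambda>u v. c * \<alpha> u v) (tl (us[i := v]))"
    proof (cases i)
      case 0
      then show ?thesis
        using linear_add[OF lin0[of ws], of "a *\<^sub>R u" "b *\<^sub>R v"] linear_scale[OF lin0[of ws]] us
        by simp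
    next
      case (Suc k)
      then show ?thesis using alternating_on_lin[OF alt, of ws k u v] us h by simp
    qed
  next
    fix us :: "'a list" assume h: "length us = Suc (Suc (2 * n))" "\<not> distinct us"
    then obtain y ws where us: "us = y # ws" "length ws = Suc (2 * n)" by (cases us) auto
    show "permutation_form n (\<alpha> (hd us)) (\<lambda>u v. c * \<alpha> u v) (tl us) = 0"
    proof (cases "y \<in> set ws")
      case True
      then obtain j where "j < Suc (2 * n)" "ws ! j = y" using us by (auto simp: in_set_conv_nth)
      then show ?thesis using permutation_form_radial[OF \<alpha>, of j n ws y] us by simp
    next
      case False
      then show ?thesis using alternating_on_not_distinct[OF alt, of ws] us h by simp
    qed
  qed
qed

text \<open>Gram matrix of a symplectic basis with pairs (1,2), (3,4), and so on. Numbering starts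
  at 1 because position 0 belongs to \<omega>.\<close>

definition pairing :: "nat \<Rightarrow> nat \<Rightarrow> real" where
  "pairing p q = (if odd p \<and> q = p + 1 then 1 else if odd q \<and> p = q + 1 then -1 else 0)"

lemma pairing_antisym: "pairing p q = - pairing q p"
  by (auto simp: pairing_def)

text \<open>Precomposing with the exchange of two pairs, or of the two members of a pair, does not change
  the term, and these moves reduce every nonzero term to that of the identity.\<close>

lemma pairing_term_nonneg:
  "\<sigma> permutes {1..2 * m} \<Longrightarrow>
     0 \<le> of_int (sign \<sigma>) * (\<Prod>i<m. pairing (\<sigma> (2 * i + 1)) (\<sigma> (2 * i + 2)))"
proof (induction m arbitrary: \<sigma>)
  case 0
  then have "\<sigma> = id" by (simp add: permutes_empty)
  then show ?case by simp
next
  case (Suc m)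
  let ?Q = "\<lambda>\<sigma>. of_int (sign \<sigma>) * (\<Prod>i<Suc m. pairing (\<sigma> (2 * i + 1)) (\<sigma> (2 * i + 2)))"
  let ?S = "{1..2 * Suc m}"
  have base: "0 \<le> ?Q \<sigma>" if \<sigma>: "\<sigma> permutes ?S" and fix1: "\<sigma> (2 * m + 1) = 2 * m + 1"
    and fix2: "\<sigma> (2 * m + 2) = 2 * m + 2" for \<sigma>
  proof -
    have "\<sigma> permutes {1..2 * m}"
    proof (rule permutes_superset[OF \<sigma>])
      fix x assume "x \<in> ?S - {1..2 * m}"
      then have "x = 2 * m + 1 \<or> x = 2 * m + 2" by auto
      then show "\<sigma> x = x" using fix1 fix2 by auto
    qed
    from Suc.IH[OF this] show ?thesis using fix1 fix2 by (simp add: pairing_def)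
  qed
  have last: "0 \<le> ?Q \<sigma>" if \<sigma>: "\<sigma> permutes ?S"
    and f: "\<sigma> (2 * m + 1) = 2 * m + 2 \<or> \<sigma> (2 * m + 2) = 2 * m + 2" for \<sigma>
  proof (cases "pairing (\<sigma> (2 * m + 1)) (\<sigma> (2 * m + 2)) = 0")
    case True
    then show ?thesis by simp
  next
    case False
    from f show ?thesis
    proof
      assume *: "\<sigma> (2 * m + 2) = 2 * m + 2"
      then have "\<sigma> (2 * m + 1) = 2 * m + 1" using False by (auto simp: pairing_def split: if_splits)
      then show ?thesis using base[OF \<sigma>] * by blast
    next
      assume *: "\<sigma> (2 * m + 1) = 2 * m + 2"
      then have **: "\<sigma> (2 * m + 2) = 2 * m + 1" using False by (auto simp: pairing_def split: if_splits)
      \<comment> \<open>Exchanging the members of the last pair reverses both the sign of the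
        permutation and the last factor.\<close>
      define \<tau> where "\<tau> = Transposition.transpose (2 * m + 1) (2 * m + 2)"
      have \<tau>: "\<tau> permutes ?S" unfolding \<tau>_def by (intro permutes_swap_id) auto
      have "0 \<le> ?Q (\<sigma> \<circ> \<tau>)"
        using * ** by (intro base permutes_compose[OF \<tau> \<sigma>]) (simp_all add: \<tau>_def)
      moreover have "sign (\<sigma> \<circ> \<tau>) = - sign \<sigma>"
        using sign_compose_permutes[OF finite_atLeastAtMost \<sigma> \<tau>] by (simp add: \<tau>_def sign_swap_id)
      moreover have "(\<Prod>i<m. pairing ((\<sigma> \<circ> \<tau>) (2 * i + 1)) ((\<sigma> \<circ> \<tau>) (2 * i + 2)))
          = (\<Prod>i<m. pairing (\<sigma> (2 * i + 1)) (\<sigma> (2 * i + 2)))"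
        by (intro prod.cong) (auto simp: \<tau>_def Transposition.transpose_def)
      moreover have "pairing ((\<sigma> \<circ> \<tau>) (2 * m + 1)) ((\<sigma> \<circ> \<tau>) (2 * m + 2))
          = - pairing (\<sigma> (2 * m + 1)) (\<sigma> (2 * m + 2))"
        using pairing_antisym[of "\<sigma> (2 * m + 2)" "\<sigma> (2 * m + 1)"] by (simp add: \<tau>_def)
      ultimately show ?thesis by simp
    qed
  qed
  have "2 * m + 2 \<in> \<sigma> ` ?S" unfolding permutes_image[OF Suc.prems] by simp
  then obtain p where p: "p \<in> ?S" "\<sigma> p = 2 * m + 2" by force
  have "p \<le> 2 * Suc m" "p \<noteq> 0" using p(1) by auto
  then obtain i where i: "i < Suc m" "p = 2 * i + 1 \<or> p = 2 * i + 2"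
    using position_cases[of p "Suc m" "\<exists>i<Suc m. p = 2 * i + 1 \<or> p = 2 * i + 2"] by blast
  \<comment> \<open>\<open>i\<close> numbers the pair of positions containing the preimage of the
    largest index. \<open>\<tau>\<close> exchanges that pair with the last one; it is a product of
    two transpositions, or the identity if \<open>i = m\<close>, and hence even.\<close>
  define \<rho> where "\<rho> = Transposition.transpose i m"
  define \<tau> where "\<tau> = Transposition.transpose (2 * i + 1) (2 * m + 1) \<circ> Transposition.transpose (2 * i + 2) (2 * m + 2)"
  have t: "Transposition.transpose (2 * i + 1) (2 * m + 1) permutes ?S" "Transposition.transpose (2 * i + 2) (2 * m + 2) permutes ?S"
    using i by (auto intro!: permutes_swap_id)
  then have \<tau>: "\<tau> permutes ?S" unfolding \<tau>_def by (intro permutes_compose)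
  have "sign \<tau> = 1"
    using sign_compose_permutes[OF finite_atLeastAtMost t] by (simp add: \<tau>_def sign_swap_id)
  then have s: "sign (\<sigma> \<circ> \<tau>) = sign \<sigma>"
    using sign_compose_permutes[OF finite_atLeastAtMost Suc.prems \<tau>] by simp
  have \<tau>v: "\<tau> (2 * l + 1) = 2 * \<rho> l + 1" "\<tau> (2 * l + 2) = 2 * \<rho> l + 2" for l
    unfolding \<tau>_def \<rho>_def Transposition.transpose_def by (auto; presburger)+
  have \<rho>: "\<rho> permutes {..<Suc m}" unfolding \<rho>_def using i by (intro permutes_swap_id) auto
  have "?Q (\<sigma> \<circ> \<tau>) = of_int (sign \<sigma>) *
      (\<Prod>l<Suc m. (\<lambda>l. pairing (\<sigma> (2 * l + 1)) (\<sigma> (2 * l + 2))) (\<rho> l))"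
    unfolding s o_apply \<tau>v ..
  also have "\<dots> = ?Q \<sigma>"
    using prod.permute[OF \<rho>, of "\<lambda>l. pairing (\<sigma> (2 * l + 1)) (\<sigma> (2 * l + 2))"]
    by (simp only: comp_def)
  finally have "?Q (\<sigma> \<circ> \<tau>) = ?Q \<sigma>" .
  moreover have "0 \<le> ?Q (\<sigma> \<circ> \<tau>)"
  proof (rule last)
    have "\<rho> m = i" by (simp add: \<rho>_def)
    show "(\<sigma> \<circ> \<tau>) (2 * m + 1) = 2 * m + 2 \<or> (\<sigma> \<circ> \<tau>) (2 * m + 2) = 2 * m + 2"
      using i(2) p(2) unfolding o_apply \<tau>v \<open>\<rho> m = i\<close> by blast
  qed (rule permutes_compose[OF \<tau> Suc.prems])
  ultimately show ?case by simp
qed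

text \<open>As \<open>\<omega>\<close> vanishes on every vector after the first, only permutations
  fixing 0 contribute. Their terms are one nonzero factor times non-negative numbers, with 1 for the
  identity, so nothing can cancel.\<close>

lemma permutation_form_symplectic_basis:
  assumes vs: "\<omega> (vs ! 0) \<noteq> 0" "\<And>p. 0 < p \<Longrightarrow> p \<le> 2 * n \<Longrightarrow> \<omega> (vs ! p) = 0"
    and \<beta>: "\<And>p q. 0 < p \<Longrightarrow> p \<le> 2 * n \<Longrightarrow> 0 < q \<Longrightarrow> q \<le> 2 * n \<Longrightarrow> \<beta> (vs ! p) (vs ! q) = b * pairing p q"
    and b: "b \<noteq> 0"
  shows "permutation_form n \<omega> \<beta> vs \<noteq> 0"
proof -
  let ?q = "\<lambda>\<sigma>. of_int (sign \<sigma>) * (\<Prod>i<n. pairing (\<sigma> (2 * i + 1)) (\<sigma> (2 * i + 2)))"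
  have fin: "finite {\<sigma>. \<sigma> permutes {..2 * n}}" by (simp add: finite_permutations)
  have sub: "{\<sigma>. \<sigma> permutes {1..2 * n}} \<subseteq> {\<sigma>. \<sigma> permutes {..2 * n}}"
    by (auto intro: permutes_subset)
  have "permutation_form n \<omega> \<beta> vs
      = (\<Sum>\<sigma> | \<sigma> permutes {1..2 * n}. of_int (sign \<sigma>) *
         (\<omega> (vs ! \<sigma> 0) * (\<Prod>i<n. \<beta> (vs ! \<sigma> (2 * i + 1)) (vs ! \<sigma> (2 * i + 2)))))"
    unfolding permutation_form_def
  proof (intro sum.mono_neutral_right fin sub ballI)
    fix \<sigma> assume \<sigma>: "\<sigma> \<in> {\<sigma>. \<sigma> permutes {..2 * n}} - {\<sigma>. \<sigma> permutes {1..2 * n}}"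
    have "\<sigma> 0 \<noteq> 0"
    proof
      assume "\<sigma> 0 = 0"
      have "\<sigma> permutes {1..2 * n}"
      proof (rule permutes_superset)
        show "\<sigma> permutes {..2 * n}" using \<sigma> by simp
        show "\<sigma> x = x" if "x \<in> {..2 * n} - {1..2 * n}" for x
        proof -
          have "x = 0" using that by (cases x) auto
          then show ?thesis using \<open>\<sigma> 0 = 0\<close> by simp
        qed
      qed
      then show False using \<sigma> by blast
    qed
    moreover have "\<sigma> 0 \<le> 2 * n" using \<sigma> permutes_in_image[of \<sigma> "{..2 * n}" 0] by simp
    ultimately show "of_int (sign \<sigma>) *
         (\<omega> (vs ! \<sigma> 0) * (\<Prod>i<n. \<beta> (vs ! \<sigma> (2 * i + 1)) (vs ! \<sigma> (2 * i + 2)))) = 0"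
      using vs(2) by simp
  qed
  also have "\<dots> = (\<Sum>\<sigma> | \<sigma> permutes {1..2 * n}. (\<omega> (vs ! 0) * b ^ n) * ?q \<sigma>)"
  proof (rule sum.cong[OF refl])
    fix \<sigma> assume "\<sigma> \<in> {\<sigma>. \<sigma> permutes {1..2 * n}}"
    then have \<sigma>: "\<sigma> permutes {1..2 * n}" by simp
    then have "\<sigma> 0 = 0" by (auto simp: permutes_def)
    moreover have "\<beta> (vs ! \<sigma> (2 * i + 1)) (vs ! \<sigma> (2 * i + 2))
        = b * pairing (\<sigma> (2 * i + 1)) (\<sigma> (2 * i + 2))" if "i < n" for i
    proof -
      have "\<sigma> (2 * i + 1) \<in> {1..2 * n}" "\<sigma> (2 * i + 2) \<in> {1..2 * n}"
        unfolding permutes_in_image[OF \<sigma>] using that by auto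
      then show ?thesis by (intro \<beta>) auto
    qed
    ultimately show "of_int (sign \<sigma>) *
         (\<omega> (vs ! \<sigma> 0) * (\<Prod>i<n. \<beta> (vs ! \<sigma> (2 * i + 1)) (vs ! \<sigma> (2 * i + 2))))
       = (\<omega> (vs ! 0) * b ^ n) * ?q \<sigma>"
      by (simp add: prod.distrib)
  qed
  also have "\<dots> = (\<omega> (vs ! 0) * b ^ n) * (\<Sum>\<sigma> | \<sigma> permutes {1..2 * n}. ?q \<sigma>)"
    by (simp add: sum_distrib_left)
  finally have eq: "permutation_form n \<omega> \<beta> vs
    = (\<omega> (vs ! 0) * b ^ n) * (\<Sum>\<sigma> | \<sigma> permutes {1..2 * n}. ?q \<sigma>)" .
  have "?q id \<le> (\<Sum>\<sigma> | \<sigma> permutes {1..2 * n}. ?q \<sigma>)"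
    using pairing_term_nonneg by (intro member_le_sum) (auto simp: permutes_id[unfolded id_def] finite_permutations)
  moreover have "?q id = 1" by (simp add: pairing_def)
  ultimately show ?thesis using eq vs(1) b by simp
qed

section \<open>Images of diffusions and tangent vectors\<close>

lemma martingale_cong:
  assumes P: "prob_space P" and F: "filtration (space P) F" "\<And>t. sets (F t) \<subseteq> sets P"
    and eq: "\<And>t w. 0 \<le> t \<Longrightarrow> w \<in> space P \<Longrightarrow> Y t w = Z t w"
    and Y: "martingale P F Y"
  shows "martingale P F Z"
proof -
  have sp: "space (F t) = space P" for t using F(1) by (simp add: filtration_def)
  have m: "Z t \<in> borel_measurable (F t)" if "0 \<le> t" for t
    using Y that eq[OF that] sp measurable_cong[of "F t" "Y t" "Z t" borel]
    by (auto simp: martingale_def)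
  have i: "integrable P (Z t)" if "0 \<le> t" for t
    using Y that eq[OF that] Bochner_Integration.integrable_cong[of P P "Y t" "Z t"]
    by (auto simp: martingale_def)
  have c: "AE w in P. real_cond_exp P (F s) (Z t) w = Z s w" if st: "0 \<le> s" "s \<le> t" for s t
  proof -
    interpret prob_space P by (rule P)
    have "subalgebra P (F s)" using F(2) sp by (auto simp: subalgebra_def)
    then interpret finite_measure_subalgebra P "F s" by unfold_locales
    have t: "0 \<le> t" using st by simp
    have "AE w in P. real_cond_exp P (F s) (Y t) w = real_cond_exp P (F s) (Z t) w"
      using eq[OF t] i[OF t] Y t
      by (intro real_cond_exp_cong) (auto simp: martingale_def)
    moreover have "AE w in P. real_cond_exp P (F s) (Y t) w = Y s w"
      using Y st by (auto simp: martingale_def)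
    moreover have "AE w in P. Y s w = Z s w" using eq[OF st(1)] by auto
    ultimately show ?thesis by eventually_elim simp
  qed
  show ?thesis unfolding martingale_def using m i c by blast
qed

text \<open>\<open>proper\<close> serves twice: it gives f(r) compact support, and it carries the
  exit from compact sets at the lifetime over to the image.\<close>

lemma diffusion_image:
  fixes r :: "'a::euclidean_space \<Rightarrow> 'b::euclidean_space"
  assumes X: "diffusion P F E L \<zeta> X"
    and E: "E \<in> sets borel" and r: "continuous_on E r" "\<And>x. x \<in> E \<Longrightarrow> r x \<in> I"
    and proper: "\<And>K. compact K \<Longrightarrow> K \<subseteq> I \<Longrightarrow> compact {x \<in> E. r x \<in> K}"
    and smooth: "\<And>f. smooth_along I f \<Longrightarrow> smooth_along E (\<lambda>x. f (r x))"
    and gen: "\<And>f x. smooth_along I f \<Longrightarrow> x \<in> E \<Longrightarrow> L (\<lambda>x. f (r x)) x = L' f (r x)"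
  shows "diffusion P F I L' \<zeta> (\<lambda>t w. r (X t w))"
proof -
  have P: "prob_space P" and F: "filtration (space P) F" "\<And>t. sets (F t) \<subseteq> sets P"
    and \<zeta>: "\<And>w. w \<in> space P \<Longrightarrow> 0 < \<zeta> w"
    and XE: "\<And>w t. w \<in> space P \<Longrightarrow> 0 \<le> t \<Longrightarrow> ereal t < \<zeta> w \<Longrightarrow> X t w \<in> E"
    and cont: "\<And>w. w \<in> space P \<Longrightarrow> continuous_on {t. 0 \<le> t \<and> ereal t < \<zeta> w} (\<lambda>t. X t w)"
    and meas: "\<And>t B. 0 \<le> t \<Longrightarrow> B \<in> sets borel \<Longrightarrow>
        {w \<in> space P. ereal t < \<zeta> w \<and> X t w \<in> B} \<in> sets (F t)"
    and leave: "\<And>w K. w \<in> space P \<Longrightarrow> \<zeta> w < \<infinity> \<Longrightarrow> compact K \<Longrightarrow> K \<subseteq> E \<Longrightarrow>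
        \<forall>\<^sub>F t in at_left (real_of_ereal (\<zeta> w)). X t w \<notin> K"
    and mart: "\<And>f. f \<in> test_functions E \<Longrightarrow> martingale P F (\<lambda>t w.
        before_lifetime \<zeta> X f t w - f (X 0 w) - (LINT s:{0..t}|lborel. before_lifetime \<zeta> X (L f) s w))"
    using X unfolding diffusion_def by auto
  have c: "continuous_on {t. 0 \<le> t \<and> ereal t < \<zeta> w} (\<lambda>t. r (X t w))" if "w \<in> space P" for w
    using XE that by (intro continuous_on_compose2[OF r(1) cont[OF that]]) auto
  have m: "{w \<in> space P. ereal t < \<zeta> w \<and> r (X t w) \<in> B} \<in> sets (F t)"
    if "0 \<le> t" "B \<in> sets borel" for t B
  proof -
    have "r \<in> borel_measurable (restrict_space borel E)"
      using r(1) by (rule borel_measurable_continuous_on_restrict)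
    then have "r -` B \<inter> space (restrict_space borel E) \<in> sets (restrict_space borel E)"
      using that(2) by (rule measurable_sets)
    \<comment> \<open>\<open>r\<close> is controlled on \<open>E\<close> only; before the lifetime
      the path is in \<open>E\<close>, so intersecting with \<open>E\<close> does not change the
      event.\<close>
    then have "r -` B \<inter> E \<in> sets borel"
      using E by (simp add: space_restrict_space sets_restrict_space_iff)
    from meas[OF that(1) this] show ?thesis
      using XE[OF _ that(1)] by (elim back_subst[of "\<lambda>S. S \<in> sets (F t)"]) auto
  qed
  have l: "\<forall>\<^sub>F t in at_left (real_of_ereal (\<zeta> w)). r (X t w) \<notin> K"
    if w: "w \<in> space P" "\<zeta> w < \<infinity>" and K: "compact K" "K \<subseteq> I" for w K
  proof -
    obtain z where z: "\<zeta> w = ereal z" "0 < z" using \<zeta>[OF w(1)] w(2) by (cases "\<zeta> w") auto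
    have "\<forall>\<^sub>F t in at_left z. X t w \<notin> {x \<in> E. r x \<in> K}"
      using leave[OF w proper[OF K]] z by auto
    \<comment> \<open>Times in this interval are non-negative and before the lifetime, which is what
      places the path in \<open>E\<close>.\<close>
    moreover have "\<forall>\<^sub>F t in at_left z. t \<in> {0<..<z}" using eventually_at_left_real[OF z(2)] .
    ultimately have "\<forall>\<^sub>F t in at_left z. r (X t w) \<notin> K"
      by eventually_elim (use XE[OF w(1)] z in auto)
    then show ?thesis using z by simp
  qed
  have M: "martingale P F (\<lambda>t w. before_lifetime \<zeta> (\<lambda>t w. r (X t w)) f t w - f (r (X 0 w)) -
      (LINT s:{0..t}|lborel. before_lifetime \<zeta> (\<lambda>t w. r (X t w)) (L' f) s w))"
    if f: "f \<in> test_functions I" for f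
  proof -
    obtain K where K: "compact K" "K \<subseteq> I" "\<forall>x\<in>I - K. f x = 0" and sm: "smooth_along I f"
      using f by (auto simp: test_functions_def)
    have "(\<lambda>x. f (r x)) \<in> test_functions E"
      unfolding test_functions_def
      using smooth[OF sm] proper[OF K(1,2)] K(3) r(2)
      by (auto intro!: exI[of _ "{x \<in> E. r x \<in> K}"])
    then have mf: "martingale P F (\<lambda>t w. before_lifetime \<zeta> X (\<lambda>x. f (r x)) t w - f (r (X 0 w)) -
      (LINT s:{0..t}|lborel. before_lifetime \<zeta> X (L (\<lambda>x. f (r x))) s w))"
      using mart by blast
    show ?thesis
    proof (rule martingale_cong[OF P F _ mf])
      fix t :: real and w assume t: "0 \<le> t" and w: "w \<in> space P"
      \<comment> \<open>The integrands agree pointwise: before the lifetime by \<open>gen\<close>,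
        afterwards because both are 0.\<close>
      have "(LINT s:{0..t}|lborel. before_lifetime \<zeta> X (L (\<lambda>x. f (r x))) s w)
          = (LINT s:{0..t}|lborel. before_lifetime \<zeta> (\<lambda>t w. r (X t w)) (L' f) s w)"
        using gen[OF sm XE[OF w]] by (intro set_lebesgue_integral_cong) (auto simp: before_lifetime_def)
      then show "before_lifetime \<zeta> X (\<lambda>x. f (r x)) t w - f (r (X 0 w)) -
          (LINT s:{0..t}|lborel. before_lifetime \<zeta> X (L (\<lambda>x. f (r x))) s w)
        = before_lifetime \<zeta> (\<lambda>t w. r (X t w)) f t w - f (r (X 0 w)) -
          (LINT s:{0..t}|lborel. before_lifetime \<zeta> (\<lambda>t w. r (X t w)) (L' f) s w)"
        by (simp add: before_lifetime_def)
    qed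
  qed
  show ?thesis
    unfolding diffusion_def
  proof (intro conjI ballI allI impI)
    fix w K assume "w \<in> space P" "\<zeta> w < \<infinity>" "compact K \<and> K \<subseteq> I"
    then show "\<forall>\<^sub>F t in at_left (real_of_ereal (\<zeta> w)). r (X t w) \<notin> K" by (intro l) auto
  qed (use P F \<zeta> XE r(2) c m M in simp_all)
qed

text \<open>Two derivatives within \<open>E\<close> may differ as linear maps, but along a curve in
  \<open>E\<close> with velocity \<open>v\<close> each of them computes the derivative of
  \<open>f\<close> along that curve.\<close>

lemma frechet_derivative_within_tangent:
  fixes f :: "'a::euclidean_space \<Rightarrow> real"
  assumes f: "(f has_derivative f') (at x within E)" and v: "v \<in> tangent_space E x"
  shows "frechet_derivative f (at x within E) v = f' v"
proof -
  obtain \<gamma> :: "real \<Rightarrow> 'a" where \<gamma>: "\<gamma> 0 = x" "\<forall>\<^sub>F t in nhds 0. \<gamma> t \<in> E"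
    "(\<gamma> has_vector_derivative v) (at 0)"
    using v unfolding tangent_space_def by blast
  obtain U where U: "open U" "0 \<in> U" "\<And>t. t \<in> U \<Longrightarrow> \<gamma> t \<in> E"
    using \<gamma>(2) unfolding eventually_nhds by blast
  have g: "(\<gamma> has_vector_derivative v) (at 0 within U)"
    using \<gamma>(3) by (rule has_vector_derivative_at_within)
  have *: "((\<lambda>t. f (\<gamma> t)) has_vector_derivative D v) (at 0)"
    if D: "(f has_derivative D) (at x within E)" for D
  proof -
    have "(f has_derivative D) (at (\<gamma> 0) within \<gamma> ` U)"
      using D U(3) \<gamma>(1) by (auto intro: has_derivative_subset)
    note chain = diff_chain_within[OF g[unfolded has_vector_derivative_def] this]
    have eq: "D \<circ> (\<lambda>h. h *\<^sub>R v) = (\<lambda>h. h *\<^sub>R D v)"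
    proof
      show "(D \<circ> (\<lambda>h. h *\<^sub>R v)) h = h *\<^sub>R D v" for h
        using linear_scale[OF has_derivative_linear[OF D], of h v] by simp
    qed
    have "((\<lambda>t. f (\<gamma> t)) has_derivative (\<lambda>h. h *\<^sub>R D v)) (at 0 within U)"
      using chain[unfolded eq] unfolding o_def .
    then show ?thesis
      unfolding has_vector_derivative_def at_within_open[OF U(2,1)] .
  qed
  have "(f has_derivative frechet_derivative f (at x within E)) (at x within E)"
    using f by (auto simp: frechet_derivative_works[symmetric] differentiable_def)
  from vector_derivative_unique_at[OF *[OF this] *[OF f]] show ?thesis .
qed

lemma tangent_space_level_set:
  fixes \<phi> :: "'a::euclidean_space \<Rightarrow> real"
  assumes \<phi>: "(\<phi> has_derivative \<phi>') (at x)" and E: "\<And>y. y \<in> E \<Longrightarrow> \<phi> y = c"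
    and v: "v \<in> tangent_space E x"
  shows "\<phi>' v = 0"
proof -
  obtain \<gamma> :: "real \<Rightarrow> 'a" where \<gamma>: "\<gamma> 0 = x" "\<forall>\<^sub>F t in nhds 0. \<gamma> t \<in> E"
    "(\<gamma> has_vector_derivative v) (at 0)"
    using v unfolding tangent_space_def by blast
  have "((\<lambda>t. \<phi> (\<gamma> t)) has_derivative (\<lambda>h. \<phi>' (h *\<^sub>R v))) (at 0)"
    using \<gamma>(1,3) \<phi> has_derivative_compose[of \<gamma> "\<lambda>h. h *\<^sub>R v" 0 UNIV \<phi> \<phi>']
    unfolding has_vector_derivative_def by simp
  moreover obtain U where U: "open U" "0 \<in> U" "\<And>t. t \<in> U \<Longrightarrow> \<gamma> t \<in> E"
    using \<gamma>(2) unfolding eventually_nhds by blast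
  ultimately have "((\<lambda>t. c) has_derivative (\<lambda>h. \<phi>' (h *\<^sub>R v))) (at 0)"
    using E by (elim has_derivative_transform_within_open[OF _ U(1,2)]) auto
  from has_derivative_unique[OF this has_derivative_const]
  have "\<phi>' (h *\<^sub>R v) = 0" for h by meson
  from this[of 1] show ?thesis by simp
qed

section \<open>The sub-Laplacian on radial functions\<close>

text \<open>\<^term>\<open>N\<close> is the sub-Riemannian normal up to sign, \<^term>\<open>X\<close> the unit radial field, and \<^term>\<open>W\<close>
  the tangent space of the hypersurface.\<close>

locale radial_hypersurface =
  fixes C :: "'a::euclidean_space contact_sr" and S E :: "'a set" and n :: nat
    and W :: "'a \<Rightarrow> 'a set" and N X :: "'a \<Rightarrow> 'a"
    and r :: "'a \<Rightarrow> real" and r' :: "'a \<Rightarrow> 'a \<Rightarrow> real"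
    and T :: "'a list \<Rightarrow> real" and q :: "'a \<Rightarrow> real"
  assumes half_rank: "half_rank C = n" and n_pos: "0 < n"
    and noncharacteristic: "noncharacteristic C S = E"
    and openin_E: "openin (top_of_set S) E"
    and tangent_S: "\<And>x. x \<in> E \<Longrightarrow> tangent_space S x = W x"
    and tangent_E: "\<And>x. x \<in> E \<Longrightarrow> tangent_space E x = W x"
    and subspace_W: "\<And>x. x \<in> E \<Longrightarrow> subspace (W x)"
    and dim_W: "\<And>x. x \<in> E \<Longrightarrow> dim (W x) \<le> 2 * n"
    and volume_alternating: "\<And>x. x \<in> E \<Longrightarrow> alternating_on (Suc (2 * n)) UNIV (contact_volume C x)"
    and volume_nonzero: "\<And>x. x \<in> E \<Longrightarrow>
      \<exists>Zs. length Zs = 2 * n \<and> set Zs \<subseteq> W x \<and> contact_volume C x (N x # Zs) \<noteq> 0"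
    and subspace_distribution: "\<And>x. x \<in> E \<Longrightarrow> subspace (distribution C x)"
    and metric_sym: "\<And>x u v. x \<in> E \<Longrightarrow> metric C x u v = metric C x v u"
    and metric_linear: "\<And>x u. x \<in> E \<Longrightarrow> linear (metric C x u)"
    and metric_pos: "\<And>x Y. x \<in> E \<Longrightarrow> Y \<in> foliation C S x \<Longrightarrow> metric C x Y Y = 0 \<Longrightarrow> Y = 0"
    and N_distribution: "\<And>x. x \<in> E \<Longrightarrow> N x \<in> distribution C x"
    and N_unit: "\<And>x. x \<in> E \<Longrightarrow> metric C x (N x) (N x) = 1"
    and N_orthogonal: "\<And>x Y. x \<in> E \<Longrightarrow> Y \<in> foliation C S x \<Longrightarrow> metric C x (N x) Y = 0"
    and N_complement: "\<And>x v. x \<in> E \<Longrightarrow> v \<in> distribution C x \<Longrightarrow>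
      \<exists>c. v - c *\<^sub>R N x \<in> foliation C S x"
    and X_foliation: "\<And>x. x \<in> E \<Longrightarrow> X x \<in> foliation C S x"
    and r_derivative: "\<And>x. x \<in> E \<Longrightarrow> (r has_derivative r' x) (at x within E)"
    and r'_metric: "\<And>x Y. x \<in> E \<Longrightarrow> Y \<in> foliation C S x \<Longrightarrow> r' x Y = metric C x (X x) Y"
    and r'_X: "\<And>x. x \<in> E \<Longrightarrow> r' x (X x) = 1"
    and T_alternating: "alternating_on (2 * n) UNIV T"
    and volume_N_X: "\<And>x y ws. x \<in> E \<Longrightarrow> y \<in> E \<Longrightarrow> Suc (length ws) = 2 * n \<Longrightarrow> set ws \<subseteq> W x \<Longrightarrow>
      contact_volume C y (N y # X y # ws) = T (y # ws)"
    and T_eq: "\<And>x vs. x \<in> E \<Longrightarrow> length vs = 2 * n \<Longrightarrow> set vs \<subseteq> W x \<Longrightarrow>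
      T vs = q x * contact_volume C x (N x # vs)"
    and sections: "\<And>x v. x \<in> E \<Longrightarrow> v \<in> W x \<Longrightarrow>
      \<exists>V. continuous_on E V \<and> (\<forall>y\<in>E. V y \<in> W y) \<and> V x = v"
    and volume_continuous: "\<And>Z. (\<And>i. i < 2 * n \<Longrightarrow> continuous_on E (Z i)) \<Longrightarrow>
      continuous_on E (\<lambda>y. contact_volume C y (N y # map (\<lambda>i. Z i y) [0..<2 * n]))"
begin

section \<open>Frames and top-degree forms on the hypersurface\<close>

lemma E_subset: "x \<in> E \<Longrightarrow> x \<in> S"
  using openin_imp_subset[OF openin_E] by blast

lemma foliation_eq: "x \<in> E \<Longrightarrow> foliation C S x = distribution C x \<inter> W x"
  by (simp add: foliation_def tangent_S)

lemma subspace_foliation: "x \<in> E \<Longrightarrow> subspace (foliation C S x)"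
  by (simp add: foliation_eq subspace_inter subspace_distribution subspace_W)

lemma mu_alternating:
  "x \<in> E \<Longrightarrow> alternating_on (2 * n) (W x) (\<lambda>vs. contact_volume C x (N x # vs))"
  using alternating_on_subset[OF alternating_on_Cons[OF volume_alternating]] by simp

lemma volume_scale:
  assumes "x \<in> E" "length vs = 2 * n"
  shows "contact_volume C x (c *\<^sub>R v # vs) = c * contact_volume C x (v # vs)"
  \<comment> \<open>The head 0 is a placeholder overwritten by the slot update, and the coefficient
    0 removes the second summand.\<close>
  using alternating_on_lin[OF volume_alternating[OF assms(1)], of "0 # vs" 0 v v c 0] assms(2) by simp

lemma frame_iff:
  assumes "x \<in> E"
  shows "is_frame (2 * n) S x vs \<longleftrightarrow>
    length vs = 2 * n \<and> distinct vs \<and> independent (set vs) \<and> span (set vs) = W x"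
  using tangent_S[OF assms] by (simp add: is_frame_def)

text \<open>A top-degree form detects frames: a nonzero value forces independence, and 2n
  independent vectors fill \<open>W x\<close>, whose dimension is at most 2n.\<close>

lemma frameI:
  assumes x: "x \<in> E" and A: "alternating_on (2 * n) (W x) A"
    and vs: "length vs = 2 * n" "set vs \<subseteq> W x" "A vs \<noteq> 0"
  shows "is_frame (2 * n) S x vs"
proof -
  have d: "distinct vs" using alternating_on_not_distinct[OF A vs(1,2)] vs(3) by blast
  have i: "independent (set vs)"
    using alternating_on_dependent[OF A subspace_W[OF x] vs(1,2)] vs(3) by blast
  have "W x \<subseteq> span (set vs)"
    using vs d dim_W[OF x] by (intro card_ge_dim_independent i) (simp_all add: distinct_card)
  moreover have "span (set vs) \<subseteq> W x" using span_minimal[OF vs(2) subspace_W[OF x]] .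
  ultimately show ?thesis using d i vs by (auto simp: frame_iff[OF x])
qed

lemma frame_D:
  assumes "x \<in> E" "is_frame (2 * n) S x vs"
  shows "length vs = 2 * n" "set vs \<subseteq> W x" "W x \<subseteq> span (set vs)"
  using assms span_superset[of "set vs"] by (auto simp: frame_iff)

lemma frame_exists: "x \<in> E \<Longrightarrow> \<exists>Zs. is_frame (2 * n) S x Zs"
  using volume_nonzero[of x] frameI[OF _ mu_alternating, of x] by blast

lemma mu_frame_nonzero:
  assumes x: "x \<in> E" and Z: "is_frame (2 * n) S x Zs"
  shows "contact_volume C x (N x # Zs) \<noteq> 0"
proof
  assume "contact_volume C x (N x # Zs) = 0"
  then have "contact_volume C x (N x # Ys) = 0" if "length Ys = 2 * n" "set Ys \<subseteq> W x" for Ys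
    using alternating_on_eq_0[OF mu_alternating[OF x] subspace_W[OF x] frame_D[OF x Z]] that by simp
  then show False using volume_nonzero[OF x] by blast
qed

text \<open>The difference of the two sides, read as a form in \<open>Zs\<close>, vanishes on the
  frame \<open>Ys\<close> and hence everywhere.\<close>

lemma top_forms_proportional:
  assumes x: "x \<in> E" and A: "alternating_on (2 * n) (W x) A" and B: "alternating_on (2 * n) (W x) B"
    and Z: "is_frame (2 * n) S x Zs" and Y: "is_frame (2 * n) S x Ys"
  shows "A Zs * B Ys = A Ys * B Zs"
proof -
  have "alternating_on (2 * n) (W x) (\<lambda>vs. A vs * B Ys - A Ys * B vs)"
    using A B unfolding alternating_on_def by (simp add: algebra_simps)
  from alternating_on_eq_0[OF this subspace_W[OF x] frame_D[OF x Y] _ frame_D(1,2)[OF x Z]]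
  show ?thesis by simp
qed

section \<open>Orientation and the sub-Riemannian normal\<close>

context
  fixes \<theta> :: "'a \<Rightarrow> 'a list \<Rightarrow> real"
  assumes \<theta>: "orientation_form (2 * n) S \<theta>"
begin

lemma theta_alternating:
  assumes x: "x \<in> E"
  shows "alternating_on (2 * n) (W x) (\<theta> x)"
  using \<theta> E_subset[OF x]
  unfolding orientation_form_def alternating_on_def tangent_S[OF x, symmetric] by blast

lemma theta_frame_nonzero: "x \<in> E \<Longrightarrow> is_frame (2 * n) S x Zs \<Longrightarrow> \<theta> x Zs \<noteq> 0"
  using \<theta> E_subset[of x] unfolding orientation_form_def by blast

lemma theta_continuous:
  assumes "\<And>i. i < 2 * n \<Longrightarrow> continuous_on E (Z i)" "\<And>i x. i < 2 * n \<Longrightarrow> x \<in> E \<Longrightarrow> Z i x \<in> W x"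
  shows "continuous_on E (\<lambda>x. \<theta> x (map (\<lambda>i. Z i x) [0..<2 * n]))"
proof -
  have "\<forall>i<2 * n. continuous_on E (Z i) \<and> (\<forall>x\<in>E. Z i x \<in> tangent_space S x)"
    using assms tangent_S by simp
  then show ?thesis using \<theta> openin_E unfolding orientation_form_def by blast
qed

text \<open>The sign by which \<open>N\<close> differs from the normal prescribed by
  \<open>\<theta>\<close>. At points of \<open>E\<close> top forms are proportional, so one frame
  with a positive product decides for all frames, and -1 means that all products are
  negative.\<close>

definition orientation_sign :: "'a \<Rightarrow> real" where
  "orientation_sign x =
     (if \<exists>Zs. is_frame (2 * n) S x Zs \<and> \<theta> x Zs * contact_volume C x (N x # Zs) > 0 then 1 else -1)"

lemma orientation_sign_frame:
  assumes x: "x \<in> E" and Z: "is_frame (2 * n) S x Zs"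
  shows "orientation_sign x * (\<theta> x Zs * contact_volume C x (N x # Zs)) > 0"
proof (cases "\<exists>Ys. is_frame (2 * n) S x Ys \<and> \<theta> x Ys * contact_volume C x (N x # Ys) > 0")
  case True
  then obtain Ys where Y: "is_frame (2 * n) S x Ys" "\<theta> x Ys * contact_volume C x (N x # Ys) > 0" by blast
  have "\<theta> x Zs * contact_volume C x (N x # Ys) = \<theta> x Ys * contact_volume C x (N x # Zs)"
    by (rule top_forms_proportional[OF x theta_alternating[OF x] mu_alternating[OF x] Z Y(1)])
  then have "(\<theta> x Zs * contact_volume C x (N x # Zs)) * (\<theta> x Ys * contact_volume C x (N x # Ys))
      = (\<theta> x Ys * contact_volume C x (N x # Zs))\<^sup>2"
    by (simp add: power2_eq_square algebra_simps)
  moreover have "(\<theta> x Ys * contact_volume C x (N x # Zs))\<^sup>2 > 0"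
    using theta_frame_nonzero[OF x Y(1)] mu_frame_nonzero[OF x Z] by simp
  ultimately have "\<theta> x Zs * contact_volume C x (N x # Zs) > 0"
    using Y(2) by (metis zero_less_mult_pos2)
  then show ?thesis using True by (simp add: orientation_sign_def)
next
  case False
  then have "\<not> \<theta> x Zs * contact_volume C x (N x # Zs) > 0" using Z by blast
  moreover have "\<theta> x Zs * contact_volume C x (N x # Zs) \<noteq> 0"
    using theta_frame_nonzero[OF x Z] mu_frame_nonzero[OF x Z] by simp
  ultimately have "\<theta> x Zs * contact_volume C x (N x # Zs) < 0" by linarith
  moreover have "orientation_sign x = -1" unfolding orientation_sign_def using False by (rule if_not_P)
  ultimately show ?thesis by simp
qed

lemma orientation_sign_square: "orientation_sign x * orientation_sign x = 1"
  by (simp add: orientation_sign_def)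

lemma positive_frame_exists:
  assumes x: "x \<in> E"
  shows "\<exists>Zs. is_frame (2 * n) S x Zs \<and> \<theta> x Zs > 0"
proof -
  obtain Zs where Z: "is_frame (2 * n) S x Zs" using frame_exists[OF x] by blast
  show ?thesis
  proof (cases "\<theta> x Zs > 0")
    case False
    then have neg: "\<theta> x Zs < 0" using theta_frame_nonzero[OF x Z] by simp
    \<comment> \<open>Reversing one vector of the frame reverses the sign of
      \<open>\<theta>\<close>; slot 0 exists because n > 0.\<close>
    define z where "z = Zs ! 0"
    have z: "z \<in> W x" unfolding z_def using frame_D[OF x Z] n_pos by (auto intro: nth_mem[THEN subsetD[rotated]])
    have "\<theta> x (Zs[0 := (-1) *\<^sub>R z + 0 *\<^sub>R z]) = (-1) * \<theta> x (Zs[0 := z]) + 0 * \<theta> x (Zs[0 := z])"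
      using frame_D[OF x Z] n_pos z by (intro alternating_on_lin[OF theta_alternating[OF x]]) auto
    then have pos: "\<theta> x (Zs[0 := - z]) > 0" using neg by (simp add: z_def)
    have "is_frame (2 * n) S x (Zs[0 := - z])"
      using frame_D[OF x Z] pos z subspace_neg[OF subspace_W[OF x]]
      by (intro frameI[OF x theta_alternating[OF x]]) (auto simp: set_list_update_subset)
    then show ?thesis using pos by blast
  qed (use Z in blast)
qed

lemma sr_normal_eq:
  assumes x: "x \<in> E"
  shows "sr_normal C S \<theta> x = orientation_sign x *\<^sub>R N x"
  unfolding sr_normal_def half_rank
proof (rule the_equality)
  have scale: "metric C x (c *\<^sub>R u) v = c * metric C x u v" for c u v
    using linear_scale[OF metric_linear[OF x], of v c u] metric_sym[OF x] by simp
  have diff: "metric C x (u - v) w = metric C x u w - metric C x v w" for u v w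
    using linear_diff[OF metric_linear[OF x], of w u v] metric_sym[OF x] by simp
  let ?s = "orientation_sign x"
  have "?s *\<^sub>R N x \<in> distribution C x"
    using subspace_scale[OF subspace_distribution[OF x] N_distribution[OF x]] .
  moreover have "metric C x (?s *\<^sub>R N x) (?s *\<^sub>R N x) = 1"
    using scale linear_scale[OF metric_linear[OF x]] N_unit[OF x] orientation_sign_square[of x] by simp
  moreover have "\<forall>Y\<in>foliation C S x. metric C x (?s *\<^sub>R N x) Y = 0"
    using scale N_orthogonal[OF x] by simp
  moreover have "contact_volume C x (?s *\<^sub>R N x # Zs) > 0"
    if "is_frame (2 * n) S x Zs" "\<theta> x Zs > 0" for Zs
    using orientation_sign_frame[OF x that(1)] that(2) frame_D(1)[OF x that(1)]
      zero_less_mult_pos[of "\<theta> x Zs" "?s * contact_volume C x (N x # Zs)"]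
    by (simp add: volume_scale[OF x] mult.left_commute)
  ultimately show "?s *\<^sub>R N x \<in> tangent_space (points C) x \<and> contact_form C x (?s *\<^sub>R N x) = 0 \<and>
     metric C x (?s *\<^sub>R N x) (?s *\<^sub>R N x) = 1 \<and> (\<forall>Y\<in>foliation C S x. metric C x (?s *\<^sub>R N x) Y = 0) \<and>
     (\<forall>Zs. is_frame (2 * n) S x Zs \<and> 0 < \<theta> x Zs \<longrightarrow> 0 < contact_volume C x (?s *\<^sub>R N x # Zs))"
    unfolding distribution_def by blast
  fix M
  assume M: "M \<in> tangent_space (points C) x \<and> contact_form C x M = 0 \<and>
     metric C x M M = 1 \<and> (\<forall>Y\<in>foliation C S x. metric C x M Y = 0) \<and>
     (\<forall>Zs. is_frame (2 * n) S x Zs \<and> 0 < \<theta> x Zs \<longrightarrow> 0 < contact_volume C x (M # Zs))"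
  then have "M \<in> distribution C x" unfolding distribution_def by blast
  then obtain c where c: "M - c *\<^sub>R N x \<in> foliation C S x" using N_complement[OF x] by blast
  \<comment> \<open>\<open>M\<close> and \<open>N x\<close> are both orthogonal to the foliation, so
    their difference \<open>M - c *\<^sub>R N x\<close>, which lies in it, is orthogonal to
    itself.\<close>
  have "metric C x (M - c *\<^sub>R N x) (M - c *\<^sub>R N x) = 0"
    using M c N_orthogonal[OF x c] unfolding diff scale by simp
  then have Mc: "M = c *\<^sub>R N x" using metric_pos[OF x c] by simp
  have "c * c = 1"
    using M N_unit[OF x] scale linear_scale[OF metric_linear[OF x]] unfolding Mc by simp
  then have c1: "c = 1 \<or> c = -1" by (simp add: square_eq_1_iff)
  obtain Zs where Z: "is_frame (2 * n) S x Zs" "\<theta> x Zs > 0" using positive_frame_exists[OF x] by blast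
  have "contact_volume C x (c *\<^sub>R N x # Zs) > 0" using M Z unfolding Mc by blast
  then have "c * contact_volume C x (N x # Zs) > 0"
    using volume_scale[OF x frame_D(1)[OF x Z(1)]] by simp
  moreover have "?s * contact_volume C x (N x # Zs) > 0"
    using orientation_sign_frame[OF x Z(1)] Z(2)
      zero_less_mult_pos[of "\<theta> x Zs" "?s * contact_volume C x (N x # Zs)"]
    by (simp add: mult.left_commute)
  moreover have "?s = 1 \<or> ?s = -1" by (simp add: orientation_sign_def)
  ultimately have "c = ?s" using c1 by auto
  then show "M = ?s *\<^sub>R N x" using Mc by simp
qed

text \<open>A frame at \<open>x\<close> extends by \<open>sections\<close> to continuous tangent
  fields; on these the product of \<open>\<theta>\<close> and the volume is continuous and nonzero
  at \<open>x\<close>.\<close>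

lemma orientation_sign_locally_constant:
  assumes x: "x \<in> E"
  shows "\<exists>d>0. \<forall>y\<in>E. dist y x < d \<longrightarrow> orientation_sign y = orientation_sign x"
proof -
  obtain Zs where Z: "is_frame (2 * n) S x Zs" using frame_exists[OF x] by blast
  have "\<exists>V. continuous_on E V \<and> (\<forall>y\<in>E. V y \<in> W y) \<and> V x = Zs ! i" if "i < 2 * n" for i
    using frame_D[OF x Z] that by (intro sections[OF x]) auto
  then obtain V where V: "\<And>i. i < 2 * n \<Longrightarrow> continuous_on E (V i) \<and> (\<forall>y\<in>E. V i y \<in> W y) \<and> V i x = Zs ! i"
    by metis
  define L where "L y = map (\<lambda>i. V i y) [0..<2 * n]" for y
  have Lx: "L x = Zs" unfolding L_def using V frame_D(1)[OF x Z] by (intro nth_equalityI) auto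
  define G where "G y = \<theta> y (L y) * contact_volume C y (N y # L y)" for y
  have LW: "length (L y) = 2 * n" "y \<in> E \<Longrightarrow> set (L y) \<subseteq> W y" for y
    unfolding L_def using V by auto
  have "continuous_on E G" unfolding G_def L_def
    using V by (intro continuous_on_mult theta_continuous volume_continuous) auto
  \<comment> \<open>The factor \<open>G x\<close> makes the value at \<open>x\<close> positive,
    which treats both signs at once.\<close>
  then have "continuous_on E (\<lambda>y. G x * G y)" by (intro continuous_intros)
  moreover have "G x * G x > 0"
    using theta_frame_nonzero[OF x Z] mu_frame_nonzero[OF x Z]
    by (metis G_def Lx mult_eq_0_iff not_real_square_gt_zero)
  ultimately obtain d where d: "d > 0" "\<And>y. y \<in> E \<Longrightarrow> dist y x < d \<Longrightarrow> dist (G x * G y) (G x * G x) < G x * G x"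
    using x unfolding continuous_on_iff by meson
  have "orientation_sign y = orientation_sign x" if y: "y \<in> E" "dist y x < d" for y
  proof -
    have pos: "G x * G y > 0" using d(2)[OF y] by (auto simp: dist_real_def)
    \<comment> \<open>A nonzero volume shows that the extended fields still form a frame at
      \<open>y\<close>.\<close>
    then have "contact_volume C y (N y # L y) \<noteq> 0" by (auto simp: G_def)
    then have F: "is_frame (2 * n) S y (L y)"
      using frameI[OF y(1) mu_alternating[OF y(1)] LW(1) LW(2)[OF y(1)]] by blast
    have "orientation_sign y * G y > 0" unfolding G_def by (rule orientation_sign_frame[OF y(1) F])
    moreover have "orientation_sign x * G x > 0"
      unfolding G_def Lx by (rule orientation_sign_frame[OF x Z])
    ultimately show ?thesis using pos
      by (auto simp: orientation_sign_def zero_less_mult_iff split: if_splits)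
  qed
  then show ?thesis using d(1) by blast
qed

section \<open>Gradient, flux and divergence of radial functions\<close>

context
  fixes f :: "real \<Rightarrow> real"
  assumes f: "\<And>x. x \<in> E \<Longrightarrow> (f has_real_derivative deriv f (r x)) (at (r x))"
    and f': "\<And>x. x \<in> E \<Longrightarrow> (deriv f has_real_derivative deriv (deriv f) (r x)) (at (r x))"
begin

lemma horizontal_gradient_radial:
  assumes x: "x \<in> E"
  shows "horizontal_gradient C S (\<lambda>x. f (r x)) x = deriv f (r x) *\<^sub>R X x"
  unfolding horizontal_gradient_def noncharacteristic
proof (rule the_equality)
  have scale: "metric C x (c *\<^sub>R u) v = c * metric C x u v" for c u v
    using linear_scale[OF metric_linear[OF x], of v c u] metric_sym[OF x] by simp
  have diff: "metric C x (u - v) w = metric C x u w - metric C x v w" for u v w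
    using linear_diff[OF metric_linear[OF x], of w u v] metric_sym[OF x] by simp
  have "((\<lambda>x. f (r x)) has_derivative (\<lambda>v. deriv f (r x) * r' x v)) (at x within E)"
    using has_derivative_compose[OF r_derivative[OF x], of f "\<lambda>u. deriv f (r x) * u"] f[OF x]
    by (simp add: has_field_derivative_def)
  then have fd: "frechet_derivative (\<lambda>x. f (r x)) (at x within E) Y = deriv f (r x) * r' x Y"
    if "Y \<in> foliation C S x" for Y
    using that by (intro frechet_derivative_within_tangent) (auto simp: tangent_E[OF x] foliation_eq[OF x])
  have G: "deriv f (r x) *\<^sub>R X x \<in> foliation C S x"
    using X_foliation[OF x] subspace_foliation[OF x] by (simp add: subspace_scale)
  moreover have m: "metric C x (deriv f (r x) *\<^sub>R X x) Y
      = frechet_derivative (\<lambda>x. f (r x)) (at x within E) Y" if "Y \<in> foliation C S x" for Y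
    using fd[OF that] r'_metric[OF x that] scale by simp
  ultimately show "deriv f (r x) *\<^sub>R X x \<in> foliation C S x \<and> (\<forall>Y\<in>foliation C S x.
      metric C x (deriv f (r x) *\<^sub>R X x) Y = frechet_derivative (\<lambda>x. f (r x)) (at x within E) Y)" by blast
  fix H assume H: "H \<in> foliation C S x \<and> (\<forall>Y\<in>foliation C S x.
      metric C x H Y = frechet_derivative (\<lambda>x. f (r x)) (at x within E) Y)"
  then have D: "H - deriv f (r x) *\<^sub>R X x \<in> foliation C S x"
    using G subspace_foliation[OF x] by (simp add: subspace_diff)
  have "metric C x (H - deriv f (r x) *\<^sub>R X x) (H - deriv f (r x) *\<^sub>R X x) = 0"
    using H m D by (simp add: diff)
  then show "H = deriv f (r x) *\<^sub>R X x" using metric_pos[OF x D] by simp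
qed

text \<open>The vectors \<open>ws\<close> stay fixed and tangent at \<open>x\<close> while
  \<open>y\<close> moves, so \<open>volume_N_X\<close> is applied with tangency at \<open>x\<close>
  and evaluation at \<open>y\<close>. The orientation sign is constant near \<open>x\<close> and
  \<open>T (y # ws)\<close> is linear in \<open>y\<close>, which leaves a product rule.\<close>

lemma flux_derivative:
  assumes x: "x \<in> E" and ws: "Suc (length ws) = 2 * n" "set ws \<subseteq> W x" and v: "v \<in> W x"
  shows "frechet_derivative (\<lambda>y. interior_product (horizontal_gradient C S (\<lambda>x. f (r x)))
      (hypersurface_volume C S \<theta>) y ws) (at x within E) v
    = orientation_sign x * (deriv (deriv f) (r x) * r' x v * T (x # ws) + deriv f (r x) * T (v # ws))"
proof (rule frechet_derivative_within_tangent)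
  show "v \<in> tangent_space E x" using v by (simp add: tangent_E[OF x])
  obtain d where d: "d > 0" "\<And>y. y \<in> E \<Longrightarrow> dist y x < d \<Longrightarrow> orientation_sign y = orientation_sign x"
    using orientation_sign_locally_constant[OF x] by blast
  have eq: "interior_product (horizontal_gradient C S (\<lambda>x. f (r x))) (hypersurface_volume C S \<theta>) y ws
      = orientation_sign x * (deriv f (r y) * T (y # ws))" if y: "y \<in> E" "dist y x < d" for y
  proof -
    have "contact_volume C y (N y # deriv f (r y) *\<^sub>R X y # ws)
        = deriv f (r y) * contact_volume C y (N y # X y # ws)"
      using alternating_on_lin[OF volume_alternating[OF y(1)], of "N y # 0 # ws" 1 "X y" "X y" "deriv f (r y)" 0] ws
      by simp
    then show ?thesis
      using volume_scale[OF y(1)] volume_N_X[OF x y(1) ws] d(2)[OF y] ws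
      by (simp add: interior_product_def hypersurface_volume_def sr_normal_eq[OF y(1)]
          horizontal_gradient_radial[OF y(1)])
  qed
  have "linear (\<lambda>y. T (y # ws))"
    using alternating_on_lin[OF T_alternating, of "0 # ws" 0 _ _ 1 1]
      alternating_on_lin[OF T_alternating, of "0 # ws" 0 _ 0 _ 0] ws(1) n_pos
    by (intro linearI) auto
  then have T: "((\<lambda>y. T (y # ws)) has_derivative (\<lambda>v. T (v # ws))) (at x within E)"
    by (simp add: linear_imp_has_derivative)
  have "((\<lambda>y. deriv f (r y)) has_derivative (\<lambda>v. deriv (deriv f) (r x) * r' x v)) (at x within E)"
    using has_derivative_compose[OF r_derivative[OF x], of "deriv f" "\<lambda>u. deriv (deriv f) (r x) * u"] f'[OF x]
    by (simp add: has_field_derivative_def)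
  from has_derivative_mult_right[OF has_derivative_mult[OF this T], of "orientation_sign x"]
  have "((\<lambda>y. orientation_sign x * (deriv f (r y) * T (y # ws))) has_derivative
    (\<lambda>v. orientation_sign x * (deriv (deriv f) (r x) * r' x v * T (x # ws) + deriv f (r x) * T (v # ws))))
    (at x within E)" by (simp add: add.commute)
  then show "((\<lambda>y. interior_product (horizontal_gradient C S (\<lambda>x. f (r x)))
      (hypersurface_volume C S \<theta>) y ws) has_derivative
    (\<lambda>v. orientation_sign x * (deriv (deriv f) (r x) * r' x v * T (x # ws) + deriv f (r x) * T (v # ws))))
    (at x within E)"
    by (rule has_derivative_transform_within[OF _ d(1) x]) (simp add: eq)
qed

text \<open>The terms of \<open>ext_deriv\<close> with f'' add up by
  \<open>alternating_on_expansion\<close> at \<open>w = X x\<close>, as dr(X) = 1. In the terms with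
  f', moving the i-th vector back to its place cancels \<open>(-1) ^ i\<close>, so each of the 2n
  summands gives \<open>T vs\<close>; this is where the factor 2n comes from.\<close>

theorem sub_laplacian_radial:
  assumes x: "x \<in> E"
  shows "sub_laplacian C S \<theta> (\<lambda>x. f (r x)) x
    = deriv (deriv f) (r x) + 2 * real n * q x * deriv f (r x)"
  unfolding sub_laplacian_def half_rank noncharacteristic divergence_def tangent_E[OF x]
proof (rule the_equality)
  let ?s = "orientation_sign x" and ?G = "horizontal_gradient C S (\<lambda>x. f (r x))"
  let ?c = "deriv (deriv f) (r x) + 2 * real n * q x * deriv f (r x)"
  define A where "A vs = contact_volume C x (N x # vs)" for vs
  have A: "alternating_on (2 * n) (W x) A" unfolding A_def by (rule mu_alternating[OF x])
  have TW: "alternating_on (2 * n) (W x) T" using alternating_on_subset[OF T_alternating] by simp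
  have mu: "hypersurface_volume C S \<theta> x vs = ?s * A vs" if "length vs = 2 * n" for vs
    using that by (simp add: hypersurface_volume_def interior_product_def sr_normal_eq[OF x] volume_scale[OF x] A_def)
  have XW: "X x \<in> W x" using X_foliation[OF x] by (simp add: foliation_eq[OF x])
  obtain Zs where Z: "is_frame (2 * n) S x Zs" using frame_exists[OF x] by blast
  have main: "ext_deriv E (interior_product ?G (hypersurface_volume C S \<theta>)) x vs
      = ?c * hypersurface_volume C S \<theta> x vs" if vs: "length vs = 2 * n" "set vs \<subseteq> W x" for vs
  proof -
    let ?w = "\<lambda>i. take i vs @ drop (Suc i) vs"
    have w: "Suc (length (?w i)) = 2 * n" "set (?w i) \<subseteq> W x" "vs ! i \<in> W x" if "i < 2 * n" for i
      using vs that by (auto dest: in_set_takeD in_set_dropD)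
    have "ext_deriv E (interior_product ?G (hypersurface_volume C S \<theta>)) x vs
        = (\<Sum>i<2 * n. (-1) ^ i * (?s * (deriv (deriv f) (r x) * r' x (vs ! i) * T (x # ?w i)
            + deriv f (r x) * T (vs ! i # ?w i))))"
      unfolding ext_deriv_def vs(1) using flux_derivative[OF x w] by (intro sum.cong) auto
    also have "\<dots> = (\<Sum>i<2 * n. ?s * (deriv (deriv f) (r x) * (r' x (vs ! i) * A (vs[i := X x]))
            + deriv f (r x) * T vs))"
    proof (rule sum.cong[OF refl])
      fix i assume "i \<in> {..<2 * n}"
      then have i: "i < 2 * n" by simp
      have "A (vs[i := X x]) = (-1) ^ i * T (x # ?w i)"
        using alternating_on_front[OF A subspace_W[OF x] vs(2) XW vs(1) i] volume_N_X[OF x x w(1,2)[OF i]]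
        by (simp add: A_def)
      moreover have "T vs = (-1) ^ i * T (vs ! i # ?w i)"
        using alternating_on_front[OF TW subspace_W[OF x] vs(2) w(3)[OF i] vs(1) i] by simp
      ultimately show "(-1) ^ i * (?s * (deriv (deriv f) (r x) * r' x (vs ! i) * T (x # ?w i)
            + deriv f (r x) * T (vs ! i # ?w i)))
          = ?s * (deriv (deriv f) (r x) * (r' x (vs ! i) * A (vs[i := X x])) + deriv f (r x) * T vs)"
        by (simp add: algebra_simps)
    qed
    also have "\<dots> = ?s * (deriv (deriv f) (r x) * (\<Sum>i<2 * n. r' x (vs ! i) * A (vs[i := X x]))
        + 2 * real n * (deriv f (r x) * T vs))"
      by (simp add: sum_distrib_left sum.distrib algebra_simps)
    also have "(\<Sum>i<2 * n. r' x (vs ! i) * A (vs[i := X x])) = A vs"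
      using alternating_on_expansion[OF A subspace_W[OF x] frame_D[OF x Z]
          has_derivative_linear[OF r_derivative[OF x]] XW vs] r'_X[OF x] by simp
    also have "T vs = q x * A vs" using T_eq[OF x vs] by (simp add: A_def)
    finally show ?thesis using mu[OF vs(1)] by (simp add: algebra_simps)
  qed
  then show "\<forall>vs. length vs = 2 * n \<and> set vs \<subseteq> W x \<longrightarrow>
      ext_deriv E (interior_product ?G (hypersurface_volume C S \<theta>)) x vs
      = ?c * hypersurface_volume C S \<theta> x vs" by blast
  fix c assume "\<forall>vs. length vs = 2 * n \<and> set vs \<subseteq> W x \<longrightarrow>
      ext_deriv E (interior_product ?G (hypersurface_volume C S \<theta>)) x vs
      = c * hypersurface_volume C S \<theta> x vs"
  \<comment> \<open>Evaluation on a frame, where the volume is nonzero, determines the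
    constant.\<close>
  then have "c * (?s * A Zs) = ?c * (?s * A Zs)"
    using main[of Zs] mu[of Zs] frame_D[OF x Z] by simp
  moreover have "?s * A Zs \<noteq> 0"
    using mu_frame_nonzero[OF x Z] orientation_sign_square[of x] by (auto simp: A_def)
  ultimately show "c = ?c" by simp
qed

end

end

end

section \<open>Symplectic linear algebra\<close>

text \<open>For a contact form affine in the base point the exterior derivative is the
  antisymmetrised linear part. The constant part \<open>c\<close> accommodates -dx_(2n+1) on the
  Heisenberg group.\<close>

lemma contact_form_deriv_affine:
  assumes lin: "\<And>w. linear (\<lambda>y. \<alpha> y w)" and cf: "\<And>y w. contact_form C y w = \<alpha> y w + c w"
  shows "contact_form_deriv C x u v = \<alpha> u v - \<alpha> v u"
proof -
  have "frechet_derivative (\<lambda>y. contact_form C y w) (at x) = (\<lambda>y. \<alpha> y w)" for w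
  proof -
    have "((\<lambda>y. \<alpha> y w + c w) has_derivative (\<lambda>y. \<alpha> y w)) (at x)"
      by (intro has_derivative_add_const linear_imp_has_derivative lin)
    then show ?thesis unfolding cf by (rule frechet_derivative_at[symmetric])
  qed
  then show ?thesis
    by (simp add: contact_form_deriv_def ext_deriv_def numeral_2_eq_2)
qed

text \<open>Meant for a projection \<open>f\<close> that forgets a coordinate which neither
  \<open>\<omega>\<close> nor \<open>\<beta>\<close> sees.\<close>

lemma permutation_form_map:
  assumes "length ws = Suc (2 * n)"
    "\<And>w. \<omega> (f w) = \<omega> w" "\<And>u v. \<beta> (f u) (f v) = \<beta> u v"
  shows "permutation_form n \<omega> \<beta> (map f ws) = permutation_form n \<omega> \<beta> ws"
proof -
  have "\<omega> (map f ws ! \<sigma> 0) * (\<Prod>i<n. \<beta> (map f ws ! \<sigma> (2 * i + 1)) (map f ws ! \<sigma> (2 * i + 2)))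
      = \<omega> (ws ! \<sigma> 0) * (\<Prod>i<n. \<beta> (ws ! \<sigma> (2 * i + 1)) (ws ! \<sigma> (2 * i + 2)))"
    if \<sigma>: "\<sigma> permutes {..2 * n}" for \<sigma>
  proof -
    have "map f ws ! \<sigma> i = f (ws ! \<sigma> i)" if "i \<le> 2 * n" for i
      using permutes_in_image[OF \<sigma>, of i] that assms(1) by (simp add: less_Suc_eq_le)
    then show ?thesis using assms(2,3) by simp
  qed
  then show ?thesis unfolding permutation_form_def by (intro sum.cong) auto
qed

lemma permutation_form_add:
  "permutation_form n (\<lambda>w. \<omega> w + \<omega>' w) \<beta> ws
   = permutation_form n \<omega> \<beta> ws + permutation_form n \<omega>' \<beta> ws"
  by (simp add: permutation_form_def sum.distrib[symmetric] algebra_simps)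

lemma permutation_form_continuous:
  assumes Z: "\<And>i. i < 2 * n \<Longrightarrow> continuous_on E (Z i)" and N: "continuous_on E N"
    and \<omega>: "\<And>f. continuous_on E f \<Longrightarrow> continuous_on E (\<lambda>y. \<omega> y (f y))"
    and \<beta>: "\<And>f g. continuous_on E f \<Longrightarrow> continuous_on E g \<Longrightarrow> continuous_on E (\<lambda>y. \<beta> (f y) (g y))"
  shows "continuous_on E (\<lambda>y. permutation_form n (\<omega> y) \<beta> (N y # map (\<lambda>i. Z i y) [0..<2 * n]))"
proof -
  have V: "continuous_on E (\<lambda>y. (N y # map (\<lambda>i. Z i y) [0..<2 * n]) ! \<sigma> i)"
    if \<sigma>: "\<sigma> permutes {..2 * n}" and i: "i \<le> 2 * n" for \<sigma> i
  proof (cases "\<sigma> i")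
    case (Suc j)
    then have "j < 2 * n" using permutes_in_image[OF \<sigma>, of i] i by simp
    then show ?thesis using Suc Z by simp
  qed (simp add: N)
  show ?thesis
    unfolding permutation_form_def
    by (intro continuous_on_sum continuous_on_mult continuous_on_prod continuous_on_const \<omega> \<beta> V) auto
qed

section \<open>The standard symplectic form and complex structure J on R^(2n)\<close>

definition area :: "(real^'n::finite) \<times> (real^'n) \<Rightarrow> (real^'n) \<times> (real^'n) \<Rightarrow> real" where
  "area z w = fst z \<bullet> snd w - snd z \<bullet> fst w"

definition rot :: "(real^'n::finite) \<times> (real^'n) \<Rightarrow> (real^'n) \<times> (real^'n)" where
  "rot z = (- snd z, fst z)"

lemma area_eq_inner: "area z w = rot z \<bullet> w"
  by (simp add: area_def rot_def inner_prod_def)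

lemma area_antisym: "area z w = - area w z"
  by (simp add: area_def inner_commute)

lemma area_self [simp]: "area z z = 0"
  using area_antisym[of z z] by simp

lemma area_linear: "area z (u + v) = area z u + area z v" "area z (c *\<^sub>R u) = c * area z u"
  "area (u + v) z = area u z + area v z" "area (c *\<^sub>R u) z = c * area u z"
  by (simp_all add: area_def inner_add_left inner_add_right algebra_simps)

lemma area_zero [simp]: "area z 0 = 0" "area 0 z = 0"
  by (simp_all add: area_def)

lemma area_zero_pair [simp]: "area z (0, 0) = 0" "area (0, 0) z = 0"
  by (simp_all add: area_def)

lemma area_minus [simp]: "area z (- w) = - area z w"
  by (simp add: area_def)

lemma area_rot [simp]: "area z (rot z) = z \<bullet> z"
  by (simp add: area_def rot_def inner_prod_def)

lemma inner_rot [simp]: "z \<bullet> rot z = 0" "rot z \<bullet> rot z = z \<bullet> z"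
  by (simp_all add: rot_def inner_prod_def inner_commute)

lemma norm_rot [simp]: "norm (rot z) = norm z"
  by (simp add: norm_eq_sqrt_inner)

lemma continuous_on_area:
  "continuous_on E f \<Longrightarrow> continuous_on E g \<Longrightarrow> continuous_on E (\<lambda>y. area (f y) (g y))"
  unfolding area_def by (intro continuous_intros)

lemma sum_area:
  "(\<Sum>m\<in>UNIV. x $ m * v $ m - y $ m * u $ m) = area (x, y) (u, v)"
  by (simp add: area_def inner_vec_def sum_subtractf)

lemma sum_inner:
  "(\<Sum>m\<in>UNIV. u $ m * u' $ m + v $ m * v' $ m) = (u, v) \<bullet> (u', v')"
  by (simp add: inner_prod_def inner_vec_def sum.distrib)

lemma sum_squares:
  "(\<Sum>m\<in>UNIV. (x $ m)\<^sup>2 + (y $ m)\<^sup>2) = (x, y) \<bullet> (x, y)"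
  by (simp add: inner_prod_def inner_vec_def sum.distrib power2_eq_square)

lemma symplectic_basis_exists:
  "\<exists>b :: nat \<Rightarrow> (real^'n::finite) \<times> (real^'n).
     \<forall>p q. 0 < p \<longrightarrow> p \<le> 2 * CARD('n) \<longrightarrow> 0 < q \<longrightarrow> q \<le> 2 * CARD('n) \<longrightarrow> area (b p) (b q) = pairing p q"
proof -
  obtain e :: "nat \<Rightarrow> 'n" where e: "bij_betw e {0..<CARD('n)} UNIV"
    using ex_bij_betw_nat_finite[OF finite[of "UNIV :: 'n set"]] by blast
  \<comment> \<open>Odd indices give x-directions and even ones y-directions. The divisions number
    the pairs from 0 although \<open>p\<close> starts at 1.\<close>
  define b :: "nat \<Rightarrow> (real^'n) \<times> (real^'n)" where
    "b p = (if odd p then (axis (e ((p - 1) div 2)) 1, 0) else (0, axis (e ((p - 2) div 2)) 1))" for p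
  have inj: "e i = e j \<longleftrightarrow> i = j" if "i < CARD('n)" "j < CARD('n)" for i j
    using bij_betw_imp_inj_on[OF e] that by (auto simp: inj_on_def)
  have "area (b p) (b q) = pairing p q"
    if "0 < p" "p \<le> 2 * CARD('n)" "0 < q" "q \<le> 2 * CARD('n)" for p q
  proof (cases "odd p"; cases "odd q")
    assume h: "odd p" "\<not> odd q"
    have "(p - 1) div 2 = (q - 2) div 2 \<longleftrightarrow> q = p + 1" using h that by presburger
    moreover have "(p - 1) div 2 < CARD('n)" "(q - 2) div 2 < CARD('n)" using h that by presburger+
    ultimately show ?thesis using h inj
      by (auto simp: area_def b_def pairing_def inner_axis_axis)
  next
    assume h: "\<not> odd p" "odd q"
    have "(p - 2) div 2 = (q - 1) div 2 \<longleftrightarrow> p = q + 1" using h that by presburger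
    moreover have "(p - 2) div 2 < CARD('n)" "(q - 1) div 2 < CARD('n)" using h that by presburger+
    ultimately show ?thesis using h inj
      by (auto simp: area_def b_def pairing_def inner_axis_axis)
  qed (auto simp: area_def b_def pairing_def)
  then show ?thesis by blast
qed

section \<open>Projection onto R^(2n)\<close>

definition planar :: "'a \<times> 'b \<times> 'c \<Rightarrow> 'a \<times> 'b" where
  "planar p = (fst p, fst (snd p))"

lemma planar_pair [simp]: "planar (x, y, c) = (x, y)"
  by (simp add: planar_def)

lemma scaleR_pair_collapse [simp]: "(c *\<^sub>R fst z, c *\<^sub>R snd z) = c *\<^sub>R z"
  by (simp add: scaleR_prod_def)

lemma planar_add [simp]: "planar (p + q) = planar p + planar q" and planar_zero [simp]: "planar 0 = 0"
  by (simp_all add: planar_def zero_prod_def)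

lemma planar_diff [simp]: "planar (p - q) = planar p - planar (q :: 'a::group_add \<times> 'b::group_add \<times> 'c::group_add)"
  by (simp add: planar_def)

lemma planar_scale [simp]: "planar (c *\<^sub>R p) = c *\<^sub>R planar p"
  by (simp add: planar_def)

lemma bounded_linear_planar: "bounded_linear (planar :: 'a::euclidean_space \<times> 'b::euclidean_space \<times> 'c::euclidean_space \<Rightarrow> _)"
  by (intro linear_conv_bounded_linear[THEN iffD1] linearI) simp_all

lemmas continuous_on_planar = bounded_linear.continuous_on[OF bounded_linear_planar]
lemmas has_derivative_planar = bounded_linear.has_derivative[OF bounded_linear_planar]

section \<open>The Heisenberg group\<close>

lemma heisenberg_contact_form:
  "contact_form heisenberg p w = (1/2) * area (planar p) (planar w) + - snd (snd w)"
  by (simp add: heisenberg_def planar_def sum_area split_beta)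

lemma heisenberg_metric: "metric heisenberg p u v = planar u \<bullet> planar v"
  by (simp add: heisenberg_def planar_def sum_inner split_beta)

lemma heisenberg_half_rank: "half_rank (heisenberg :: ((real^'n::finite) \<times> _ \<times> _) contact_sr) = CARD('n)"
  by (simp add: heisenberg_def)

lemma heisenberg_radius_eq: "heisenberg_radius p = norm (planar p)"
  by (simp add: heisenberg_radius_def planar_def sum_squares split_beta norm_eq_sqrt_inner)

lemma heisenberg_contact_form_deriv:
  "contact_form_deriv heisenberg p u v = area (planar u) (planar v)"
proof -
  have "contact_form_deriv heisenberg p u v
      = (1/2) * area (planar u) (planar v) - (1/2) * area (planar v) (planar u)"
    by (rule contact_form_deriv_affine[OF _ heisenberg_contact_form]; rule linearI)
      (simp_all add: area_linear algebra_simps)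
  then show ?thesis using area_antisym[of "planar v" "planar u"] by simp
qed

definition heisenberg_noncharacteristic :: "((real^'n::finite) \<times> (real^'n) \<times> real) set" where
  "heisenberg_noncharacteristic = {p. snd (snd p) = 0 \<and> planar p \<noteq> 0}"

text \<open>With z the planar part, the planar direction is the unit vector J z / |z|. The last
  component |z|/2 is forced by \<omega>(N) = 0.\<close>

definition heisenberg_normal :: "(real^'n::finite) \<times> (real^'n) \<times> real \<Rightarrow> (real^'n) \<times> (real^'n) \<times> real" where
  "heisenberg_normal p = (let z = (1 / norm (planar p)) *\<^sub>R rot (planar p) in (fst z, snd z, norm (planar p) / 2))"

definition heisenberg_radial :: "(real^'n::finite) \<times> (real^'n) \<times> real \<Rightarrow> (real^'n) \<times> (real^'n) \<times> real" where
  "heisenberg_radial p = (let z = (1 / norm (planar p)) *\<^sub>R planar p in (fst z, snd z, 0))"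

abbreviation heisenberg_plane :: "((real^'n::finite) \<times> (real^'n) \<times> real) set" where
  "heisenberg_plane \<equiv> {w. snd (snd w) = 0}"

lemma planar_heisenberg_normal [simp]: "planar (heisenberg_normal p) = (1 / norm (planar p)) *\<^sub>R rot (planar p)"
  "snd (snd (heisenberg_normal p)) = norm (planar p) / 2"
  by (simp_all add: heisenberg_normal_def Let_def)

lemma planar_heisenberg_radial [simp]: "planar (heisenberg_radial p) = (1 / norm (planar p)) *\<^sub>R planar p"
  "snd (snd (heisenberg_radial p)) = 0"
  by (simp_all add: heisenberg_radial_def Let_def)

lemma prod3_eqI: "planar p = planar q \<Longrightarrow> snd (snd p) = snd (snd q) \<Longrightarrow> p = q"
  by (simp add: planar_def prod_eq_iff)

lemma heisenberg_volume:
  "contact_volume (heisenberg :: ((real^'n::finite) \<times> _ \<times> _) contact_sr) p ws = (1 / 2 ^ CARD('n)) *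
    permutation_form CARD('n) (contact_form heisenberg p) (\<lambda>u v. area (planar u) (planar v)) ws"
  unfolding contact_volume_eq_permutation_form heisenberg_half_rank heisenberg_contact_form_deriv ..

lemma heisenberg_contact_form_linear: "linear (contact_form heisenberg p)"
  by (rule linearI) (simp_all add: heisenberg_contact_form area_linear algebra_simps)

lemma heisenberg_permutation_form_alternating:
  fixes \<omega> :: "(real^'n::finite) \<times> (real^'n) \<times> real \<Rightarrow> real"
  assumes "linear \<omega>"
  shows "alternating_on (Suc (2 * n)) UNIV (permutation_form n \<omega> (\<lambda>u v. area (planar u) (planar v)))"
  by (rule permutation_form_alternating[OF assms]; rule linearI) (simp_all add: area_linear)

lemma heisenberg_volume_alternating:
  fixes p :: "(real^'n::finite) \<times> (real^'n) \<times> real"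
  shows "alternating_on (Suc (2 * CARD('n))) UNIV (contact_volume heisenberg p)"
  using alternating_on_cmult[OF heisenberg_permutation_form_alternating[OF heisenberg_contact_form_linear],
      of "CARD('n)" "1 / 2 ^ CARD('n)" p]
  unfolding heisenberg_volume .

lemma subspace_heisenberg_plane: "subspace heisenberg_plane"
  by (auto simp: subspace_def)

lemma dim_heisenberg_plane:
  "dim (heisenberg_plane :: ((real^'n::finite) \<times> (real^'n) \<times> real) set) = 2 * CARD('n)"
proof -
  have "heisenberg_plane = {w :: (real^'n) \<times> (real^'n) \<times> real. (0, 0, 1) \<bullet> w = 0}"
    by (auto simp: inner_prod_def)
  then show ?thesis using dim_hyperplane[of "(0, 0, 1) :: (real^'n) \<times> (real^'n) \<times> real"]
    by (simp add: zero_prod_def)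
qed

text \<open>The part of \<omega> that depends on the base point sees planar components only, and so
  does d\<omega>. Its contribution is therefore a form of degree 2n+1 on a space of dimension
  2n.\<close>

lemma heisenberg_volume_const:
  fixes p :: "(real^'n::finite) \<times> (real^'n) \<times> real"
  assumes ws: "length ws = Suc (2 * CARD('n))"
  shows "contact_volume heisenberg p ws = contact_volume heisenberg 0 ws"
proof -
  let ?n = "CARD('n)" and ?\<beta> = "\<lambda>u v :: (real^'n) \<times> (real^'n) \<times> real. area (planar u) (planar v)"
  let ?\<omega> = "\<lambda>w :: (real^'n) \<times> (real^'n) \<times> real. (1/2) * area (planar p) (planar w)"
  let ?\<pi> = "\<lambda>w :: (real^'n) \<times> (real^'n) \<times> real. (fst (planar w), snd (planar w), 0 :: real)"
  have "linear ?\<omega>" by (rule linearI) (simp_all add: area_linear algebra_simps)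
  then have "permutation_form ?n ?\<omega> ?\<beta> (map ?\<pi> ws) = 0"
    using ws dim_heisenberg_plane[where 'n = 'n]
    by (intro alternating_on_exceeds_dim[OF alternating_on_subset[OF heisenberg_permutation_form_alternating]
          subspace_heisenberg_plane]) auto
  moreover have "permutation_form ?n ?\<omega> ?\<beta> (map ?\<pi> ws) = permutation_form ?n ?\<omega> ?\<beta> ws"
    using ws by (intro permutation_form_map) auto
  ultimately have "permutation_form ?n ?\<omega> ?\<beta> ws = 0" by simp
  then show ?thesis
    unfolding heisenberg_volume heisenberg_contact_form[abs_def] permutation_form_add
    by (simp add: permutation_form_def)
qed

text \<open>The planar part of the normal lies with \<open>vs\<close> in a plane of dimension 2n and
  contributes nothing, so the last component |z|/2 is the whole effect.\<close>

lemma heisenberg_volume_normal: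
  fixes p :: "(real^'n::finite) \<times> (real^'n) \<times> real"
  assumes vs: "length vs = 2 * CARD('n)" "set vs \<subseteq> heisenberg_plane"
  shows "contact_volume heisenberg p (heisenberg_normal p # vs)
    = (norm (planar p) / 2) * contact_volume heisenberg 0 ((0, 0, 1) # vs)"
proof -
  define h where "h = (fst (planar (heisenberg_normal p)), snd (planar (heisenberg_normal p)), 0 :: real)"
  have N: "heisenberg_normal p = 1 *\<^sub>R h + (norm (planar p) / 2) *\<^sub>R (0, 0, 1)"
    by (rule prod3_eqI) (simp_all add: h_def zero_prod_def[symmetric])
  have "contact_volume heisenberg 0 (h # vs) = 0"
    using vs dim_heisenberg_plane[where 'n = 'n]
    by (intro alternating_on_exceeds_dim[OF alternating_on_subset[OF heisenberg_volume_alternating]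
          subspace_heisenberg_plane]) (auto simp: h_def)
  moreover have "contact_volume heisenberg 0 (heisenberg_normal p # vs)
      = 1 * contact_volume heisenberg 0 (h # vs) + (norm (planar p) / 2) * contact_volume heisenberg 0 ((0, 0, 1) # vs)"
    unfolding N
    using alternating_on_lin[OF heisenberg_volume_alternating, of "0 # vs" 0 h "(0, 0, 1)" 0 1 "norm (planar p) / 2"] vs
    by simp
  ultimately show ?thesis using heisenberg_volume_const[of "heisenberg_normal p # vs" p] vs by simp
qed

lemma heisenberg_volume_nonzero:
  "\<exists>Zs. length Zs = 2 * CARD('n) \<and> set Zs \<subseteq> heisenberg_plane \<and>
     contact_volume heisenberg 0 ((0, 0, 1) # Zs :: ((real^'n::finite) \<times> (real^'n) \<times> real) list) \<noteq> 0"
proof -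
  obtain b :: "nat \<Rightarrow> (real^'n) \<times> (real^'n)" where
    b: "\<And>p q. 0 < p \<Longrightarrow> p \<le> 2 * CARD('n) \<Longrightarrow> 0 < q \<Longrightarrow> q \<le> 2 * CARD('n) \<Longrightarrow> area (b p) (b q) = pairing p q"
    using symplectic_basis_exists by blast
  define Zs where "Zs = map (\<lambda>p. (fst (b (Suc p)), snd (b (Suc p)), 0 :: real)) [0..<2 * CARD('n)]"
  define vs where "vs = (0, 0, 1) # Zs"
  have vs0: "vs ! 0 = (0, 0, 1)" by (simp add: vs_def)
  have nth: "vs ! p = (fst (b p), snd (b p), 0)" if "0 < p" "p \<le> 2 * CARD('n)" for p
    using that by (cases p) (auto simp: vs_def Zs_def)
  have "permutation_form CARD('n) (contact_form heisenberg 0) (\<lambda>u v. area (planar u) (planar v)) vs \<noteq> 0"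
    by (rule permutation_form_symplectic_basis[where b = 1])
      (auto simp: heisenberg_contact_form vs0 nth b)
  then have "contact_volume heisenberg 0 ((0, 0, 1) # Zs) \<noteq> 0" by (simp add: heisenberg_volume vs_def)
  moreover have "length Zs = 2 * CARD('n)" "set Zs \<subseteq> heisenberg_plane" by (auto simp: Zs_def)
  ultimately show ?thesis by blast
qed

lemma heisenberg_points:
  fixes p :: "(real^'n::finite) \<times> (real^'n) \<times> real"
  shows "tangent_space (points heisenberg) p = UNIV"
proof -
  have "v \<in> tangent_space (points heisenberg) p" for v
    unfolding tangent_space_def heisenberg_def
    by (auto intro!: exI[of _ "\<lambda>t. p + t *\<^sub>R v"] derivative_eq_intros)
  then show ?thesis by blast
qed

lemma heisenberg_distribution: "distribution heisenberg p = {w. contact_form heisenberg p w = 0}"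
  unfolding distribution_def heisenberg_points by simp

lemma heisenberg_surface_eq: "heisenberg_surface = heisenberg_plane"
  by (auto simp: heisenberg_surface_def)

text \<open>The open set \<open>G\<close> lets one statement serve for the surface, with
  \<open>G = UNIV\<close>, and for its noncharacteristic part.\<close>

lemma heisenberg_tangent_space:
  fixes p :: "(real^'n::finite) \<times> (real^'n) \<times> real"
  assumes G: "open G" and p: "p \<in> heisenberg_plane \<inter> G"
  shows "tangent_space (heisenberg_plane \<inter> G) p = heisenberg_plane"
proof
  show "tangent_space (heisenberg_plane \<inter> G) p \<subseteq> heisenberg_plane"
  proof
    fix v assume v: "v \<in> tangent_space (heisenberg_plane \<inter> G) p"
    have "((\<lambda>q. snd (snd q)) has_derivative (\<lambda>w. snd (snd w))) (at p)"
      by (auto intro!: derivative_eq_intros)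
    from tangent_space_level_set[OF this _ v, of 0] show "v \<in> heisenberg_plane" by simp
  qed
  show "heisenberg_plane \<subseteq> tangent_space (heisenberg_plane \<inter> G) p"
  proof
    fix v :: "(real^'n) \<times> (real^'n) \<times> real" assume v: "v \<in> heisenberg_plane"
    let ?\<gamma> = "\<lambda>t :: real. p + t *\<^sub>R v"
    have "?\<gamma> \<midarrow>0\<rightarrow> p" by (auto intro!: tendsto_eq_intros)
    then have "\<forall>\<^sub>F t in nhds 0. ?\<gamma> t \<in> G"
      using topological_tendstoD[of ?\<gamma> p "at 0" G] G p by (auto simp: eventually_at_filter elim: eventually_mono)
    then have "\<forall>\<^sub>F t in nhds 0. ?\<gamma> t \<in> heisenberg_plane \<inter> G"
      by eventually_elim (use p v in auto)
    moreover have "(?\<gamma> has_vector_derivative v) (at 0)" by (auto intro!: derivative_eq_intros)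
    ultimately show "v \<in> tangent_space (heisenberg_plane \<inter> G) p"
      unfolding tangent_space_def by (auto intro!: exI[of _ ?\<gamma>])
  qed
qed

lemma open_planar_nonzero: "open {p :: 'a::euclidean_space \<times> 'b::euclidean_space \<times> 'c::euclidean_space. planar p \<noteq> 0}"
  using open_Collect_neq[OF continuous_on_planar[OF continuous_on_id] continuous_on_const, of 0] by simp

lemma heisenberg_noncharacteristic_eq:
  "noncharacteristic heisenberg heisenberg_surface =
    (heisenberg_noncharacteristic :: ((real^'n::finite) \<times> (real^'n) \<times> real) set)"
proof -
  have D: "heisenberg_plane = distribution heisenberg p \<longleftrightarrow> planar p = 0"
    for p :: "(real^'n) \<times> (real^'n) \<times> real"
  proof
    assume *: "heisenberg_plane = distribution heisenberg p"
    \<comment> \<open>This includes points with \<open>planar p = 0\<close>, where division by zero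
      makes the normal the zero vector.\<close>
    have "heisenberg_normal p \<in> distribution heisenberg p"
      by (auto simp: heisenberg_distribution heisenberg_contact_form area_linear dot_square_norm power2_eq_square)
    then have "snd (snd (heisenberg_normal p)) = 0" unfolding *[symmetric] by simp
    then show "planar p = 0" by simp
  next
    assume "planar p = 0"
    then show "heisenberg_plane = distribution heisenberg p"
      by (auto simp: heisenberg_distribution heisenberg_contact_form)
  qed
  have "p \<in> noncharacteristic heisenberg heisenberg_plane \<longleftrightarrow> p \<in> heisenberg_noncharacteristic"
    for p :: "(real^'n) \<times> (real^'n) \<times> real"
  proof (cases "p \<in> heisenberg_plane")
    case True
    then have "tangent_space heisenberg_plane p = heisenberg_plane"
      using heisenberg_tangent_space[OF open_UNIV, of p] by simp
    then show ?thesis using True D[of p]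
      unfolding noncharacteristic_def characteristic_points_def heisenberg_noncharacteristic_def by blast
  next
    case False
    then show ?thesis
      unfolding noncharacteristic_def heisenberg_noncharacteristic_def by blast
  qed
  then show ?thesis unfolding heisenberg_surface_eq by blast
qed

lemma heisenberg_radial_hypersurface:
  "radial_hypersurface (heisenberg :: ((real^'n::finite) \<times> (real^'n) \<times> real) contact_sr)
     heisenberg_surface heisenberg_noncharacteristic CARD('n) (\<lambda>_. heisenberg_plane)
     heisenberg_normal heisenberg_radial heisenberg_radius (\<lambda>p w. (planar p \<bullet> planar w) / norm (planar p))
     (\<lambda>us. (1/2) * contact_volume heisenberg 0 ((0, 0, 1) # us)) (\<lambda>p. 1 / norm (planar p))"
proof -
  have E: "heisenberg_noncharacteristic = heisenberg_plane \<inter> {p :: (real^'n) \<times> (real^'n) \<times> real. planar p \<noteq> 0}"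
    by (auto simp: heisenberg_noncharacteristic_def)
  have z: "norm (planar p) \<noteq> 0" if "p \<in> heisenberg_noncharacteristic" for p :: "(real^'n) \<times> (real^'n) \<times> real"
    using that by (simp add: heisenberg_noncharacteristic_def)
  have S: "p \<in> heisenberg_surface" if "p \<in> heisenberg_noncharacteristic" for p :: "(real^'n) \<times> (real^'n) \<times> real"
    using that by (simp add: heisenberg_surface_eq E)
  have TS: "tangent_space heisenberg_surface p = heisenberg_plane"
    if "p \<in> heisenberg_surface" for p :: "(real^'n) \<times> (real^'n) \<times> real"
    using heisenberg_tangent_space[OF open_UNIV, of p] that by (simp add: heisenberg_surface_eq)
  have F: "foliation heisenberg heisenberg_surface p = {w. area (planar p) (planar w) = 0 \<and> snd (snd w) = 0}"
    if "p \<in> heisenberg_noncharacteristic" for p :: "(real^'n) \<times> (real^'n) \<times> real"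
    by (auto simp: foliation_def TS[OF S[OF that]] heisenberg_distribution heisenberg_contact_form)
  show ?thesis
  \<comment> \<open>Goals follow the order of the locale assumptions; from 20 on they are
    \<open>r_derivative\<close>, \<open>r'_metric\<close>, \<open>r'_X\<close>,
    \<open>T_alternating\<close>, \<open>volume_N_X\<close>, \<open>T_eq\<close>,
    \<open>sections\<close>, \<open>volume_continuous\<close>.\<close>
  proof (rule radial_hypersurface.intro, goal_cases)
    case 1 show ?case by (rule heisenberg_half_rank)
  next
    case 2 show ?case by simp
  next
    case 3 show ?case by (rule heisenberg_noncharacteristic_eq)
  next
    case 4 show ?case unfolding E heisenberg_surface_eq
      by (intro openin_open_Int open_planar_nonzero)
  next
    case 5 then show ?case by (intro TS S)
  next
    case (6 p) then show ?case using heisenberg_tangent_space[OF open_planar_nonzero, of p] by (simp add: E)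
  next
    case 7 show ?case by (rule subspace_heisenberg_plane)
  next
    case 8 show ?case by (simp add: dim_heisenberg_plane)
  next
    case 9 show ?case by (rule heisenberg_volume_alternating)
  next
    case (10 p) then show ?case using heisenberg_volume_nonzero[where 'n = 'n] z[of p]
      by (force simp: heisenberg_volume_normal)
  next
    case 11 show ?case
      using linear_subspace_kernel[OF heisenberg_contact_form_linear] by (simp add: heisenberg_distribution)
  next
    case 12 show ?case by (simp add: heisenberg_metric inner_commute)
  next
    case 13 show ?case by (rule linearI) (simp_all add: heisenberg_metric inner_add_right)
  next
    case (14 p Y) then show ?case by (intro prod3_eqI) (auto simp: heisenberg_metric F)
  next
    case (15 p) then show ?case using z[of p]
      by (simp add: heisenberg_distribution heisenberg_contact_form area_linear dot_square_norm power2_eq_square)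
  next
    case (16 p) then show ?case using z[of p]
      by (simp add: heisenberg_metric dot_square_norm power2_eq_square)
  next
    case (17 p Y) then show ?case by (auto simp: heisenberg_metric F area_eq_inner)
  next
    case (18 p v)
    \<comment> \<open>The normal has last component |z|/2, so this multiple of it cancels the last
      component of \<open>v\<close> and leaves a vector tangent to the surface.\<close>
    have "v - (snd (snd v) * 2 / norm (planar p)) *\<^sub>R heisenberg_normal p \<in> foliation heisenberg heisenberg_surface p"
    proof -
      have "heisenberg_normal p \<in> distribution heisenberg p" using z[OF 18(1)]
        by (simp add: heisenberg_distribution heisenberg_contact_form area_linear dot_square_norm power2_eq_square)
      then have "v - (snd (snd v) * 2 / norm (planar p)) *\<^sub>R heisenberg_normal p \<in> distribution heisenberg p"
        using 18(2) heisenberg_contact_form_linear[of p]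
        by (simp add: heisenberg_distribution linear_diff linear_scale)
      then show ?thesis using z[OF 18(1)] by (simp add: foliation_def TS[OF S[OF 18(1)]])
    qed
    then show ?case by blast
  next
    case (19 p) then show ?case by (simp add: F area_linear)
  next
    case (20 p)
    have "((\<lambda>q. norm (planar q)) has_derivative (\<lambda>w. planar p \<bullet> planar w / norm (planar p))) (at p within heisenberg_noncharacteristic)"
      using has_derivative_compose[OF has_derivative_planar[OF has_derivative_ident] has_derivative_norm[of "planar p"]] z[OF 20]
      by (simp add: sgn_div_norm inner_commute divide_inverse mult.commute)
    then show ?case by (simp add: heisenberg_radius_eq[abs_def])
  next
    case (21 p Y) show ?case by (simp add: heisenberg_metric)
  next
    case (22 p) then show ?case using z[of p] by (simp add: dot_square_norm power2_eq_square)
  next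
    case 23 show ?case
      by (intro alternating_on_cmult alternating_on_Cons heisenberg_volume_alternating UNIV_I)
  next
    case (24 p y ws)
    \<comment> \<open>The factor 1/|z| found here meets the |z|/2 of the normal, which is the origin
      of the 1/2 in the constant form.\<close>
    have y: "heisenberg_radial y = (1 / norm (planar y)) *\<^sub>R y"
      using 24(2) by (intro prod3_eqI) (auto simp: E)
    have "contact_volume heisenberg y (heisenberg_normal y # heisenberg_radial y # ws)
        = (norm (planar y) / 2) * contact_volume heisenberg 0 ((0, 0, 1) # heisenberg_radial y # ws)"
      using 24 by (intro heisenberg_volume_normal) auto
    also have "contact_volume heisenberg 0 ((0, 0, 1) # heisenberg_radial y # ws)
        = (1 / norm (planar y)) * contact_volume heisenberg 0 ((0, 0, 1) # y # ws)"
      unfolding y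
      using alternating_on_lin[OF heisenberg_volume_alternating, of "(0, 0, 1) # 0 # ws" 1 y y 0 "1 / norm (planar y)" 0] 24(3)
      by simp
    finally show ?case using z[OF 24(2)] by simp
  next
    case (25 p vs) then show ?case using z[of p] by (simp add: heisenberg_volume_normal)
  next
    case (26 p v) then show ?case by (intro exI[of _ "\<lambda>_. v"]) auto
  next
    case (27 Z)
    have "continuous_on heisenberg_noncharacteristic (heisenberg_normal :: (real^'n) \<times> (real^'n) \<times> real \<Rightarrow> _)"
      unfolding heisenberg_normal_def rot_def Let_def
      by (intro continuous_intros continuous_on_planar) (auto dest: z)
    then show ?case
      unfolding heisenberg_volume heisenberg_contact_form using 27
      by (intro continuous_on_mult continuous_on_const
        permutation_form_continuous[where \<omega> = "contact_form heisenberg", unfolded heisenberg_contact_form[abs_def]]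
          continuous_intros continuous_on_area continuous_on_planar) auto
  qed
qed

section \<open>The radial process on the Heisenberg group\<close>

lemma heisenberg_bessel:
  fixes X :: "real \<Rightarrow> 'w \<Rightarrow> (real^'n::finite) \<times> (real^'n) \<times> real"
  assumes \<theta>: "orientation_form (2 * CARD('n)) heisenberg_surface \<theta>"
    and X: "sub_laplacian_diffusion heisenberg heisenberg_surface \<theta> P F \<zeta> X"
  shows "bessel_process (2 * CARD('n) + 1) P F \<zeta> (\<lambda>t w. heisenberg_radius (X t w))"
  unfolding bessel_process_def
proof (rule diffusion_image[where X = X and r = heisenberg_radius and E = heisenberg_noncharacteristic
      and L = "\<lambda>f x. (1/2) * sub_laplacian heisenberg heisenberg_surface \<theta> f x"])
  interpret radial_hypersurface "heisenberg :: ((real^'n) \<times> (real^'n) \<times> real) contact_sr"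
    heisenberg_surface heisenberg_noncharacteristic "CARD('n)" "\<lambda>_. heisenberg_plane"
    heisenberg_normal heisenberg_radial heisenberg_radius "\<lambda>p w. (planar p \<bullet> planar w) / norm (planar p)"
    "\<lambda>us. (1/2) * contact_volume heisenberg 0 ((0, 0, 1) # us)" "\<lambda>p. 1 / norm (planar p)"
    by (rule heisenberg_radial_hypersurface)
  let ?E = "heisenberg_noncharacteristic :: ((real^'n) \<times> (real^'n) \<times> real) set"
  show "diffusion P F ?E (\<lambda>f x. (1/2) * sub_laplacian heisenberg heisenberg_surface \<theta> f x) \<zeta> X"
    using X unfolding sub_laplacian_diffusion_def noncharacteristic .
  have E: "?E = heisenberg_plane \<inter> {p. planar p \<noteq> 0}" by (auto simp: heisenberg_noncharacteristic_def)
  have closed: "closed (heisenberg_plane :: ((real^'n) \<times> (real^'n) \<times> real) set)"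
    by (intro closed_Collect_eq continuous_intros)
  show "?E \<in> sets borel"
    unfolding E using closed open_planar_nonzero by (intro sets.Int borel_closed borel_open)
  show "continuous_on ?E heisenberg_radius"
    unfolding heisenberg_radius_eq[abs_def] by (intro continuous_on_norm continuous_on_planar continuous_on_id)
  show pos: "heisenberg_radius x \<in> {0<..}" if "x \<in> ?E" for x
    using that by (simp add: heisenberg_radius_eq heisenberg_noncharacteristic_def)
  show "compact {x \<in> ?E. heisenberg_radius x \<in> K}" if K: "compact K" "K \<subseteq> {0<..}" for K
  proof -
    \<comment> \<open>\<open>K\<close> avoids 0, so the condition \<open>planar p \<noteq> 0\<close>
      is automatic and the set is closed in the whole space.\<close>
    have eq: "{x \<in> ?E. heisenberg_radius x \<in> K} = heisenberg_plane \<inter> {p. norm (planar p) \<in> K}"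
      using K(2) by (auto simp: E heisenberg_radius_eq)
    obtain B where B: "\<And>a. a \<in> K \<Longrightarrow> norm a \<le> B" using compact_imp_bounded[OF K(1)] by (auto simp: bounded_iff)
    have "norm p \<le> B" if "p \<in> heisenberg_plane \<inter> {p. norm (planar p) \<in> K}" for p :: "(real^'n) \<times> (real^'n) \<times> real"
    proof -
      have "norm p = norm (planar p)" using that by (auto simp: norm_prod_def planar_def)
      then show ?thesis using B[of "norm (planar p)"] that by auto
    qed
    then have "bounded (heisenberg_plane \<inter> {p :: (real^'n) \<times> (real^'n) \<times> real. norm (planar p) \<in> K})"
      unfolding bounded_iff by blast
    moreover have "closed {p :: (real^'n) \<times> (real^'n) \<times> real. norm (planar p) \<in> K}"
      using closed_vimage[OF compact_imp_closed[OF K(1)] continuous_on_norm[OF continuous_on_planar[OF continuous_on_id]]]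
      by (simp add: vimage_def)
    ultimately show ?thesis unfolding eq compact_eq_bounded_closed using closed by (auto intro: closed_Int)
  qed
  fix f :: "real \<Rightarrow> real" assume f: "smooth_along {0<..} f"
  show "smooth_along ?E (\<lambda>x. f (heisenberg_radius x))"
  proof (rule smooth_along_compose[OF f pos])
    fix x :: "(real^'n) \<times> (real^'n) \<times> real" assume x: "x \<in> ?E"
    let ?U = "{p :: (real^'n) \<times> (real^'n) \<times> real. planar p \<noteq> 0}"
    \<comment> \<open>The radius is the square root of a sum of squares of linear functions, which
      is positive on \<open>?U\<close>.\<close>
    have "Ck_on k ?U (\<lambda>p. (\<Sum>b\<in>Basis. (planar p \<bullet> b) ^ 2))" for k
      by (intro Ck_on_sum Ck_on_power Ck_on_bounded_linear open_planar_nonzero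
          bounded_linear_compose[OF bounded_linear_inner_left bounded_linear_planar])
    moreover have "(\<Sum>b\<in>Basis. (planar p \<bullet> b) ^ 2) = (norm (planar p))\<^sup>2" for p :: "(real^'n) \<times> (real^'n) \<times> real"
      unfolding power2_norm_eq_inner euclidean_inner[of "planar p" "planar p"] by (simp add: power2_eq_square)
    ultimately have "Ck_on k ?U (\<lambda>p. (norm (planar p))\<^sup>2)" for k by simp
    then have "Ck_on k ?U (\<lambda>p. sqrt ((norm (planar p))\<^sup>2))" for k
      by (rule_tac Ck_on_compose[of _ "{0<..}"]) (auto simp: open_planar_nonzero Ck_on_sqrt)
    then have "Ck_on k ?U (\<lambda>p. norm (planar p))" for k by simp
    then show "\<exists>U g. open U \<and> x \<in> U \<and> (\<forall>k. Ck_on k U g) \<and> (\<forall>y\<in>U \<inter> ?E. g y = heisenberg_radius y)"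
      using x by (intro exI[of _ ?U] exI[of _ "\<lambda>p. norm (planar p)"])
        (auto simp: open_planar_nonzero E heisenberg_radius_eq)
  qed
  show "(1/2) * sub_laplacian heisenberg heisenberg_surface \<theta> (\<lambda>x. f (heisenberg_radius x)) x
      = (1/2) * deriv (deriv f) (heisenberg_radius x) +
        (real (2 * CARD('n) + 1) - 1) / (2 * heisenberg_radius x) * deriv f (heisenberg_radius x)"
    if x: "x \<in> ?E" for x
    using sub_laplacian_radial[OF \<theta> smooth_along_real_derivs[OF f open_greaterThan pos] x]
    by (simp add: heisenberg_radius_eq)
qed

section \<open>Spheres and anti-de Sitter spaces\<close>

definition coord_a :: "'a \<times> 'b \<times> real \<times> real \<Rightarrow> real" where "coord_a p = fst (snd (snd p))"
definition coord_b :: "'a \<times> 'b \<times> real \<times> real \<Rightarrow> real" where "coord_b p = snd (snd (snd p))"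

lemma coord_a_simps [simp]: "coord_a (x, y, a, b) = a" "coord_a (p + p') = coord_a p + coord_a (p' :: 'a::real_vector \<times> 'b::real_vector \<times> _)"
  "coord_a (q - q') = coord_a q - coord_a (q' :: 'a::real_vector \<times> 'b::real_vector \<times> _)" "coord_a (c *\<^sub>R q) = c * coord_a q"
  by (simp_all add: coord_a_def)

lemma coord_b_simps [simp]: "coord_b (x, y, a, b) = b" "coord_b (p + p') = coord_b p + coord_b (p' :: 'a::real_vector \<times> 'b::real_vector \<times> _)"
  "coord_b (q - q') = coord_b q - coord_b (q' :: 'a::real_vector \<times> 'b::real_vector \<times> _)" "coord_b (c *\<^sub>R q) = c * coord_b q"
  by (simp_all add: coord_b_def)

lemma prod4_eqI: "planar p = planar q \<Longrightarrow> coord_a p = coord_a q \<Longrightarrow> coord_b p = coord_b q \<Longrightarrow> p = q"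
  by (simp add: planar_def coord_a_def coord_b_def prod_eq_iff)

lemma bounded_linear_coord_a: "bounded_linear (coord_a :: 'a::euclidean_space \<times> 'b::euclidean_space \<times> _ \<Rightarrow> _)"
  by (intro linear_conv_bounded_linear[THEN iffD1] linearI) simp_all

lemma bounded_linear_coord_b: "bounded_linear (coord_b :: 'a::euclidean_space \<times> 'b::euclidean_space \<times> _ \<Rightarrow> _)"
  by (intro linear_conv_bounded_linear[THEN iffD1] linearI) simp_all

lemmas continuous_on_coord_a = bounded_linear.continuous_on[OF bounded_linear_coord_a]
lemmas continuous_on_coord_b = bounded_linear.continuous_on[OF bounded_linear_coord_b]
lemmas has_derivative_coord_a = bounded_linear.has_derivative[OF bounded_linear_coord_a]
lemmas has_derivative_coord_b = bounded_linear.has_derivative[OF bounded_linear_coord_b]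

text \<open>The sign \<open>\<kappa>\<close> unites the models: the level set
  \<open>quad \<kappa> p p = \<kappa>\<close> is the sphere for 1 and the anti-de Sitter space for
  -1.\<close>

definition quad ::
    "real \<Rightarrow> (real^'n::finite) \<times> (real^'n) \<times> real \<times> real \<Rightarrow> (real^'n) \<times> (real^'n) \<times> real \<times> real \<Rightarrow> real" where
  "quad \<kappa> u v = planar u \<bullet> planar v + \<kappa> * (coord_a u * coord_a v + coord_b u * coord_b v)"

lemma quad_linear:
  "quad \<kappa> p (u + v) = quad \<kappa> p u + quad \<kappa> p v" "quad \<kappa> p (c *\<^sub>R u) = c * quad \<kappa> p u"
  "quad \<kappa> p (u - v) = quad \<kappa> p u - quad \<kappa> p v"
  by (simp_all add: quad_def inner_add_right inner_diff_right algebra_simps)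

lemma quad_commute: "quad \<kappa> u v = quad \<kappa> v u"
  by (simp add: quad_def inner_commute algebra_simps)

lemma quad_linear_left:
  "quad \<kappa> (u + v) p = quad \<kappa> u p + quad \<kappa> v p" "quad \<kappa> (c *\<^sub>R u) p = c * quad \<kappa> u p"
  by (simp_all add: quad_def inner_add_left algebra_simps)

lemma continuous_on_quad:
  "continuous_on E f \<Longrightarrow> continuous_on E g \<Longrightarrow> continuous_on E (\<lambda>y. quad \<kappa> (f y) (g y))"
  unfolding quad_def by (intro continuous_intros continuous_on_planar continuous_on_coord_a continuous_on_coord_b)

lemma has_derivative_quad: "((\<lambda>q. quad \<kappa> q q) has_derivative (\<lambda>w. 2 * quad \<kappa> p w)) (at p)"
  unfolding quad_def
  by (rule derivative_eq_intros has_derivative_planar has_derivative_coord_a has_derivative_coord_b refl)+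
    (simp add: inner_commute algebra_simps)

definition quadric :: "real \<Rightarrow> real \<Rightarrow> ((real^'n::finite) \<times> (real^'n) \<times> real \<times> real) contact_sr" where
  "quadric \<kappa> k = \<lparr> half_rank = CARD('n), points = {p. quad \<kappa> p p = \<kappa>},
     contact_form = (\<lambda>p w. (1 / (2 * k\<^sup>2)) * (area (planar p) (planar w) + (coord_a p * coord_b w - coord_b p * coord_a w))),
     metric = (\<lambda>_ u v. (1 / k\<^sup>2) * quad \<kappa> u v) \<rparr>"

lemma sphere_model_eq: "sphere_model k = quadric 1 k"
  by (simp add: sphere_model_def quadric_def quad_def fun_eq_iff sum_area sum_inner sum_squares coord_a_def coord_b_def
      power2_eq_square add.assoc planar_def split_beta) auto

lemma anti_de_sitter_eq: "anti_de_sitter k = quadric (-1) k"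
  by (simp add: anti_de_sitter_def quadric_def quad_def fun_eq_iff sum_area sum_inner sum_squares coord_a_def coord_b_def
      power2_eq_square diff_diff_eq planar_def split_beta) (auto simp: algebra_simps)

text \<open>\<open>A\<close> selects the sheet: it is all of the reals for the sphere, and the
  positive reals for the anti-de Sitter space.\<close>

definition quadric_surface :: "real \<Rightarrow> real set \<Rightarrow> ((real^'n::finite) \<times> (real^'n) \<times> real \<times> real) set" where
  "quadric_surface \<kappa> A = {p. quad \<kappa> p p = \<kappa>} \<inter> {p. coord_b p = 0} \<inter> {p. coord_a p \<in> A}"

lemma sphere_surface_eq: "sphere_surface k = quadric_surface 1 UNIV"
  unfolding sphere_surface_def sphere_model_eq
  by (auto simp: quadric_def quadric_surface_def)

lemma anti_de_sitter_surface_eq: "anti_de_sitter_surface k = quadric_surface (-1) {0<..}"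
  unfolding anti_de_sitter_surface_def anti_de_sitter_eq
  by (auto simp: quadric_def quadric_surface_def)

definition quadric_noncharacteristic :: "real \<Rightarrow> real set \<Rightarrow> ((real^'n::finite) \<times> (real^'n) \<times> real \<times> real) set" where
  "quadric_noncharacteristic \<kappa> A = quadric_surface \<kappa> A \<inter> {p. planar p \<noteq> 0}"

text \<open>With z the planar part and a the coordinate \<open>coord_a p\<close>: a combination of J
  z and the last basis vector, both \<open>quad\<close>-orthogonal to p on the hypersurface. The
  ratio of the coefficients comes from \<omega>(N) = 0 and the factor k from a^2 + \<kappa> |z|^2 =
  1.\<close>

definition quadric_normal ::
    "real \<Rightarrow> (real^'n::finite) \<times> (real^'n) \<times> real \<times> real \<Rightarrow> (real^'n) \<times> (real^'n) \<times> real \<times> real" where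
  "quadric_normal k p = (let z = (- (k * coord_a p / norm (planar p))) *\<^sub>R rot (planar p) in (fst z, snd z, 0, k * norm (planar p)))"

text \<open>The unit vector opposite to the tangential projection of the basis vector of the
  coordinate a. Its own a-component is -\<kappa> k |z|, so r increases along it for both
  signs.\<close>

definition quadric_radial ::
    "real \<Rightarrow> (real^'n::finite) \<times> (real^'n) \<times> real \<times> real \<Rightarrow> (real^'n) \<times> (real^'n) \<times> real \<times> real" where
  "quadric_radial k p = (k / norm (planar p)) *\<^sub>R (coord_a p *\<^sub>R p - (0, 0, 1, 0))"

definition quadric_tangent ::
    "real \<Rightarrow> (real^'n::finite) \<times> (real^'n) \<times> real \<times> real \<Rightarrow> ((real^'n) \<times> (real^'n) \<times> real \<times> real) set" where
  "quadric_tangent \<kappa> p = {w. quad \<kappa> p w = 0 \<and> coord_b w = 0}"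

lemma quadric_normal_simps [simp]:
  "planar (quadric_normal k p) = (- (k * coord_a p / norm (planar p))) *\<^sub>R rot (planar p)"
  "coord_a (quadric_normal k p) = 0" "coord_b (quadric_normal k p) = k * norm (planar p)"
  by (simp_all add: quadric_normal_def Let_def del: scaleR_minus_left)

lemma quadric_metric: "metric (quadric \<kappa> k) p u v = (1 / k\<^sup>2) * quad \<kappa> u v"
  by (simp add: quadric_def)

lemma quadric_contact_form:
  "contact_form (quadric \<kappa> k) p w = (1 / (2 * k\<^sup>2)) * (area (planar p) (planar w) + (coord_a p * coord_b w - coord_b p * coord_a w))"
  by (simp add: quadric_def)

lemma quadric_half_rank: "half_rank (quadric \<kappa> k :: ((real^'n::finite) \<times> _ \<times> _) contact_sr) = CARD('n)"
  by (simp add: quadric_def)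

lemma quadric_contact_form_antisym:
  "contact_form (quadric \<kappa> k) u v = - contact_form (quadric \<kappa> k) v u"
  using area_antisym[of "planar u" "planar v"] by (simp add: quadric_contact_form algebra_simps)

lemma quadric_contact_form_linear: "linear (contact_form (quadric \<kappa> k) p)"
  by (rule linearI) (simp_all add: quadric_contact_form area_linear add_divide_distrib diff_divide_distrib algebra_simps)

lemma quadric_contact_form_deriv:
  "contact_form_deriv (quadric \<kappa> k) p u v = 2 * contact_form (quadric \<kappa> k) u v"
proof -
  have "contact_form_deriv (quadric \<kappa> k) p u v = contact_form (quadric \<kappa> k) u v - contact_form (quadric \<kappa> k) v u"
  proof (rule contact_form_deriv_affine)
    show "linear (\<lambda>y. contact_form (quadric \<kappa> k) y w)" for w
      by (rule linearI) (simp_all add: quadric_contact_form area_linear add_divide_distrib diff_divide_distrib algebra_simps)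
    show "contact_form (quadric \<kappa> k) y w = contact_form (quadric \<kappa> k) y w + 0" for y w by simp
  qed
  then show ?thesis using quadric_contact_form_antisym[of \<kappa> k v u] by simp
qed

text \<open>Since \<open>d\<omega>(u, v) = 2 \<omega>\<^sub>u(v)\<close> on the ambient space, \<open>\<Omega>\<^sub>p\<close> is the contraction with \<open>p\<close> of the
  constant ambient top form below.\<close>

definition quadric_volume_form ::
    "real \<Rightarrow> real \<Rightarrow> ((real^'n::finite) \<times> (real^'n) \<times> real \<times> real) list \<Rightarrow> real" where
  "quadric_volume_form \<kappa> k us = (1 / 2 ^ CARD('n)) *
     permutation_form CARD('n) (contact_form (quadric \<kappa> k) (hd us)) (\<lambda>u v. 2 * contact_form (quadric \<kappa> k) u v) (tl us)"

lemma quadric_volume: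
  "contact_volume (quadric \<kappa> k) p ws = quadric_volume_form \<kappa> k (p # ws)"
  unfolding contact_volume_eq_permutation_form quadric_half_rank quadric_volume_form_def
    quadric_contact_form_deriv by simp

lemma quadric_volume_form_alternating:
  "alternating_on (Suc (Suc (2 * CARD('n)))) UNIV
     (quadric_volume_form \<kappa> k :: ((real^'n::finite) \<times> (real^'n) \<times> real \<times> real) list \<Rightarrow> real)"
  unfolding quadric_volume_form_def[abs_def]
  by (intro alternating_on_cmult permutation_form_bilinear_alternating quadric_contact_form_antisym
      quadric_contact_form_linear)

abbreviation hyperplane :: "((real^'n::finite) \<times> (real^'n) \<times> real \<times> real) set" where
  "hyperplane \<equiv> {w. coord_b w = 0}"

lemma subspace_hyperplane: "subspace hyperplane"
  by (auto simp: subspace_def coord_b_def)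

lemma dim_hyperplane_coord_b:
  "dim (hyperplane :: ((real^'n::finite) \<times> (real^'n) \<times> real \<times> real) set) = Suc (2 * CARD('n))"
proof -
  have "hyperplane = {w :: (real^'n) \<times> (real^'n) \<times> real \<times> real. (0, 0, 0, 1) \<bullet> w = 0}"
    by (auto simp: inner_prod_def coord_b_def)
  then show ?thesis using dim_hyperplane[of "(0, 0, 0, 1) :: (real^'n) \<times> (real^'n) \<times> real \<times> real"]
    by (simp add: zero_prod_def)
qed

lemma quadric_volume_form_hyperplane:
  fixes us :: "((real^'n::finite) \<times> (real^'n) \<times> real \<times> real) list"
  assumes "length us = Suc (Suc (2 * CARD('n)))" "set us \<subseteq> hyperplane"
  shows "quadric_volume_form \<kappa> k us = 0"
  using assms dim_hyperplane_coord_b[where 'n = 'n]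
  by (intro alternating_on_exceeds_dim[OF alternating_on_subset[OF quadric_volume_form_alternating]
        subspace_hyperplane]) auto

text \<open>The component of the normal along the last basis vector is all that survives, since the
  rest lies in the hyperplane together with \<open>p\<close> and \<open>vs\<close>. Moving that
  basis vector in front of \<open>p\<close> produces the minus sign.\<close>

lemma quadric_volume_normal:
  fixes p :: "(real^'n::finite) \<times> (real^'n) \<times> real \<times> real"
  assumes p: "coord_b p = 0" and vs: "length vs = 2 * CARD('n)" "set vs \<subseteq> hyperplane"
  shows "contact_volume (quadric \<kappa> k) p (quadric_normal k p # vs)
    = - (k * norm (planar p)) * quadric_volume_form \<kappa> k ((0, 0, 0, 1) # p # vs)"
proof -
  let ?D = "quadric_volume_form \<kappa> k" and ?b = "(0, 0, 0, 1) :: (real^'n) \<times> (real^'n) \<times> real \<times> real"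
  define h where "h = (fst (planar (quadric_normal k p)), snd (planar (quadric_normal k p)), 0 :: real, 0 :: real)"
  have N: "quadric_normal k p = 1 *\<^sub>R h + (k * norm (planar p)) *\<^sub>R ?b"
    by (rule prod4_eqI) (simp_all add: h_def zero_prod_def[symmetric] del: quadric_normal_simps(1))
  have "?D (p # quadric_normal k p # vs) = 1 * ?D (p # h # vs) + (k * norm (planar p)) * ?D (p # ?b # vs)"
    unfolding N
    using alternating_on_lin[OF quadric_volume_form_alternating, of "p # 0 # vs" 1 h ?b \<kappa> k 1 "k * norm (planar p)"] vs
    by simp
  also have "?D (p # h # vs) = 0"
    using p vs by (intro quadric_volume_form_hyperplane) (auto simp: h_def)
  also have "?D (p # ?b # vs) = - ?D (?b # p # vs)"
    using alternating_on_swap_adjacent[OF quadric_volume_form_alternating subspace_UNIV, of "[]" p ?b vs] vs by simp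
  finally show ?thesis by (simp add: quadric_volume)
qed

section \<open>Tangent spaces of the quadrics and their hyperplane sections\<close>

lemma open_coord_a: "open A \<Longrightarrow> open {p :: 'a::euclidean_space \<times> 'b::euclidean_space \<times> real \<times> real. coord_a p \<in> A}"
  using open_vimage[OF _ continuous_on_coord_a[OF continuous_on_id], of A] by (simp add: vimage_def)

locale quadric_model =
  fixes \<kappa> k :: real
  assumes \<kappa>: "\<kappa> * \<kappa> = 1" and k: "k > 0"
begin

text \<open>The line p + t w is rescaled by the square root of \<open>d t\<close> to return to the
  quadric. Rescaling keeps it in \<open>V\<close>, and d'(0) = 0 keeps the velocity
  \<open>w\<close>. Suitable \<open>V\<close> and \<open>G\<close> give the model space, the
  hypersurface and its noncharacteristic part.\<close>

lemma tangent_space_quadric: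
  fixes p :: "(real^'n::finite) \<times> (real^'n) \<times> real \<times> real"
  assumes V: "subspace V" and G: "open G" and p: "quad \<kappa> p p = \<kappa>" "p \<in> V" "p \<in> G"
    and w: "quad \<kappa> p w = 0" "w \<in> V"
  shows "w \<in> tangent_space ({p. quad \<kappa> p p = \<kappa>} \<inter> V \<inter> G) p"
proof -
  define d where "d t = 1 + \<kappa> * t\<^sup>2 * quad \<kappa> w w" for t :: real
  define \<gamma> where "\<gamma> t = inverse (sqrt (d t)) *\<^sub>R (p + t *\<^sub>R w)" for t
  have q: "quad \<kappa> (p + t *\<^sub>R w) (p + t *\<^sub>R w) = \<kappa> * d t" for t
    using w(1) p(1) \<kappa> quad_commute[of \<kappa> w p]
    by (simp add: quad_linear quad_linear_left d_def algebra_simps power2_eq_square)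
  have "(d has_real_derivative 0) (at 0)" unfolding d_def by (auto intro!: derivative_eq_intros)
  moreover have d0: "d 0 = 1" by (simp add: d_def)
  ultimately have "((\<lambda>t. inverse (sqrt (d t))) has_real_derivative 0) (at 0)"
    by (auto intro!: derivative_eq_intros)
  moreover have "((\<lambda>t. p + t *\<^sub>R w) has_vector_derivative w) (at 0)" by (auto intro!: derivative_eq_intros)
  ultimately have \<gamma>': "(\<gamma> has_vector_derivative w) (at 0)"
    unfolding \<gamma>_def using has_vector_derivative_scaleR d0 by fastforce
  have \<gamma>0: "\<gamma> 0 = p" by (simp add: \<gamma>_def d0)
  have "isCont \<gamma> 0" using \<gamma>' has_vector_derivative_continuous by blast
  then have "\<forall>\<^sub>F t in nhds 0. \<gamma> t \<in> G"
    using G p(3) \<gamma>0 by (metis continuous_within tendsto_at_iff_tendsto_nhds topological_tendstoD)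
  moreover have "isCont d 0" unfolding d_def by (intro continuous_intros)
  then have "\<forall>\<^sub>F t in nhds 0. d t \<in> {0<..}"
    using d0 by (metis continuous_within greaterThan_iff open_greaterThan tendsto_at_iff_tendsto_nhds
        topological_tendstoD zero_less_one)
  ultimately have "\<forall>\<^sub>F t in nhds 0. \<gamma> t \<in> {p. quad \<kappa> p p = \<kappa>} \<inter> V \<inter> G"
  proof eventually_elim
    case (elim t)
    have "quad \<kappa> (\<gamma> t) (\<gamma> t) = inverse (sqrt (d t)) * (inverse (sqrt (d t)) * (\<kappa> * d t))"
      unfolding \<gamma>_def quad_linear(2) quad_linear_left(2) q ..
    also have "\<dots> = \<kappa>" using elim(2) by (simp add: field_simps)
    finally show ?case
      using elim V p(2) w(2) unfolding \<gamma>_def by (auto intro!: subspace_scale subspace_add)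
  qed
  with \<gamma>' \<gamma>0 show ?thesis unfolding tangent_space_def by blast
qed

lemma tangent_points:
  fixes p :: "(real^'n::finite) \<times> (real^'n) \<times> real \<times> real"
  assumes p: "quad \<kappa> p p = \<kappa>"
  shows "tangent_space (points (quadric \<kappa> k)) p = {w. quad \<kappa> p w = 0}"
proof
  show "tangent_space (points (quadric \<kappa> k)) p \<subseteq> {w. quad \<kappa> p w = 0}"
  proof
    fix w assume "w \<in> tangent_space (points (quadric \<kappa> k)) p"
    then have w: "w \<in> tangent_space {p. quad \<kappa> p p = \<kappa>} p" by (simp add: quadric_def)
    have "2 * quad \<kappa> p w = 0" by (rule tangent_space_level_set[OF has_derivative_quad _ w, of \<kappa>]) simp
    then show "w \<in> {w. quad \<kappa> p w = 0}" by simp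
  qed
  show "{w. quad \<kappa> p w = 0} \<subseteq> tangent_space (points (quadric \<kappa> k)) p"
    using tangent_space_quadric[OF subspace_UNIV open_UNIV p] by (auto simp: quadric_def)
qed

lemma tangent_surface:
  fixes p :: "(real^'n::finite) \<times> (real^'n) \<times> real \<times> real"
  assumes G: "open G" and p: "quad \<kappa> p p = \<kappa>" "coord_b p = 0" "p \<in> G"
  shows "tangent_space ({p. quad \<kappa> p p = \<kappa>} \<inter> hyperplane \<inter> G) p = quadric_tangent \<kappa> p"
proof
  show "tangent_space ({p. quad \<kappa> p p = \<kappa>} \<inter> hyperplane \<inter> G) p \<subseteq> quadric_tangent \<kappa> p"
  proof
    fix w assume w: "w \<in> tangent_space ({p. quad \<kappa> p p = \<kappa>} \<inter> hyperplane \<inter> G) p"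
    have "2 * quad \<kappa> p w = 0" by (rule tangent_space_level_set[OF has_derivative_quad _ w, of \<kappa>]) simp
    moreover have "coord_b w = 0"
      by (rule tangent_space_level_set[OF has_derivative_coord_b[OF has_derivative_ident] _ w, of 0]) simp
    ultimately show "w \<in> quadric_tangent \<kappa> p" by (simp add: quadric_tangent_def)
  qed
  show "quadric_tangent \<kappa> p \<subseteq> tangent_space ({p. quad \<kappa> p p = \<kappa>} \<inter> hyperplane \<inter> G) p"
  proof
    fix w assume "w \<in> quadric_tangent \<kappa> p"
    then show "w \<in> tangent_space ({p. quad \<kappa> p p = \<kappa>} \<inter> hyperplane \<inter> G) p"
      using p by (intro tangent_space_quadric[OF subspace_hyperplane G]) (simp_all add: quadric_tangent_def)
  qed
qed

end

text \<open>\<open>c\<close> and \<open>\<rho>\<close> translate between r in \<open>I\<close> and a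
  = \<open>coord_a p\<close> in \<open>B\<close>: they are cos(kr) or cosh(kr) and its inverse.
  \<open>B\<close> keeps |z|^2 = \<kappa> (1 - a^2) positive, that is, it excludes the
  characteristic points. The factor -\<kappa> makes r decrease in a on the sphere and increase on
  the anti-de Sitter space.\<close>

locale quadric_radius = quadric_model +
  fixes A B I :: "real set" and c \<rho> :: "real \<Rightarrow> real"
  assumes open_A: "open A" and open_I: "open I"
    and B_eq: "B = {a \<in> A. \<kappa> * (1 - a\<^sup>2) > 0}"
    and continuous_c: "continuous_on I c"
    and c_in: "\<And>t. t \<in> I \<Longrightarrow> c t \<in> B" and \<rho>_c: "\<And>t. t \<in> I \<Longrightarrow> \<rho> (c t) = t"
    and \<rho>_in: "\<And>a. a \<in> B \<Longrightarrow> \<rho> a \<in> I" and c_\<rho>: "\<And>a. a \<in> B \<Longrightarrow> c (\<rho> a) = a"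
    and \<rho>_deriv: "\<And>a. a \<in> B \<Longrightarrow> (\<rho> has_real_derivative - \<kappa> / (k * sqrt (\<kappa> * (1 - a\<^sup>2)))) (at a)"
begin

abbreviation "E \<equiv> quadric_noncharacteristic \<kappa> A"

lemma E_eq: "E = ({p. quad \<kappa> p p = \<kappa>} \<inter> hyperplane \<inter> {p. coord_a p \<in> A}) \<inter> {p. planar p \<noteq> 0}"
  by (simp add: quadric_noncharacteristic_def quadric_surface_def)

lemma \<kappa>_cancel: "\<kappa> * (\<kappa> * x) = x" "\<kappa> * x * \<kappa> = x"
  using \<kappa> by (metis mult.assoc mult_1, metis mult.assoc mult.commute mult_1)

lemma open_B: "open B"
proof -
  have "open {a. \<kappa> * (1 - a\<^sup>2) > 0}" by (intro open_Collect_less continuous_intros)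
  moreover have "B = A \<inter> {a. \<kappa> * (1 - a\<^sup>2) > 0}" unfolding B_eq by blast
  ultimately show ?thesis using open_A by (simp add: open_Int)
qed

lemma norm_planar:
  assumes "p \<in> {p. quad \<kappa> p p = \<kappa>} \<inter> hyperplane"
  shows "planar p \<bullet> planar p = \<kappa> * (1 - (coord_a p)\<^sup>2)" "norm (planar p) = sqrt (\<kappa> * (1 - (coord_a p)\<^sup>2))"
proof -
  show "planar p \<bullet> planar p = \<kappa> * (1 - (coord_a p)\<^sup>2)"
    using assms by (auto simp: quad_def power2_eq_square algebra_simps)
  then show "norm (planar p) = sqrt (\<kappa> * (1 - (coord_a p)\<^sup>2))" by (simp add: norm_eq_sqrt_inner)
qed

lemma E_iff:
  "p \<in> E \<longleftrightarrow> quad \<kappa> p p = \<kappa> \<and> coord_b p = 0 \<and> coord_a p \<in> B"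
proof -
  have "planar p \<noteq> 0 \<longleftrightarrow> \<kappa> * (1 - (coord_a p)\<^sup>2) > 0" if "quad \<kappa> p p = \<kappa>" "coord_b p = 0"
  proof -
    have "planar p \<bullet> planar p = \<kappa> * (1 - (coord_a p)\<^sup>2)" using that by (intro norm_planar) simp
    then show ?thesis by (metis inner_gt_zero_iff)
  qed
  then show ?thesis unfolding E_eq B_eq by auto
qed

lemma E_D:
  assumes "p \<in> E"
  shows "quad \<kappa> p p = \<kappa>" "coord_b p = 0" "coord_a p \<in> A" "coord_a p \<in> B" "norm (planar p) \<noteq> 0"
  using assms E_iff[of p] by (auto simp: E_eq)

lemma distribution_eq:
  assumes "quad \<kappa> p p = \<kappa>" "coord_b p = 0"
  shows "distribution (quadric \<kappa> k) p = {w. quad \<kappa> p w = 0 \<and> area (planar p) (planar w) + coord_a p * coord_b w = 0}"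
  using assms k by (simp add: distribution_def tangent_points quadric_contact_form)

lemma normal_distribution:
  assumes p: "quad \<kappa> p p = \<kappa>" "coord_b p = 0"
  shows "quadric_normal k p \<in> distribution (quadric \<kappa> k) p"
proof (cases "planar p = 0")
  case False
  then show ?thesis
    using assms by (simp add: distribution_eq quad_def area_linear dot_square_norm power2_eq_square)
next
  case True
  then show ?thesis using assms by (simp add: distribution_eq quad_def)
qed

lemma tangent_surface_eq:
  fixes p :: "(real^'n::finite) \<times> (real^'n) \<times> real \<times> real"
  assumes "p \<in> quadric_surface \<kappa> A"
  shows "tangent_space (quadric_surface \<kappa> A) p = quadric_tangent \<kappa> p"
  using tangent_surface[OF open_coord_a[OF open_A], of p] assms by (simp add: quadric_surface_def)

text \<open>Where z is nonzero, the normal is horizontal with nonzero last component and so not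
  tangent to the hypersurface. At z = 0 the coordinate a is nonzero, and \<omega> = 0 reduces to a
  vanishing last component.\<close>

lemma quadric_noncharacteristic_eq:
  "noncharacteristic (quadric \<kappa> k) (quadric_surface \<kappa> A) = (E :: ((real^'n::finite) \<times> (real^'n) \<times> real \<times> real) set)"
proof -
  have "quadric_tangent \<kappa> p = distribution (quadric \<kappa> k) p \<longleftrightarrow> planar p = 0"
    if p: "quad \<kappa> p p = \<kappa>" "coord_b p = 0" for p :: "(real^'n) \<times> (real^'n) \<times> real \<times> real"
  proof
    assume *: "quadric_tangent \<kappa> p = distribution (quadric \<kappa> k) p"
    have "quadric_normal k p \<in> quadric_tangent \<kappa> p" unfolding * by (rule normal_distribution[OF p])
    then have "k * norm (planar p) = 0" by (simp add: quadric_tangent_def)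
    then show "planar p = 0" using k by simp
  next
    assume z: "planar p = 0"
    then have "coord_a p \<noteq> 0" using p(1) \<kappa> by (auto simp: quad_def p(2))
    then show "quadric_tangent \<kappa> p = distribution (quadric \<kappa> k) p"
      using z by (auto simp: distribution_eq[OF p] quadric_tangent_def)
  qed
  then have *: "p \<in> noncharacteristic (quadric \<kappa> k) (quadric_surface \<kappa> A) \<longleftrightarrow> p \<in> E"
    if "p \<in> quadric_surface \<kappa> A" for p :: "(real^'n) \<times> (real^'n) \<times> real \<times> real"
    using that tangent_surface_eq[OF that]
    by (simp add: noncharacteristic_def characteristic_points_def quadric_noncharacteristic_def quadric_surface_def)
  show ?thesis
    using * by (auto simp: noncharacteristic_def quadric_noncharacteristic_def)
qed

lemma subspace_tangent: "subspace (quadric_tangent \<kappa> p)"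
  by (auto simp: subspace_def quadric_tangent_def quad_linear) (auto simp: quad_def coord_b_def coord_a_def planar_def)

text \<open>The tangent space misses \<open>p\<close>, because
  \<open>quad \<kappa> p p = \<kappa>\<close> is nonzero, and is therefore a proper subspace of the
  hyperplane.\<close>

lemma dim_tangent:
  fixes p :: "(real^'n::finite) \<times> (real^'n) \<times> real \<times> real"
  assumes p: "p \<in> E"
  shows "dim (quadric_tangent \<kappa> p) \<le> 2 * CARD('n)"
proof -
  have "\<kappa> \<noteq> 0" using \<kappa> by auto
  then have "p \<notin> quadric_tangent \<kappa> p" "p \<in> hyperplane" using E_D[OF p] by (auto simp: quadric_tangent_def)
  moreover have "quadric_tangent \<kappa> p \<subseteq> hyperplane" by (auto simp: quadric_tangent_def)
  ultimately have "quadric_tangent \<kappa> p \<subset> hyperplane" by blast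
  then have "dim (quadric_tangent \<kappa> p) < dim (hyperplane :: ((real^'n) \<times> (real^'n) \<times> real \<times> real) set)"
    using dim_psubset[of "quadric_tangent \<kappa> p" hyperplane]
    by (simp add: span_eq_iff[THEN iffD2] subspace_tangent subspace_hyperplane)
  then show ?thesis by (simp add: dim_hyperplane_coord_b)
qed

abbreviation (input) eb :: "(real^'n::finite) \<times> (real^'n) \<times> real \<times> real" where "eb \<equiv> (0, 0, 0, 1)"
abbreviation (input) ea :: "(real^'n::finite) \<times> (real^'n) \<times> real \<times> real" where "ea \<equiv> (0, 0, 1, 0)"

lemma slice_alternating:
  "alternating_on (Suc (2 * CARD('n))) UNIV
    (\<lambda>us. quadric_volume_form \<kappa> k (eb # us :: ((real^'n::finite) \<times> (real^'n) \<times> real \<times> real) list))"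
  by (intro alternating_on_Cons quadric_volume_form_alternating UNIV_I)

lemma slice_nonzero:
  "\<exists>us :: ((real^'n::finite) \<times> (real^'n) \<times> real \<times> real) list.
     length us = Suc (2 * CARD('n)) \<and> set us \<subseteq> hyperplane \<and> quadric_volume_form \<kappa> k (eb # us) \<noteq> 0"
proof -
  obtain b :: "nat \<Rightarrow> (real^'n) \<times> (real^'n)" where
    b: "\<And>p q. 0 < p \<Longrightarrow> p \<le> 2 * CARD('n) \<Longrightarrow> 0 < q \<Longrightarrow> q \<le> 2 * CARD('n) \<Longrightarrow> area (b p) (b q) = pairing p q"
    using symplectic_basis_exists by blast
  define us where "us = ea # map (\<lambda>p. (fst (b (Suc p)), snd (b (Suc p)), 0 :: real, 0 :: real)) [0..<2 * CARD('n)]"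
  have us0: "us ! 0 = ea" by (simp add: us_def)
  have nth: "us ! p = (fst (b p), snd (b p), 0, 0)" if "0 < p" "p \<le> 2 * CARD('n)" for p
    using that by (cases p) (auto simp: us_def)
  \<comment> \<open>The leading factor at \<open>eb\<close> is -1/(2k^2) on \<open>ea\<close> and 0
    on planar vectors, where twice the contact form is \<open>area\<close> divided by k^2.\<close>
  have "permutation_form CARD('n) (contact_form (quadric \<kappa> k) eb) (\<lambda>u v. 2 * contact_form (quadric \<kappa> k) u v) us \<noteq> 0"
    using k by (intro permutation_form_symplectic_basis[where b = "1 / k\<^sup>2"])
      (auto simp: quadric_contact_form us0 nth b)
  then have "quadric_volume_form \<kappa> k (eb # us) \<noteq> 0" by (simp add: quadric_volume_form_def)
  moreover have "length us = Suc (2 * CARD('n))" "set us \<subseteq> hyperplane" by (auto simp: us_def)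
  ultimately show ?thesis by blast
qed

text \<open>\<open>p\<close> and a basis of the tangent space span the hyperplane, the component of
  \<open>v\<close> along \<open>p\<close> being \<open>\<kappa> * quad \<kappa> p v\<close>. If the
  form were 0 on them, it would vanish on the whole hyperplane, against
  \<open>slice_nonzero\<close>.\<close>

lemma tangent_frame:
  fixes p :: "(real^'n::finite) \<times> (real^'n) \<times> real \<times> real"
  assumes p: "p \<in> E"
  shows "\<exists>Zs. length Zs = 2 * CARD('n) \<and> set Zs \<subseteq> quadric_tangent \<kappa> p \<and>
    quadric_volume_form \<kappa> k (eb # p # Zs) \<noteq> 0"
proof -
  obtain b where b: "b \<subseteq> quadric_tangent \<kappa> p" "independent b" "quadric_tangent \<kappa> p \<subseteq> span b"
    "card b = dim (quadric_tangent \<kappa> p)"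
    using basis_exists[of "quadric_tangent \<kappa> p"] by metis
  have fin: "finite b" using b(2) by (rule independent_imp_finite)
  obtain Bs where Bs: "set Bs = b" "distinct Bs" using finite_distinct_list[OF fin] by blast
  have sp: "hyperplane \<subseteq> span (insert p b)"
  proof
    fix v :: "(real^'n) \<times> (real^'n) \<times> real \<times> real" assume v: "v \<in> hyperplane"
    let ?c = "\<kappa> * quad \<kappa> p v"
    have "quad \<kappa> p (v - ?c *\<^sub>R p) = 0"
      using E_D[OF p] by (simp add: quad_linear \<kappa>_cancel)
    then have "v - ?c *\<^sub>R p \<in> quadric_tangent \<kappa> p" using v E_D[OF p] by (simp add: quadric_tangent_def)
    then have "v - ?c *\<^sub>R p \<in> span b" using b(3) by blast
    then show "v \<in> span (insert p b)" by (meson span_breakdown_eq)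
  qed
  have "dim (hyperplane :: ((real^'n) \<times> (real^'n) \<times> real \<times> real) set) \<le> card (insert p b)"
    using sp fin by (intro dim_le_card) auto
  also have "\<dots> \<le> Suc (card b)" using fin by (simp add: card_insert_le_m1 card_insert_if)
  finally have len: "length Bs = 2 * CARD('n)"
    using dim_tangent[OF p] b(4) Bs distinct_card[OF Bs(2)] by (simp add: dim_hyperplane_coord_b)
  have "quadric_volume_form \<kappa> k (eb # p # Bs) \<noteq> 0"
  proof
    assume 0: "quadric_volume_form \<kappa> k (eb # p # Bs) = 0"
    obtain us :: "((real^'n) \<times> (real^'n) \<times> real \<times> real) list" where
      us: "length us = Suc (2 * CARD('n))" "set us \<subseteq> hyperplane" "quadric_volume_form \<kappa> k (eb # us) \<noteq> 0"
      using slice_nonzero by blast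
    have "quadric_volume_form \<kappa> k (eb # us) = 0"
    proof (rule alternating_on_eq_0[OF alternating_on_subset[OF slice_alternating] subspace_hyperplane _ _ _ _ us(1,2)])
      show "length (p # Bs) = Suc (2 * CARD('n))" using len by simp
      show "set (p # Bs) \<subseteq> hyperplane" using E_D[OF p] Bs b(1) by (auto simp: quadric_tangent_def)
      show "hyperplane \<subseteq> span (set (p # Bs))" using sp Bs by simp
    qed (use 0 in auto)
    then show False using us by blast
  qed
  then show ?thesis using len Bs b(1) by blast
qed

text \<open>Write D for \<open>quadric_volume_form\<close>. Contracting \<mu> = -k |z| D(eb, p, ...)
  with the radial field kills its multiple of p and leaves k^2 D(eb, p, ea, ...); exchanging p and
  ea gives the factor -k^2. As \<open>ea\<close> differs from a p by a tangent vector, the constant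
  form is k a / |z| times \<mu>.\<close>

lemma quadric_radial_hypersurface:
  fixes radius :: "(real^'n::finite) \<times> (real^'n) \<times> real \<times> real \<Rightarrow> real"
  assumes radius: "\<And>p. p \<in> E \<Longrightarrow> radius p = \<rho> (coord_a p)"
  shows "radial_hypersurface (quadric \<kappa> k)
     (quadric_surface \<kappa> A) E CARD('n) (quadric_tangent \<kappa>)
     (quadric_normal k) (quadric_radial k) radius (\<lambda>p w. - \<kappa> * coord_a w / (k * norm (planar p)))
     (\<lambda>us. - k\<^sup>2 * quadric_volume_form \<kappa> k (eb # ea # us)) (\<lambda>p. k * coord_a p / norm (planar p))"
proof -
  have TS: "tangent_space (quadric_surface \<kappa> A) p = quadric_tangent \<kappa> p" if "p \<in> E"
    for p :: "(real^'n) \<times> (real^'n) \<times> real \<times> real"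
    using that by (intro tangent_surface_eq) (simp add: quadric_noncharacteristic_def)
  have F: "foliation (quadric \<kappa> k) (quadric_surface \<kappa> A) p
      = {w. quad \<kappa> p w = 0 \<and> area (planar p) (planar w) = 0 \<and> coord_b w = 0}" if "p \<in> E"
    for p :: "(real^'n) \<times> (real^'n) \<times> real \<times> real"
    using E_D[OF that] by (auto simp: foliation_def TS[OF that] distribution_eq quadric_tangent_def)
  have z2: "norm (planar p) * norm (planar p) = \<kappa> - \<kappa> * (coord_a p * coord_a p)" if "p \<in> E"
    for p :: "(real^'n) \<times> (real^'n) \<times> real \<times> real"
    using norm_planar(1)[of p] E_D[OF that] by (simp add: dot_square_norm power2_eq_square algebra_simps)
  have \<kappa>a: "\<kappa> * (norm (planar p) * norm (planar p)) = 1 - coord_a p * coord_a p" if "p \<in> E"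
    for p :: "(real^'n) \<times> (real^'n) \<times> real \<times> real"
    unfolding z2[OF that] by (simp add: right_diff_distrib \<kappa> \<kappa>_cancel)
  have SD: "subspace (distribution (quadric \<kappa> k) p)" if "p \<in> E"
    for p :: "(real^'n) \<times> (real^'n) \<times> real \<times> real"
  proof -
    have "linear (\<lambda>w. area (planar p) (planar w) + coord_a p * coord_b w)" "linear (quad \<kappa> p)"
      by (rule linearI; simp add: area_linear quad_linear algebra_simps)+
    then have "subspace ({w. quad \<kappa> p w = 0} \<inter> {w. area (planar p) (planar w) + coord_a p * coord_b w = 0})"
      by (intro subspace_inter linear_subspace_kernel)
    then show ?thesis unfolding distribution_eq[OF E_D(1,2)[OF that]] by (simp add: Collect_conj_eq)
  qed
  show ?thesis
  proof (rule radial_hypersurface.intro, goal_cases)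
    case 1 show ?case by (rule quadric_half_rank)
  next
    case 2 show ?case by simp
  next
    case 3 show ?case by (rule quadric_noncharacteristic_eq)
  next
    case 4 show ?case unfolding quadric_noncharacteristic_def
      by (intro openin_open_Int open_planar_nonzero)
  next
    case 5 then show ?case by (rule TS)
  next
    case (6 p)
    have "open ({p. coord_a p \<in> A} \<inter> {p :: (real^'n) \<times> (real^'n) \<times> real \<times> real. planar p \<noteq> 0})"
      by (intro open_Int open_planar_nonzero open_coord_a open_A)
    from tangent_surface[OF this, of p] show ?case
      using 6 by (simp add: E_eq Int_assoc)
  next
    case 7 show ?case by (rule subspace_tangent)
  next
    case 8 then show ?case by (rule dim_tangent)
  next
    case (9 p)
    show ?case unfolding quadric_volume[abs_def]
      by (intro alternating_on_Cons quadric_volume_form_alternating UNIV_I)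
  next
    case (10 p)
    obtain Zs where Zs: "length Zs = 2 * CARD('n)" "set Zs \<subseteq> quadric_tangent \<kappa> p"
      "quadric_volume_form \<kappa> k (eb # p # Zs) \<noteq> 0" using tangent_frame[OF 10] by blast
    have "set Zs \<subseteq> hyperplane" using Zs(2) by (auto simp: quadric_tangent_def)
    then have "contact_volume (quadric \<kappa> k) p (quadric_normal k p # Zs) \<noteq> 0"
      using Zs E_D[OF 10] k by (simp add: quadric_volume_normal)
    then show ?case using Zs by blast
  next
    case 11 then show ?case by (rule SD)
  next
    case 12 show ?case by (simp add: quadric_metric quad_commute)
  next
    case 13 show ?case by (rule linearI) (simp_all add: quadric_metric quad_linear add_divide_distrib)
  next
    case (14 p Y)
    have Y: "quad \<kappa> p Y = 0" "coord_b Y = 0" "quad \<kappa> Y Y = 0" using 14 k by (auto simp: F quadric_metric)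
    have 1: "planar Y \<bullet> planar Y = - \<kappa> * (coord_a Y * coord_a Y)" using Y by (simp add: quad_def)
    have 2: "planar p \<bullet> planar Y = - \<kappa> * (coord_a p * coord_a Y)" using Y E_D[OF 14(1)] by (simp add: quad_def)
    \<comment> \<open>For \<open>\<kappa> = -1\<close> the form \<open>quad\<close> is indefinite.
      Orthogonality to \<open>p\<close> and Cauchy-Schwarz for the planar parts give a_p^2 a_Y^2
      \<le> (a_p^2 - 1) a_Y^2, which forces a_Y = 0.\<close>
    have "coord_a Y = 0"
    proof (cases "\<kappa> = 1")
      case True
      then have "coord_a Y * coord_a Y \<le> 0" using 1 inner_ge_zero[of "planar Y"] by simp
      then show ?thesis by (metis mult_eq_0_iff order_antisym zero_le_square)
    next
      case False
      then have m: "\<kappa> = -1" using \<kappa> by (simp add: square_eq_1_iff)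
      have "(planar p \<bullet> planar Y)\<^sup>2 \<le> (planar p \<bullet> planar p) * (planar Y \<bullet> planar Y)" by (rule Cauchy_Schwarz_ineq)
      then have "(coord_a p * coord_a Y)\<^sup>2 \<le> ((coord_a p)\<^sup>2 - 1) * (coord_a Y * coord_a Y)"
        unfolding 1 2 using norm_planar(1)[of p] E_D[OF 14(1)] m by simp
      then have "coord_a Y * coord_a Y \<le> 0" by (simp add: power2_eq_square algebra_simps)
      then show ?thesis by (metis mult_eq_0_iff order_antisym zero_le_square)
    qed
    then show ?case using 1 Y by (intro prod4_eqI) (simp_all add: zero_prod_def coord_a_def coord_b_def)
  next
    case (15 p) then show ?case using E_D by (intro normal_distribution)
  next
    case (16 p)
    have "quad \<kappa> (quadric_normal k p) (quadric_normal k p)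
        = k\<^sup>2 * (coord_a p * coord_a p + \<kappa> * (norm (planar p) * norm (planar p)))"
      using E_D(5)[OF 16] by (simp add: quad_def dot_square_norm power2_eq_square algebra_simps)
    then show ?case using \<kappa>a[OF 16] k by (simp add: quadric_metric)
  next
    case (17 p Y) then show ?case by (auto simp: quadric_metric F quad_def area_eq_inner)
  next
    case (18 p v)
    have N: "quadric_normal k p \<in> distribution (quadric \<kappa> k) p" using E_D[OF 18(1)] by (intro normal_distribution)
    have "v - (coord_b v / (k * norm (planar p))) *\<^sub>R quadric_normal k p \<in> distribution (quadric \<kappa> k) p"
      by (intro subspace_diff[OF SD[OF 18(1)]] subspace_scale[OF SD[OF 18(1)]] 18(2) N)
    then show ?case using E_D[OF 18(1)] k
      by (intro exI[of _ "coord_b v / (k * norm (planar p))"])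
        (simp add: F[OF 18(1)] distribution_eq[OF E_D(1,2)[OF 18(1)]] del: quadric_normal_simps(1))
  next
    case (19 p)
    have "quad \<kappa> p (quadric_radial k p) = (k / norm (planar p)) * (coord_a p * \<kappa> - \<kappa> * coord_a p)"
      using E_D[OF 19] unfolding quadric_radial_def quad_linear by (simp add: quad_def zero_prod_def[symmetric])
    then show ?case using E_D[OF 19]
      by (simp add: F[OF 19] quadric_radial_def area_linear zero_prod_def[symmetric])
  next
    case (20 p)
    have "(\<rho> has_derivative (\<lambda>h. (- \<kappa> / (k * norm (planar p))) * h)) (at (coord_a p))"
    proof -
      have "norm (planar p) = sqrt (\<kappa> * (1 - (coord_a p)\<^sup>2))" using E_D(1,2)[OF 20] by (intro norm_planar) simp
      then show ?thesis using \<rho>_deriv[OF E_D(4)[OF 20]] unfolding has_field_derivative_def by metis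
    qed
    from has_derivative_compose[OF has_derivative_coord_a[OF has_derivative_ident] this]
    have "((\<lambda>p. \<rho> (coord_a p)) has_derivative (\<lambda>w. - \<kappa> * coord_a w / (k * norm (planar p)))) (at p within E)"
      by simp
    from has_derivative_transform[OF 20 radius this] show ?case .
  next
    case (21 p Y)
    have "quad \<kappa> (quadric_radial k p) Y = (k / norm (planar p)) * (coord_a p * quad \<kappa> p Y - \<kappa> * coord_a Y)"
      unfolding quadric_radial_def quad_linear_left by (simp add: quad_def inner_diff_left zero_prod_def[symmetric] algebra_simps)
    then show ?case using 21 k by (simp add: F quadric_metric power2_eq_square)
  next
    case (22 p)
    have "coord_a (quadric_radial k p) = (k / norm (planar p)) * - (\<kappa> * (norm (planar p) * norm (planar p)))"
      unfolding \<kappa>a[OF 22] by (simp add: quadric_radial_def)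
    also have "\<dots> = - \<kappa> * (k * norm (planar p))" using E_D(5)[OF 22] by simp
    finally show ?case using E_D(5)[OF 22] k \<kappa> by simp
  next
    case 23 show ?case
      by (intro alternating_on_cmult alternating_on_Cons quadric_volume_form_alternating UNIV_I)
  next
    case (24 p y ws)
    let ?D = "\<lambda>us. quadric_volume_form \<kappa> k (eb # us)"
    have ws: "set ws \<subseteq> hyperplane" using 24(4) by (auto simp: quadric_tangent_def)
    have X: "quadric_radial k y = (k * coord_a y / norm (planar y)) *\<^sub>R y + (- k / norm (planar y)) *\<^sub>R ea"
      by (simp add: quadric_radial_def scaleR_diff_right)
    have "contact_volume (quadric \<kappa> k) y (quadric_normal k y # quadric_radial k y # ws)
        = - (k * norm (planar y)) * ?D (y # quadric_radial k y # ws)"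
      using 24(2,3) ws E_D[OF 24(2)] by (intro quadric_volume_normal) (auto simp: quadric_radial_def)
    also have "?D (y # quadric_radial k y # ws)
        = (k * coord_a y / norm (planar y)) * ?D (y # y # ws) + (- k / norm (planar y)) * ?D (y # ea # ws)"
      unfolding X
      using alternating_on_lin[OF slice_alternating, of "y # 0 # ws" 1 y ea "k * coord_a y / norm (planar y)" "- k / norm (planar y)"] 24(3)
      by simp
    also have "?D (y # y # ws) = 0"
      using 24(3) by (intro alternating_on_not_distinct[OF slice_alternating]) auto
    also have "?D (y # ea # ws) = - ?D (ea # y # ws)"
      using alternating_on_swap_adjacent[OF slice_alternating subspace_UNIV, of "[]" y ea ws] 24(3) by simp
    finally show ?case using E_D(5)[OF 24(2)] by (simp add: power2_eq_square)
  next
    case (25 p vs)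
    let ?D = "\<lambda>us. quadric_volume_form \<kappa> k (eb # us)"
    define u where "u = ea - coord_a p *\<^sub>R p"
    have "quad \<kappa> p u = \<kappa> * coord_a p - coord_a p * \<kappa>"
      unfolding u_def quad_linear using E_D[OF 25(1)] by (simp add: quad_def zero_prod_def[symmetric])
    then have u: "u \<in> quadric_tangent \<kappa> p" using E_D[OF 25(1)] by (simp add: quadric_tangent_def u_def)
    have "?D (u # vs) = 0"
      using dim_tangent[OF 25(1)] 25(2,3) u
      by (intro alternating_on_exceeds_dim[OF alternating_on_subset[OF slice_alternating] subspace_tangent]) auto
    moreover have "ea = coord_a p *\<^sub>R p + 1 *\<^sub>R u" by (simp add: u_def)
    then have "?D (ea # vs) = coord_a p * ?D (p # vs) + 1 * ?D (u # vs)"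
      using alternating_on_lin[OF slice_alternating, of "0 # vs" 0 p u "coord_a p" 1] 25(2) by simp
    moreover have "set vs \<subseteq> hyperplane" using 25(3) by (auto simp: quadric_tangent_def)
    ultimately show ?case
      using 25(2) E_D[OF 25(1)] by (simp add: quadric_volume_normal power2_eq_square)
  next
    case (26 p v)
    \<comment> \<open>The constant vector \<open>v\<close>, projected along \<open>y\<close> onto
      the tangent space at \<open>y\<close>.\<close>
    define V where "V y = v - (\<kappa> * quad \<kappa> y v) *\<^sub>R y" for y
    have "continuous_on E V" unfolding V_def by (intro continuous_intros continuous_on_quad)
    moreover have "V y \<in> quadric_tangent \<kappa> y" if "y \<in> E" for y
      using E_D[OF that] 26(2)
      by (simp add: V_def quadric_tangent_def quad_linear \<kappa>_cancel)
    moreover have "V p = v" using 26(2) by (simp add: V_def quadric_tangent_def)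
    ultimately show ?case by blast
  next
    case (27 Z)
    have "continuous_on E (quadric_normal k :: (real^'n) \<times> (real^'n) \<times> real \<times> real \<Rightarrow> _)"
      unfolding quadric_normal_def rot_def Let_def
      by (intro continuous_intros continuous_on_planar continuous_on_coord_a) (auto dest: E_D(5))
    then show ?case
      unfolding quadric_volume quadric_volume_form_def list.sel
      using 27 k
      by (intro continuous_on_mult continuous_on_const permutation_form_continuous)
        (auto simp: quadric_contact_form intro!: continuous_intros continuous_on_area continuous_on_planar
          continuous_on_coord_a continuous_on_coord_b)
  qed
qed

end

section \<open>The radial process on a quadric\<close>

context quadric_radius
begin

lemma Ck_on_\<rho>: "Ck_on j B \<rho>"
proof -
  have pos: "\<kappa> * (1 - a\<^sup>2) > 0" if "a \<in> B" for a using that by (simp add: B_eq)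
  have "Ck_on (Suc j) B \<rho>"
  proof (rule Ck_on_real_SucI[OF open_B \<rho>_deriv])
    have "Ck_on j B (\<lambda>a. (- \<kappa> / k) * inverse (sqrt (\<kappa> * (1 - a\<^sup>2))))"
      using pos by (intro Ck_on_cmult Ck_on_inverse_sqrt_poly open_B)
    then show "Ck_on j B (\<lambda>a. - \<kappa> / (k * sqrt (\<kappa> * (1 - a\<^sup>2))))"
      by (simp add: field_simps)
  qed
  then show ?thesis by (rule Ck_on_Suc_imp)
qed

text \<open>The first-order coefficient is half of 2n q with q = k a / |z|, expressed in r by a =
  c(r) and |z|^2 = \<kappa> (1 - a^2). The trigonometric or hyperbolic identities are left to the
  two instances.\<close>

lemma diffusion_radial_part:
  fixes X :: "real \<Rightarrow> 'w \<Rightarrow> (real^'n::finite) \<times> (real^'n) \<times> real \<times> real"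
    and radius :: "(real^'n) \<times> (real^'n) \<times> real \<times> real \<Rightarrow> real"
  assumes radius: "\<And>p. p \<in> E \<Longrightarrow> radius p = \<rho> (coord_a p)"
    and \<theta>: "orientation_form (2 * CARD('n)) (quadric_surface \<kappa> A) \<theta>"
    and X: "sub_laplacian_diffusion (quadric \<kappa> k) (quadric_surface \<kappa> A) \<theta> P F \<zeta> X"
    and L': "\<And>f t. t \<in> I \<Longrightarrow> L' f t = (1/2) * deriv (deriv f) t +
      real CARD('n) * (k * c t / sqrt (\<kappa> * (1 - (c t)\<^sup>2))) * deriv f t"
  shows "diffusion P F I L' \<zeta> (\<lambda>t w. radius (X t w))"
proof (rule diffusion_image[where X = X and r = radius and E = E
      and L = "\<lambda>f x. (1/2) * sub_laplacian (quadric \<kappa> k) (quadric_surface \<kappa> A) \<theta> f x"])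
  interpret radial_hypersurface "quadric \<kappa> k :: ((real^'n) \<times> (real^'n) \<times> real \<times> real) contact_sr"
     "quadric_surface \<kappa> A" E "CARD('n)" "quadric_tangent \<kappa>"
     "quadric_normal k" "quadric_radial k" radius "\<lambda>p w. - \<kappa> * coord_a w / (k * norm (planar p))"
     "\<lambda>us. - k\<^sup>2 * quadric_volume_form \<kappa> k ((0, 0, 0, 1) # (0, 0, 1, 0) # us)" "\<lambda>p. k * coord_a p / norm (planar p)"
    by (rule quadric_radial_hypersurface[OF radius])
  let ?E = "E :: ((real^'n) \<times> (real^'n) \<times> real \<times> real) set"
  let ?Q = "{p :: (real^'n) \<times> (real^'n) \<times> real \<times> real. quad \<kappa> p p = \<kappa>} \<inter> hyperplane"
  show "diffusion P F ?E (\<lambda>f x. (1/2) * sub_laplacian (quadric \<kappa> k) (quadric_surface \<kappa> A) \<theta> f x) \<zeta> X"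
    using X unfolding sub_laplacian_diffusion_def noncharacteristic .
  have closed_Q: "closed ?Q"
    by (intro closed_Int closed_Collect_eq continuous_on_quad continuous_on_coord_b continuous_on_id continuous_on_const)
  show "?E \<in> sets borel"
    unfolding E_eq using closed_Q open_coord_a[OF open_A] open_planar_nonzero
    by (intro sets.Int[OF sets.Int]) (auto intro: borel_closed borel_open)
  show "continuous_on ?E radius"
    unfolding continuous_on_eq_continuous_within
    using r_derivative has_derivative_continuous by blast
  show pos: "radius p \<in> I" if "p \<in> ?E" for p using radius[OF that] \<rho>_in[OF E_D(4)[OF that]] by simp
  show "compact {p \<in> ?E. radius p \<in> K}" if K: "compact K" "K \<subseteq> I" for K
  proof -
    have cK: "compact (c ` K)"
      using continuous_on_subset[OF continuous_c K(2)] K(1) by (rule compact_continuous_image)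
    \<comment> \<open>\<open>c\<close> maps \<open>K\<close> into \<open>B\<close>, which makes
      membership in \<open>?E\<close> automatic, so the set is closed in the whole space.\<close>
    have eq: "{p \<in> ?E. radius p \<in> K} = ?Q \<inter> {p. coord_a p \<in> c ` K}"
    proof (intro subset_antisym subsetI)
      fix p assume "p \<in> {p \<in> ?E. radius p \<in> K}"
      then have p: "p \<in> ?E" "radius p \<in> K" by auto
      have "coord_a p = c (radius p)" using radius[OF p(1)] c_\<rho>[OF E_D(4)[OF p(1)]] by simp
      then show "p \<in> ?Q \<inter> {p. coord_a p \<in> c ` K}" using p E_D[OF p(1)] by blast
    next
      fix p assume p: "p \<in> ?Q \<inter> {p. coord_a p \<in> c ` K}"
      then obtain t where t: "t \<in> K" "coord_a p = c t" by blast
      then have "t \<in> I" using K(2) by blast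
      then have E: "p \<in> ?E" using p t c_in[of t] by (simp add: E_iff)
      then have "radius p = t" using radius[OF E] t \<rho>_c[OF \<open>t \<in> I\<close>] by simp
      then show "p \<in> {p \<in> ?E. radius p \<in> K}" using E t by simp
    qed
    obtain M where M: "\<And>a. a \<in> c ` K \<Longrightarrow> norm a \<le> M" using compact_imp_bounded[OF cK] by (auto simp: bounded_iff)
    \<comment> \<open>Since |z|^2 = \<kappa> (1 - a^2) on the quadric, a bound \<open>M\<close> on a
      bounds the planar part too.\<close>
    have "norm p \<le> sqrt (\<bar>\<kappa>\<bar> * (1 + M\<^sup>2)) + M" if p: "p \<in> ?Q \<inter> {p. coord_a p \<in> c ` K}" for p
    proof -
      have a: "(coord_a p)\<^sup>2 \<le> M\<^sup>2" "\<bar>coord_a p\<bar> \<le> M" 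
        using M[of "coord_a p"] p power_mono[of "\<bar>coord_a p\<bar>" M 2] by auto
      have "\<kappa> * (1 - (coord_a p)\<^sup>2) \<le> \<bar>\<kappa> * (1 - (coord_a p)\<^sup>2)\<bar>" by simp
      also have "\<dots> \<le> \<bar>\<kappa>\<bar> * (1 + M\<^sup>2)"
        unfolding abs_mult using a(1) zero_le_power2[of "coord_a p"]
        by (intro mult_left_mono) (auto simp: abs_le_iff simp del: zero_le_power2)
      finally have "norm (planar p) \<le> sqrt (\<bar>\<kappa>\<bar> * (1 + M\<^sup>2))"
        using norm_planar(2)[of p] p by simp
      moreover have "p = (fst (planar p), snd (planar p), 0, 0) + (0, 0, coord_a p, 0)"
        using p by (intro prod4_eqI) auto
      then have "norm p \<le> norm (fst (planar p), snd (planar p), 0 :: real, 0 :: real) + norm (0 :: real^'n, 0 :: real^'n, coord_a p, 0 :: real)"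
        by (metis norm_triangle_ineq)
      then have "norm p \<le> norm (planar p) + \<bar>coord_a p\<bar>"
        by (simp add: norm_prod_def)
      ultimately show ?thesis using a(2) by linarith
    qed
    then have "bounded (?Q \<inter> {p. coord_a p \<in> c ` K})"
      unfolding bounded_iff by blast
    moreover have "closed {p :: (real^'n) \<times> (real^'n) \<times> real \<times> real. coord_a p \<in> c ` K}"
      using closed_vimage[OF compact_imp_closed[OF cK] continuous_on_coord_a[OF continuous_on_id]]
      by (simp add: vimage_def)
    ultimately show ?thesis unfolding eq compact_eq_bounded_closed using closed_Q by (auto intro: closed_Int)
  qed
  fix f :: "real \<Rightarrow> real" assume f: "smooth_along I f"
  show "smooth_along ?E (\<lambda>x. f (radius x))"
  proof (rule smooth_along_compose[OF f pos])
    fix x :: "(real^'n) \<times> (real^'n) \<times> real \<times> real" assume x: "x \<in> ?E"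
    let ?U = "{p :: (real^'n) \<times> (real^'n) \<times> real \<times> real. coord_a p \<in> B}"
    have "Ck_on j ?U (\<lambda>p. \<rho> (coord_a p))" for j
      using Ck_on_\<rho> Ck_on_bounded_linear[OF bounded_linear_coord_a]
      by (rule_tac Ck_on_compose[OF open_coord_a[OF open_B] open_B]) auto
    then show "\<exists>U g. open U \<and> x \<in> U \<and> (\<forall>k. Ck_on k U g) \<and> (\<forall>y\<in>U \<inter> ?E. g y = radius y)"
      using E_D(4)[OF x] open_coord_a[OF open_B] radius
      by (intro exI[of _ ?U] exI[of _ "\<lambda>p. \<rho> (coord_a p)"]) auto
  qed
  show "(1/2) * sub_laplacian (quadric \<kappa> k) (quadric_surface \<kappa> A) \<theta> (\<lambda>x. f (radius x)) p = L' f (radius p)"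
    if p: "p \<in> ?E" for p
  proof -
    have "coord_a p = c (radius p)" using radius[OF p] c_\<rho>[OF E_D(4)[OF p]] by simp
    moreover have "norm (planar p) = sqrt (\<kappa> * (1 - (coord_a p)\<^sup>2))" using E_D[OF p] by (intro norm_planar(2)) simp
    ultimately show ?thesis
      using sub_laplacian_radial[OF \<theta> smooth_along_real_derivs[OF f open_I pos] p]
      unfolding L'[OF pos[OF p]] by simp
  qed
qed

end

section \<open>The two instances: sphere and anti-de Sitter space\<close>

lemma sphere_legendre:
  fixes X :: "real \<Rightarrow> 'w \<Rightarrow> (real^'n::finite) \<times> (real^'n) \<times> real \<times> real"
  assumes k: "k > 0"
    and \<theta>: "orientation_form (2 * CARD('n)) (sphere_surface k) \<theta>"
    and X: "sub_laplacian_diffusion (sphere_model k) (sphere_surface k) \<theta> P F \<zeta> X"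
  shows "legendre_process k (2 * CARD('n) + 1) P F \<zeta> (\<lambda>t w. sphere_radius k (X t w))"
proof -
  define I where "I = {0<..<pi / k}"
  define B where "B = {a :: real. 1 * (1 - a\<^sup>2) > 0}"
  have B: "a \<in> B \<longleftrightarrow> - 1 < a \<and> a < 1" for a
    using abs_square_less_1[of a] by (auto simp: B_def)
  have I: "0 < k * t" "k * t < pi" if "t \<in> I" for t
    using that k by (auto simp: I_def field_simps)
  have sin: "sqrt (1 - (cos (k * t))\<^sup>2) = sin (k * t)" "0 < sin (k * t)" if "t \<in> I" for t
    using sin_gt_zero[OF I[OF that]] by (simp_all add: sin_squared_eq[symmetric])
  interpret quadric_radius 1 k UNIV B I "\<lambda>t. cos (k * t)" "\<lambda>a. arccos a / k"
  proof
    show "B = {a \<in> UNIV. 0 < 1 * (1 - a\<^sup>2)}" by (simp add: B_def)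
    show "continuous_on I (\<lambda>t. cos (k * t))" by (intro continuous_intros)
    show "cos (k * t) \<in> B" if "t \<in> I" for t
      using zero_less_power[OF sin(2)[OF that], of 2] by (simp add: B_def sin_squared_eq)
    show "arccos (cos (k * t)) / k = t" if "t \<in> I" for t
      using I[OF that] k by (simp add: arccos_cos)
    show "arccos a / k \<in> I" if "a \<in> B" for a
      using arccos_lt_bounded[of a] that k by (auto simp: B I_def divide_simps)
    show "cos (k * (arccos a / k)) = a" if "a \<in> B" for a
      using that k by (simp add: B cos_arccos)
    show "((\<lambda>a. arccos a / k) has_real_derivative - 1 / (k * sqrt (1 * (1 - a\<^sup>2)))) (at a)"
      if "a \<in> B" for a
      using that DERIV_arccos[of a, THEN DERIV_cdivide, of k] by (simp add: B field_simps)
  qed (use k in \<open>auto simp: I_def\<close>)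
  \<comment> \<open>That \<open>c\<close> and \<open>\<rho>\<close> are mutually inverse shows that
    the definite description in \<open>sphere_radius\<close> has exactly one solution.\<close>
  have radius: "sphere_radius k p = arccos (coord_a p) / k" if "p \<in> E"
    for p :: "(real^'n) \<times> (real^'n) \<times> real \<times> real"
    unfolding sphere_radius_def split_beta coord_a_def[symmetric]
    using c_\<rho>[OF E_D(4)[OF that]] \<rho>_in[OF E_D(4)[OF that]] \<rho>_c
    by (intro the_equality) (auto simp: I_def)
  show ?thesis
    unfolding legendre_process_def I_def[symmetric]
    using \<theta> X unfolding sphere_model_eq sphere_surface_eq
    by (intro diffusion_radial_part[OF radius]) (simp_all add: sin cot_def)
qed

lemma anti_de_sitter_hyperbolic_bessel:
  fixes X :: "real \<Rightarrow> 'w \<Rightarrow> (real^'n::finite) \<times> (real^'n) \<times> real \<times> real"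
  assumes k: "k > 0"
    and \<theta>: "orientation_form (2 * CARD('n)) (anti_de_sitter_surface k) \<theta>"
    and X: "sub_laplacian_diffusion (anti_de_sitter k) (anti_de_sitter_surface k) \<theta> P F \<zeta> X"
  shows "hyperbolic_bessel_process k (2 * CARD('n) + 1) P F \<zeta> (\<lambda>t w. anti_de_sitter_radius k (X t w))"
proof -
  define I where "I = {0 :: real<..}"
  define B where "B = {a \<in> {0 :: real<..}. - 1 * (1 - a\<^sup>2) > 0}"
  \<comment> \<open>The sheet condition a > 0 turns a^2 > 1 into a > 1.\<close>
  have B: "a \<in> B \<longleftrightarrow> 1 < a" for a
    using power2_less_imp_less[of 1 a] power_strict_mono[of 1 a 2] by (auto simp: B_def)
  have sinh: "sqrt ((cosh (k * t))\<^sup>2 - 1) = sinh (k * t)" "0 < sinh (k * t)" if "t \<in> I" for t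
    using that k by (simp_all add: cosh_square_eq I_def)
  interpret quadric_radius "-1" k "{0<..}" B I "\<lambda>t. cosh (k * t)" "\<lambda>a. arcosh a / k"
  proof
    show "B = {a \<in> {0<..}. 0 < - 1 * (1 - a\<^sup>2)}" by (simp add: B_def)
    show "continuous_on I (\<lambda>t. cosh (k * t))" by (intro continuous_intros)
    show "cosh (k * t) \<in> B" if "t \<in> I" for t
      using k that by (simp add: I_def B_def cosh_square_eq)
    show "arcosh (cosh (k * t)) / k = t" if "t \<in> I" for t
      using that k by (simp add: I_def arcosh_cosh_real)
    show "arcosh a / k \<in> I" if "a \<in> B" for a
      using arcosh_real_strict_mono[of 1 a] that k by (auto simp: B I_def)
    show "cosh (k * (arcosh a / k)) = a" if "a \<in> B" for a
      using that k by (simp add: B cosh_arcosh_real)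
    show "((\<lambda>a. arcosh a / k) has_real_derivative - (- 1) / (k * sqrt (- 1 * (1 - a\<^sup>2)))) (at a)"
      if "a \<in> B" for a
      using that arcosh_real_has_field_derivative[of a UNIV, THEN DERIV_cdivide, of k] by (simp add: B field_simps)
  qed (use k in \<open>auto simp: I_def\<close>)
  have radius: "anti_de_sitter_radius k p = arcosh (coord_a p) / k" if "p \<in> E"
    for p :: "(real^'n) \<times> (real^'n) \<times> real \<times> real"
    unfolding anti_de_sitter_radius_def split_beta coord_a_def[symmetric]
    using c_\<rho>[OF E_D(4)[OF that]] \<rho>_in[OF E_D(4)[OF that]] \<rho>_c
    by (intro the_equality) (auto simp: I_def)
  show ?thesis
    unfolding hyperbolic_bessel_process_def I_def[symmetric]
    using \<theta> X unfolding anti_de_sitter_eq anti_de_sitter_surface_eq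
    by (intro diffusion_radial_part[OF radius]) (simp_all add: sinh)
qed

theorem theorem7:
  fixes k :: real
    and P :: "'w measure" and F :: "real \<Rightarrow> 'w measure" and \<zeta> :: "'w \<Rightarrow> ereal"
  assumes k: "k > 0"
  shows
    "(\<forall>\<theta> (X :: real \<Rightarrow> 'w \<Rightarrow> (real^'n::finite) \<times> (real^'n) \<times> real).
        orientation_form (2 * CARD('n)) heisenberg_surface \<theta> \<longrightarrow>
        sub_laplacian_diffusion heisenberg heisenberg_surface \<theta> P F \<zeta> X \<longrightarrow>
        bessel_process (2 * CARD('n) + 1) P F \<zeta> (\<lambda>t w. heisenberg_radius (X t w)))
   \<and> (\<forall>\<theta> (X :: real \<Rightarrow> 'w \<Rightarrow> (real^'n) \<times> (real^'n) \<times> real \<times> real).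
        orientation_form (2 * CARD('n)) (sphere_surface k) \<theta> \<longrightarrow>
        sub_laplacian_diffusion (sphere_model k) (sphere_surface k) \<theta> P F \<zeta> X \<longrightarrow>
        legendre_process k (2 * CARD('n) + 1) P F \<zeta> (\<lambda>t w. sphere_radius k (X t w)))
   \<and> (\<forall>\<theta> (X :: real \<Rightarrow> 'w \<Rightarrow> (real^'n) \<times> (real^'n) \<times> real \<times> real).
        orientation_form (2 * CARD('n)) (anti_de_sitter_surface k) \<theta> \<longrightarrow>
        sub_laplacian_diffusion (anti_de_sitter k) (anti_de_sitter_surface k) \<theta> P F \<zeta> X \<longrightarrow>
        hyperbolic_bessel_process k (2 * CARD('n) + 1) P F \<zeta> (\<lambda>t w. anti_de_sitter_radius k (X t w)))"
  using heisenberg_bessel sphere_legendre[OF k] anti_de_sitter_hyperbolic_bessel[OF k] by blast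

end
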